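(* Let $(\underline{\mathcal{M}},\underline{\mathcal{W}},\underline{\mathcal{F}},\underline{\mathcal{C}})$ be an $\omega$-combinatorial left proper model category. Let $\mathcal{M}$ denote the full subcategory of $\underline{\mathcal{M}}$ spanned by the finitely presentable objects, and let $\mathcal{W}$ denote the class of weak equivalences between objects of $\mathcal{M}$. Suppose we are given a cylinder object in $\mathcal{M}$, that is, for every object $B$ of $\mathcal{M}$ we are given a factorization in $\mathcal{M}$ of the fold map $B\sqcup B\to B$ into a cofibration followed by a weak equivalence: $$B\sqcup B\xrightarrow{(i_0,i_1)} I\otimes B\xrightarrow{p} B.$$ (No simplicial structure is assumed; $I\otimes B$ is just notation.) Assume further: 1. The category $\mathcal{M}$ has finite limits. 2. Every object of $\mathcal{M}$ is cofibrant. 3. For every morphism $f:A\to B$ in $\mathcal{M}$, the map $B\coprod_{A}(I\otimes A)\to B$ from the pushout of $B\xleftarrow{f}A\xrightarrow{i_0}I\otimes A$, induced by $\mathrm{id}_B:B\to B$ and $f\circ p: I\otimes A\to B$, is a right proper map in $(\mathcal{M},\mathcal{W})$. Then the full subcategory of the morphism category $\underline{\mathcal{M}}^{\to}$ of $\underline{\mathcal{M}}$ spanned by the class of weak equivalences $\underline{\mathcal{W}}$ is finitely accessible.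
   Context: In the quadruple, $\underline{\mathcal{W}},\underline{\mathcal{F}},\underline{\mathcal{C}}$ are the weak equivalences, fibrations and cofibrations. Model categories are taken in Hovey's sense (in particular with functorial factorizations). A model category is combinatorial if it is locally presentable and cofibrantly generated. It is $\omega$-combinatorial if it is combinatorial, its underlying category is locally finitely presentable, and both its cofibrations and its trivial cofibrations are generated by sets of morphisms having finitely presentable ($\omega$-presentable) domains and codomains. A relative category is a pair $(\mathcal{D},\mathcal{V})$ with $\mathcal{D}$ a category and $\mathcal{V}\subseteq\mathcal{D}$ a subcategory containing all isomorphisms and satisfying the two out of three property; maps in $\mathcal{V}$ are called weak equivalences. A map $f:A\to B$ in $\mathcal{D}$ is right proper in $(\mathcal{D},\mathcal{V})$ if for every pullback square in $\mathcal{D}$ with $i:D\to B$ a weak equivalence and $j:C\to A$ its base change along $f$ (so $C=A\times_B D$), the map $j$ is also a weak equivalence. For a category $\mathcal{D}$, $\mathcal{D}^{\to}$ is the category of morphisms of $\mathcal{D}$ (commutative squares as morphisms). A category is finitely accessible if it has filtered colimits and there is a small set of finitely presentable objects that generates it under filtered colimits. *)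

theory Defs
  imports Main "HOL-Library.Equipollence"
begin

section \<open>Smallness\<close>

text \<open>
  The distinction between small and large is made relative to a Grothendieck universe.  The
  universe is represented by a type \<open>'u\<close> whose cardinality is a strongly inaccessible cardinal
  (predicate \<open>universe\<close>); a set of any type is small if it has fewer elements than \<open>'u\<close>.
  A small category is isomorphic to one whose objects and morphisms are elements
  of \<open>'u\<close>, so quantifying over small diagrams means quantifying over index categories of
  type \<open>('u, 'u) cat\<close>.  Objects and morphisms of a large category may have arbitrary types.
\<close>

definition small :: "'u itself \<Rightarrow> 'a set \<Rightarrow> bool" where
  "small (U :: 'u itself) A \<longleftrightarrow> A \<prec> (UNIV :: 'u set)"

definition universe :: "'u itself \<Rightarrow> bool" where
  "universe (U :: 'u itself) \<longleftrightarrow>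
     small U (UNIV :: nat set) \<and>
     (\<forall>A :: 'u set. small U A \<longrightarrow> small U (Pow A)) \<and>
     (\<forall>(A :: 'u set) (F :: 'u \<Rightarrow> 'u set).
        small U A \<and> (\<forall>a\<in>A. small U (F a)) \<longrightarrow> small U (\<Union>a\<in>A. F a))"


section \<open>Categories and functors\<close>

record ('o, 'm) cat =
  Obj :: "'o set"
  Mor :: "'m set"
  Dom :: "'m \<Rightarrow> 'o"
  Cod :: "'m \<Rightarrow> 'o"
  Ident :: "'o \<Rightarrow> 'm"
  Comp :: "'m \<Rightarrow> 'm \<Rightarrow> 'm"  (infixl \<open>\<cdot>\<index>\<close> 70)

definition hom :: "('o, 'm) cat \<Rightarrow> 'o \<Rightarrow> 'o \<Rightarrow> 'm set" where
  "hom C a b = {f \<in> Mor C. Dom C f = a \<and> Cod C f = b}"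

locale category =
  fixes C :: "('o, 'm) cat" (structure)
  assumes dom_obj: "f \<in> Mor C \<Longrightarrow> Dom C f \<in> Obj C"
    and cod_obj: "f \<in> Mor C \<Longrightarrow> Cod C f \<in> Obj C"
    and ident_hom: "a \<in> Obj C \<Longrightarrow> Ident C a \<in> hom C a a"
    and comp_hom: "f \<in> hom C a b \<Longrightarrow> g \<in> hom C b c \<Longrightarrow> g \<cdot> f \<in> hom C a c"
    and comp_ident: "f \<in> hom C a b \<Longrightarrow> f \<cdot> Ident C a = f"
    and ident_comp: "f \<in> hom C a b \<Longrightarrow> Ident C b \<cdot> f = f"
    and comp_assoc: "f \<in> hom C a b \<Longrightarrow> g \<in> hom C b c \<Longrightarrow> h \<in> hom C c d \<Longrightarrow>
                       (h \<cdot> g) \<cdot> f = h \<cdot> (g \<cdot> f)"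

definition locally_small :: "'u itself \<Rightarrow> ('o, 'm) cat \<Rightarrow> bool" where
  "locally_small U C \<longleftrightarrow> (\<forall>a\<in>Obj C. \<forall>b\<in>Obj C. small U (hom C a b))"

definition small_category :: "'u itself \<Rightarrow> ('u, 'u) cat \<Rightarrow> bool" where
  "small_category U J \<longleftrightarrow> category J \<and> small U (Obj J) \<and> small U (Mor J)"

definition full_subcategory :: "('o, 'm) cat \<Rightarrow> 'o set \<Rightarrow> ('o, 'm) cat" where
  "full_subcategory C S =
     C\<lparr>Obj := Obj C \<inter> S, Mor := {f \<in> Mor C. Dom C f \<in> S \<and> Cod C f \<in> S}\<rparr>"

text \<open>
  The category of morphisms.  A tuple \<open>(f, g, u, v)\<close> is the commutative square from \<open>f\<close> to \<open>g\<close>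
  with \<open>u\<close> between the domains and \<open>v\<close> between the codomains.
\<close>

definition arrow_category :: "('o, 'm) cat \<Rightarrow> ('m, 'm \<times> 'm \<times> 'm \<times> 'm) cat" where
  "arrow_category C =
     \<lparr>Obj = Mor C,
      Mor = {(f, g, u, v). f \<in> Mor C \<and> g \<in> Mor C \<and>
               u \<in> hom C (Dom C f) (Dom C g) \<and> v \<in> hom C (Cod C f) (Cod C g) \<and>
               g \<cdot>\<^bsub>C\<^esub> u = v \<cdot>\<^bsub>C\<^esub> f},
      Dom = (\<lambda>(f, g, u, v). f),
      Cod = (\<lambda>(f, g, u, v). g),
      Ident = (\<lambda>f. (f, f, Ident C (Dom C f), Ident C (Cod C f))),
      Comp = (\<lambda>(g, h, u', v') (f, g', u, v). (f, h, u' \<cdot>\<^bsub>C\<^esub> u, v' \<cdot>\<^bsub>C\<^esub> v))\<rparr>"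

lemma category_full_subcategory:
  assumes "category C"
  shows "category (full_subcategory C S)"
proof -
  interpret category C by fact
  show ?thesis
    using dom_obj cod_obj ident_hom comp_hom comp_ident ident_comp comp_assoc
    by unfold_locales (auto simp: full_subcategory_def hom_def)
qed

lemma category_arrow_category:
  assumes "category C"
  shows "category (arrow_category C)"
proof -
  interpret category C by fact
  have sq: "h \<cdot>\<^bsub>C\<^esub> (u' \<cdot>\<^bsub>C\<^esub> u) = (v' \<cdot>\<^bsub>C\<^esub> v) \<cdot>\<^bsub>C\<^esub> f"
    if "f \<in> Mor C" "g \<in> Mor C" "h \<in> Mor C" "u \<in> hom C (Dom C f) (Dom C g)"
      "v \<in> hom C (Cod C f) (Cod C g)" "u' \<in> hom C (Dom C g) (Dom C h)"
      "v' \<in> hom C (Cod C g) (Cod C h)"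
      "g \<cdot>\<^bsub>C\<^esub> u = v \<cdot>\<^bsub>C\<^esub> f" "h \<cdot>\<^bsub>C\<^esub> u' = v' \<cdot>\<^bsub>C\<^esub> g"
    for f g h u v u' v'
  proof -
    have mem: "f \<in> hom C (Dom C f) (Cod C f)" "g \<in> hom C (Dom C g) (Cod C g)"
      "h \<in> hom C (Dom C h) (Cod C h)"
      using that by (auto simp: hom_def)
    show ?thesis
      using comp_assoc[OF that(4,6) mem(3)] comp_assoc[OF that(4) mem(2) that(7)]
        comp_assoc[OF mem(1) that(5,7)] that(8,9) by simp
  qed
  have id_sq: "f \<cdot>\<^bsub>C\<^esub> Ident C (Dom C f) = Ident C (Cod C f) \<cdot>\<^bsub>C\<^esub> f" if "f \<in> Mor C" for f
    using that comp_ident[of f] ident_comp[of f] by (simp add: hom_def)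
  show ?thesis
    using dom_obj cod_obj ident_hom comp_hom comp_ident ident_comp comp_assoc
    by unfold_locales (auto simp: arrow_category_def hom_def[of "arrow_category C" for C]
        hom_def[of "\<lparr>Obj = A, Mor = B, Dom = d, Cod = c, Ident = i, Comp = k\<rparr>" for A B d c i k]
        sq id_sq)
qed

record ('o1, 'm1, 'o2, 'm2) fctr =
  fobj :: "'o1 \<Rightarrow> 'o2"
  fmor :: "'m1 \<Rightarrow> 'm2"

definition is_functor ::
  "('o1, 'm1) cat \<Rightarrow> ('o2, 'm2) cat \<Rightarrow> ('o1, 'm1, 'o2, 'm2) fctr \<Rightarrow> bool" where
  "is_functor C D F \<longleftrightarrow>
     (\<forall>a\<in>Obj C. fobj F a \<in> Obj D) \<and>
     (\<forall>a b. \<forall>f\<in>hom C a b. fmor F f \<in> hom D (fobj F a) (fobj F b)) \<and>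
     (\<forall>a\<in>Obj C. fmor F (Ident C a) = Ident D (fobj F a)) \<and>
     (\<forall>a b c. \<forall>f\<in>hom C a b. \<forall>g\<in>hom C b c.
        fmor F (g \<cdot>\<^bsub>C\<^esub> f) = fmor F g \<cdot>\<^bsub>D\<^esub> fmor F f)"


section \<open>Limits and colimits\<close>

definition is_cocone ::
  "('j, 'k) cat \<Rightarrow> ('o, 'm) cat \<Rightarrow> ('j, 'k, 'o, 'm) fctr \<Rightarrow> 'o \<Rightarrow> ('j \<Rightarrow> 'm) \<Rightarrow> bool" where
  "is_cocone J C D c l \<longleftrightarrow> c \<in> Obj C \<and>
     (\<forall>j\<in>Obj J. l j \<in> hom C (fobj D j) c) \<and>
     (\<forall>j k. \<forall>u\<in>hom J j k. l k \<cdot>\<^bsub>C\<^esub> fmor D u = l j)"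

definition is_colimit ::
  "('j, 'k) cat \<Rightarrow> ('o, 'm) cat \<Rightarrow> ('j, 'k, 'o, 'm) fctr \<Rightarrow> 'o \<Rightarrow> ('j \<Rightarrow> 'm) \<Rightarrow> bool" where
  "is_colimit J C D c l \<longleftrightarrow> is_cocone J C D c l \<and>
     (\<forall>c' l'. is_cocone J C D c' l' \<longrightarrow>
        (\<exists>!h. h \<in> hom C c c' \<and> (\<forall>j\<in>Obj J. h \<cdot>\<^bsub>C\<^esub> l j = l' j)))"

definition is_cone ::
  "('j, 'k) cat \<Rightarrow> ('o, 'm) cat \<Rightarrow> ('j, 'k, 'o, 'm) fctr \<Rightarrow> 'o \<Rightarrow> ('j \<Rightarrow> 'm) \<Rightarrow> bool" where
  "is_cone J C D c l \<longleftrightarrow> c \<in> Obj C \<and>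
     (\<forall>j\<in>Obj J. l j \<in> hom C c (fobj D j)) \<and>
     (\<forall>j k. \<forall>u\<in>hom J j k. fmor D u \<cdot>\<^bsub>C\<^esub> l j = l k)"

definition is_limit ::
  "('j, 'k) cat \<Rightarrow> ('o, 'm) cat \<Rightarrow> ('j, 'k, 'o, 'm) fctr \<Rightarrow> 'o \<Rightarrow> ('j \<Rightarrow> 'm) \<Rightarrow> bool" where
  "is_limit J C D c l \<longleftrightarrow> is_cone J C D c l \<and>
     (\<forall>c' l'. is_cone J C D c' l' \<longrightarrow>
        (\<exists>!h. h \<in> hom C c' c \<and> (\<forall>j\<in>Obj J. l j \<cdot>\<^bsub>C\<^esub> h = l' j)))"

definition has_colimits_of_shape :: "('j, 'k) cat \<Rightarrow> ('o, 'm) cat \<Rightarrow> bool" where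
  "has_colimits_of_shape J C \<longleftrightarrow> (\<forall>D. is_functor J C D \<longrightarrow> (\<exists>c l. is_colimit J C D c l))"

definition has_limits_of_shape :: "('j, 'k) cat \<Rightarrow> ('o, 'm) cat \<Rightarrow> bool" where
  "has_limits_of_shape J C \<longleftrightarrow> (\<forall>D. is_functor J C D \<longrightarrow> (\<exists>c l. is_limit J C D c l))"

definition small_cocomplete :: "'u itself \<Rightarrow> ('o, 'm) cat \<Rightarrow> bool" where
  "small_cocomplete U C \<longleftrightarrow> (\<forall>J. small_category U J \<longrightarrow> has_colimits_of_shape J C)"

definition small_complete :: "'u itself \<Rightarrow> ('o, 'm) cat \<Rightarrow> bool" where
  "small_complete U C \<longleftrightarrow> (\<forall>J. small_category U J \<longrightarrow> has_limits_of_shape J C)"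

definition has_finite_limits :: "('o, 'm) cat \<Rightarrow> bool" where
  "has_finite_limits C \<longleftrightarrow>
     (\<forall>J :: (nat, nat) cat. category J \<and> finite (Obj J) \<and> finite (Mor J) \<longrightarrow>
        has_limits_of_shape J C)"

definition is_initial :: "('o, 'm) cat \<Rightarrow> 'o \<Rightarrow> bool" where
  "is_initial C z \<longleftrightarrow> z \<in> Obj C \<and> (\<forall>a\<in>Obj C. \<exists>!f. f \<in> hom C z a)"

definition is_coproduct :: "('o, 'm) cat \<Rightarrow> 'o \<Rightarrow> 'o \<Rightarrow> 'o \<Rightarrow> 'm \<Rightarrow> 'm \<Rightarrow> bool" where
  "is_coproduct C a b s in0 in1 \<longleftrightarrow>
     in0 \<in> hom C a s \<and> in1 \<in> hom C b s \<and>
     (\<forall>x. \<forall>f\<in>hom C a x. \<forall>g\<in>hom C b x.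
        \<exists>!h. h \<in> hom C s x \<and> h \<cdot>\<^bsub>C\<^esub> in0 = f \<and> h \<cdot>\<^bsub>C\<^esub> in1 = g)"

text \<open>
  \<open>is_pushout C f g i j\<close>: the square \<open>i f = j g\<close> is a pushout, with \<open>f\<close>, \<open>g\<close> the given span, so
  that \<open>j\<close> is the cobase change of \<open>f\<close> along \<open>g\<close>.  Dually, in \<open>is_pullback C f g i j\<close> the given
  cospan is \<open>f\<close>, \<open>g\<close>, the square is \<open>f i = g j\<close>, and \<open>i\<close> is the base change of \<open>g\<close> along \<open>f\<close>.
\<close>

definition is_pushout :: "('o, 'm) cat \<Rightarrow> 'm \<Rightarrow> 'm \<Rightarrow> 'm \<Rightarrow> 'm \<Rightarrow> bool" where
  "is_pushout C f g i j \<longleftrightarrow>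
     (\<exists>a b c s. f \<in> hom C a b \<and> g \<in> hom C a c \<and> i \<in> hom C b s \<and> j \<in> hom C c s \<and>
        i \<cdot>\<^bsub>C\<^esub> f = j \<cdot>\<^bsub>C\<^esub> g \<and>
        (\<forall>x. \<forall>i'\<in>hom C b x. \<forall>j'\<in>hom C c x. i' \<cdot>\<^bsub>C\<^esub> f = j' \<cdot>\<^bsub>C\<^esub> g \<longrightarrow>
           (\<exists>!h. h \<in> hom C s x \<and> h \<cdot>\<^bsub>C\<^esub> i = i' \<and> h \<cdot>\<^bsub>C\<^esub> j = j')))"

definition is_pullback :: "('o, 'm) cat \<Rightarrow> 'm \<Rightarrow> 'm \<Rightarrow> 'm \<Rightarrow> 'm \<Rightarrow> bool" where
  "is_pullback C f g i j \<longleftrightarrow>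
     (\<exists>a b c s. f \<in> hom C b a \<and> g \<in> hom C c a \<and> i \<in> hom C s b \<and> j \<in> hom C s c \<and>
        f \<cdot>\<^bsub>C\<^esub> i = g \<cdot>\<^bsub>C\<^esub> j \<and>
        (\<forall>x. \<forall>i'\<in>hom C x b. \<forall>j'\<in>hom C x c. f \<cdot>\<^bsub>C\<^esub> i' = g \<cdot>\<^bsub>C\<^esub> j' \<longrightarrow>
           (\<exists>!h. h \<in> hom C x s \<and> i \<cdot>\<^bsub>C\<^esub> h = i' \<and> j \<cdot>\<^bsub>C\<^esub> h = j')))"


section \<open>Finite presentability and accessibility\<close>

definition filtered :: "('j, 'k) cat \<Rightarrow> bool" where
  "filtered J \<longleftrightarrow> Obj J \<noteq> {} \<and>
     (\<forall>a\<in>Obj J. \<forall>b\<in>Obj J. \<exists>c\<in>Obj J. hom J a c \<noteq> {} \<and> hom J b c \<noteq> {}) \<and>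
     (\<forall>a b. \<forall>f\<in>hom J a b. \<forall>g\<in>hom J a b. \<exists>c. \<exists>h\<in>hom J b c. h \<cdot>\<^bsub>J\<^esub> f = h \<cdot>\<^bsub>J\<^esub> g)"

text \<open>
  The colimit of the set-valued diagram \<open>j \<mapsto> hom C x (D j)\<close>, formed as the quotient of the
  disjoint union by the equivalence relation generated by \<open>(j, g) \<sim> (k, D u \<cdot> g)\<close> for
  \<open>u : j \<rightarrow> k\<close>.  For a cocone \<open>l\<close> with apex \<open>c\<close>, the canonical map to \<open>hom C x c\<close> sends the
  class of \<open>(j, g)\<close> to \<open>l j \<cdot> g\<close>.
\<close>

definition colim_hom_step ::
  "('j, 'k) cat \<Rightarrow> ('o, 'm) cat \<Rightarrow> ('j, 'k, 'o, 'm) fctr \<Rightarrow> 'o \<Rightarrow> (('j \<times> 'm) \<times> ('j \<times> 'm)) set"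
  where
  "colim_hom_step J C D x =
     {((j, g), (k, fmor D u \<cdot>\<^bsub>C\<^esub> g)) | j k u g. u \<in> hom J j k \<and> g \<in> hom C x (fobj D j)}"

definition colim_hom ::
  "('j, 'k) cat \<Rightarrow> ('o, 'm) cat \<Rightarrow> ('j, 'k, 'o, 'm) fctr \<Rightarrow> 'o \<Rightarrow> ('j \<times> 'm) set set" where
  "colim_hom J C D x =
     (SIGMA j:Obj J. hom C x (fobj D j)) //
       (colim_hom_step J C D x \<union> (colim_hom_step J C D x)\<inverse>)\<^sup>*"

definition colim_hom_map :: "('o, 'm) cat \<Rightarrow> ('j \<Rightarrow> 'm) \<Rightarrow> ('j \<times> 'm) set \<Rightarrow> 'm" where
  "colim_hom_map C l K = the_elem ((\<lambda>(j, g). l j \<cdot>\<^bsub>C\<^esub> g) ` K)"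

definition finitely_presentable :: "'u itself \<Rightarrow> ('o, 'm) cat \<Rightarrow> 'o \<Rightarrow> bool" where
  "finitely_presentable (U :: 'u itself) C x \<longleftrightarrow> x \<in> Obj C \<and>
     (\<forall>(J :: ('u, 'u) cat) D c l.
        small_category U J \<and> filtered J \<and> is_functor J C D \<and> is_colimit J C D c l \<longrightarrow>
        bij_betw (colim_hom_map C l) (colim_hom J C D x) (hom C x c))"

definition has_filtered_colimits :: "'u itself \<Rightarrow> ('o, 'm) cat \<Rightarrow> bool" where
  "has_filtered_colimits U C \<longleftrightarrow>
     (\<forall>J. small_category U J \<and> filtered J \<longrightarrow> has_colimits_of_shape J C)"

definition generates_under_filtered_colimits ::
  "'u itself \<Rightarrow> ('o, 'm) cat \<Rightarrow> 'o set \<Rightarrow> bool" where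
  "generates_under_filtered_colimits (U :: 'u itself) C S \<longleftrightarrow>
     (\<forall>x\<in>Obj C. \<exists>(J :: ('u, 'u) cat) D l.
        small_category U J \<and> filtered J \<and> is_functor J C D \<and>
        (\<forall>j\<in>Obj J. fobj D j \<in> S) \<and> is_colimit J C D x l)"

definition finitely_accessible :: "'u itself \<Rightarrow> ('o, 'm) cat \<Rightarrow> bool" where
  "finitely_accessible U C \<longleftrightarrow>
     category C \<and> locally_small U C \<and> has_filtered_colimits U C \<and>
     (\<exists>S. small U S \<and> (\<forall>x\<in>S. finitely_presentable U C x) \<and>
          generates_under_filtered_colimits U C S)"

definition locally_finitely_presentable :: "'u itself \<Rightarrow> ('o, 'm) cat \<Rightarrow> bool" where
  "locally_finitely_presentable U C \<longleftrightarrow> finitely_accessible U C \<and> small_cocomplete U C"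

definition fp_category :: "'u itself \<Rightarrow> ('o, 'm) cat \<Rightarrow> ('o, 'm) cat" where
  "fp_category U C = full_subcategory C {x. finitely_presentable U C x}"


section \<open>Model categories\<close>

definition wide_subcategory :: "('o, 'm) cat \<Rightarrow> 'm set \<Rightarrow> bool" where
  "wide_subcategory C S \<longleftrightarrow> S \<subseteq> Mor C \<and>
     (\<forall>a\<in>Obj C. Ident C a \<in> S) \<and>
     (\<forall>f\<in>S. \<forall>g\<in>S. Cod C f = Dom C g \<longrightarrow> g \<cdot>\<^bsub>C\<^esub> f \<in> S)"

definition two_out_of_three :: "('o, 'm) cat \<Rightarrow> 'm set \<Rightarrow> bool" where
  "two_out_of_three C S \<longleftrightarrow>
     (\<forall>a b c. \<forall>f\<in>hom C a b. \<forall>g\<in>hom C b c.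
        (f \<in> S \<and> g \<in> S \<longrightarrow> g \<cdot>\<^bsub>C\<^esub> f \<in> S) \<and>
        (f \<in> S \<and> g \<cdot>\<^bsub>C\<^esub> f \<in> S \<longrightarrow> g \<in> S) \<and>
        (g \<in> S \<and> g \<cdot>\<^bsub>C\<^esub> f \<in> S \<longrightarrow> f \<in> S))"

definition is_retract :: "('o, 'm) cat \<Rightarrow> 'o \<Rightarrow> 'o \<Rightarrow> bool" where
  "is_retract C a b \<longleftrightarrow> (\<exists>s\<in>hom C a b. \<exists>r\<in>hom C b a. r \<cdot>\<^bsub>C\<^esub> s = Ident C a)"

definition closed_under_retracts :: "('o, 'm) cat \<Rightarrow> 'm set \<Rightarrow> bool" where
  "closed_under_retracts C S \<longleftrightarrow>
     (\<forall>f\<in>Mor C. \<forall>g\<in>S. is_retract (arrow_category C) f g \<longrightarrow> f \<in> S)"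

definition has_lifting :: "('o, 'm) cat \<Rightarrow> 'm \<Rightarrow> 'm \<Rightarrow> bool" where
  "has_lifting C i q \<longleftrightarrow>
     (\<forall>u\<in>hom C (Dom C i) (Dom C q). \<forall>v\<in>hom C (Cod C i) (Cod C q).
        q \<cdot>\<^bsub>C\<^esub> u = v \<cdot>\<^bsub>C\<^esub> i \<longrightarrow>
        (\<exists>h\<in>hom C (Cod C i) (Dom C q). h \<cdot>\<^bsub>C\<^esub> i = u \<and> q \<cdot>\<^bsub>C\<^esub> h = v))"

definition llp :: "('o, 'm) cat \<Rightarrow> 'm set \<Rightarrow> 'm set" where
  "llp C S = {i \<in> Mor C. \<forall>q\<in>S. has_lifting C i q}"

definition rlp :: "('o, 'm) cat \<Rightarrow> 'm set \<Rightarrow> 'm set" where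
  "rlp C S = {q \<in> Mor C. \<forall>i\<in>S. has_lifting C i q}"

text \<open>
  A functorial factorization is a pair of endofunctors of the category of morphisms such that
  every morphism, and compatibly every commutative square, is the composite of its two images.
\<close>

definition functorial_factorization ::
  "('o, 'm) cat \<Rightarrow> ('m, 'm \<times> 'm \<times> 'm \<times> 'm, 'm, 'm \<times> 'm \<times> 'm \<times> 'm) fctr \<Rightarrow>
   ('m, 'm \<times> 'm \<times> 'm \<times> 'm, 'm, 'm \<times> 'm \<times> 'm \<times> 'm) fctr \<Rightarrow> bool" where
  "functorial_factorization C \<alpha> \<beta> \<longleftrightarrow>
     is_functor (arrow_category C) (arrow_category C) \<alpha> \<and>
     is_functor (arrow_category C) (arrow_category C) \<beta> \<and>
     (\<forall>f\<in>Mor C. Dom C (fobj \<alpha> f) = Dom C f \<and> Cod C (fobj \<alpha> f) = Dom C (fobj \<beta> f) \<and>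
        Cod C (fobj \<beta> f) = Cod C f \<and> fobj \<beta> f \<cdot>\<^bsub>C\<^esub> fobj \<alpha> f = f) \<and>
     (\<forall>(f, g, u, v) \<in> Mor (arrow_category C).
        \<exists>w. fmor \<alpha> (f, g, u, v) = (fobj \<alpha> f, fobj \<alpha> g, u, w) \<and>
            fmor \<beta> (f, g, u, v) = (fobj \<beta> f, fobj \<beta> g, w, v))"

definition functorially_factors :: "('o, 'm) cat \<Rightarrow> 'm set \<Rightarrow> 'm set \<Rightarrow> bool" where
  "functorially_factors C L R \<longleftrightarrow>
     (\<exists>\<alpha> \<beta>. functorial_factorization C \<alpha> \<beta> \<and>
        (\<forall>f\<in>Mor C. fobj \<alpha> f \<in> L \<and> fobj \<beta> f \<in> R))"

definition model_category ::
  "'u itself \<Rightarrow> ('o, 'm) cat \<Rightarrow> 'm set \<Rightarrow> 'm set \<Rightarrow> 'm set \<Rightarrow> bool" where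
  "model_category U M W Fib Cof \<longleftrightarrow>
     category M \<and> small_complete U M \<and> small_cocomplete U M \<and>
     wide_subcategory M W \<and> wide_subcategory M Fib \<and> wide_subcategory M Cof \<and>
     two_out_of_three M W \<and>
     closed_under_retracts M W \<and> closed_under_retracts M Fib \<and> closed_under_retracts M Cof \<and>
     (\<forall>i\<in>Cof \<inter> W. \<forall>q\<in>Fib. has_lifting M i q) \<and>
     (\<forall>i\<in>Cof. \<forall>q\<in>Fib \<inter> W. has_lifting M i q) \<and>
     functorially_factors M Cof (Fib \<inter> W) \<and>
     functorially_factors M (Cof \<inter> W) Fib"

text \<open>
  \<open>I\<close> is a small set of morphisms between finitely presentable objects which generates the left
  class \<open>L\<close>, i.e. \<open>L\<close> is the class of maps with the left lifting property against all maps having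
  the right lifting property against \<open>I\<close>.
\<close>

definition omega_generated :: "'u itself \<Rightarrow> ('o, 'm) cat \<Rightarrow> 'm set \<Rightarrow> bool" where
  "omega_generated U M L \<longleftrightarrow>
     (\<exists>I. small U I \<and> I \<subseteq> Mor M \<and>
        (\<forall>i\<in>I. finitely_presentable U M (Dom M i) \<and> finitely_presentable U M (Cod M i)) \<and>
        L = llp M (rlp M I))"

text \<open>
  Local finite presentability contains local presentability (for the regular cardinal \<open>\<omega>\<close>), and
  then the smallness condition in the definition of ``cofibrantly generated'' is automatic; so
  ``combinatorial'' does not have to be listed separately.
\<close>

definition omega_combinatorial ::
  "'u itself \<Rightarrow> ('o, 'm) cat \<Rightarrow> 'm set \<Rightarrow> 'm set \<Rightarrow> 'm set \<Rightarrow> bool" where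
  "omega_combinatorial U M W Fib Cof \<longleftrightarrow>
     model_category U M W Fib Cof \<and> locally_finitely_presentable U M \<and>
     omega_generated U M Cof \<and> omega_generated U M (Cof \<inter> W)"

definition left_proper :: "('o, 'm) cat \<Rightarrow> 'm set \<Rightarrow> 'm set \<Rightarrow> bool" where
  "left_proper M W Cof \<longleftrightarrow>
     (\<forall>f g i j. is_pushout M f g i j \<and> f \<in> W \<and> g \<in> Cof \<longrightarrow> j \<in> W)"

definition cofibrant :: "('o, 'm) cat \<Rightarrow> 'm set \<Rightarrow> 'o \<Rightarrow> bool" where
  "cofibrant M Cof x \<longleftrightarrow> (\<exists>z f. is_initial M z \<and> f \<in> hom M z x \<and> f \<in> Cof)"

definition right_proper_map :: "('o, 'm) cat \<Rightarrow> 'm set \<Rightarrow> 'm \<Rightarrow> bool" where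
  "right_proper_map D V f \<longleftrightarrow> f \<in> Mor D \<and>
     (\<forall>i j k. is_pullback D f i j k \<and> i \<in> V \<longrightarrow> j \<in> V)"

text \<open>
  \<open>is_cylinder D V Cof b Ib i0 i1 p\<close>: in the category \<open>D\<close>, the map \<open>c = (i0, i1) : b \<squnion> b \<rightarrow> Ib\<close>
  followed by \<open>p\<close> factors the fold map \<open>d : b \<squnion> b \<rightarrow> b\<close> as a map of \<open>Cof\<close> followed by a map of \<open>V\<close>.
\<close>

definition is_cylinder ::
  "('o, 'm) cat \<Rightarrow> 'm set \<Rightarrow> 'm set \<Rightarrow> 'o \<Rightarrow> 'o \<Rightarrow> 'm \<Rightarrow> 'm \<Rightarrow> 'm \<Rightarrow> bool" where
  "is_cylinder D V Cof b Ib i0 i1 p \<longleftrightarrow>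
     (\<exists>s in0 in1 d c. is_coproduct D b b s in0 in1 \<and>
        d \<in> hom D s b \<and> d \<cdot>\<^bsub>D\<^esub> in0 = Ident D b \<and> d \<cdot>\<^bsub>D\<^esub> in1 = Ident D b \<and>
        c \<in> hom D s Ib \<and> c \<cdot>\<^bsub>D\<^esub> in0 = i0 \<and> c \<cdot>\<^bsub>D\<^esub> in1 = i1 \<and>
        p \<in> hom D Ib b \<and> p \<cdot>\<^bsub>D\<^esub> c = d \<and> c \<in> Cof \<and> p \<in> V)"

end

theory Submission
  imports Defs
begin

text \<open>
  A map \<open>f\<close> is called approximable by a class \<open>T\<close> of maps between finitely presentable objects if
  every commutative square from a map between finitely presentable objects to \<open>f\<close> factors through
  a member of \<open>T\<close>.  The key fact is that \<open>f\<close> is a weak equivalence if and only if it is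
  approximable by weak equivalences between finitely presentable objects.  Approximability passes
  to filtered colimits of morphisms, and it makes the category of those small weak equivalences over
  \<open>f\<close> filtered with colimit \<open>f\<close>.

  Trivial cofibrations are approximable by small trivial cofibrations, by the small object argument.
  A square into a trivial fibration factors through a mapping cylinder projection, by lifting.  For
  a general weak equivalence, written as a trivial cofibration followed by a trivial fibration, the
  two approximations are glued along a pushout, which is where left properness enters.  Conversely,
  if \<open>f = q i\<close> is approximable with \<open>i\<close> a trivial cofibration and \<open>q\<close> a fibration, then the
  approximations of \<open>f\<close> and \<open>i\<close> combine to lifts of the generating cofibrations against \<open>q\<close>.
\<close>

section \<open>Cardinality bookkeeping relative to the universe type\<close>

section \<open>Smallness\<close>

text \<open>Weak equivalences are not given as one side of a lifting property, so closure under
  filtered colimits cannot be read off from generators. The condition on squares is chosen because a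
  map between finitely presentable objects is finitely presentable in the arrow category: such a
  square descends to a stage of any filtered diagram. The obstacle in the gluing is that a pushout
  of a weak equivalence is under control only along a cofibration, while the maps to be glued are
  arbitrary. The functorial factorizations need not stay among finitely presentable objects; mapping
  cylinders do, being finite pushouts. Cofibrancy enters by making coproduct inclusions
  cofibrations. For trivial cofibrations the obstacle is that one stage of the small object argument
  attaches a whole small set of cells at once. The stage is therefore rebuilt as the filtered
  colimit of its finite subcomplexes, and finite presentability of the domains of the generators
  makes countably many stages enough.\<close>

lemma small_lepoll: "A \<lesssim> B \<Longrightarrow> small U B \<Longrightarrow> small U A"
  unfolding small_def using lesspoll_trans1 by blast

lemma small_subset: "A \<subseteq> B \<Longrightarrow> small U B \<Longrightarrow> small U A"
  by (meson small_lepoll subset_imp_lepoll)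

lemma small_image: "small U A \<Longrightarrow> small U (f ` A)"
  by (meson small_lepoll image_lepoll)

lemma small_inj:
  assumes "small (U :: 'u itself) A"
  obtains e :: "'a \<Rightarrow> 'u" where "inj_on e A"
  using assms unfolding small_def by (meson lepoll_def lesspoll_imp_lepoll)

lemma infinite_universe:
  assumes "universe (U :: 'u itself)"
  shows "infinite (UNIV :: 'u set)"
  using assms unfolding universe_def small_def
  by (meson infinite_le_lepoll lesspoll_imp_lepoll)

lemma small_finite: "universe U \<Longrightarrow> finite A \<Longrightarrow> small U A"
  unfolding small_def by (meson finite_lesspoll_infinite infinite_universe)

lemma small_nat_set: "universe U \<Longrightarrow> small U (A :: nat set)"
  unfolding universe_def by (meson small_subset subset_UNIV)

text \<open>The universe axioms speak only of subsets of \<open>'u\<close>, so \<open>A\<close> is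
  first moved there by an injection, which also embeds its power set.\<close>

lemma small_Pow:
  assumes "universe (U :: 'u itself)" and "small U A"
  shows "small U (Pow A)"
proof -
  obtain e :: "'a \<Rightarrow> 'u" where e: "inj_on e A"
    using small_inj[OF assms(2)] .
  have "small U (Pow (e ` A))"
    using assms small_image unfolding universe_def by blast
  moreover have "Pow A \<lesssim> Pow (e ` A)"
    unfolding lepoll_def using e inj_on_image_Pow image_Pow_surj by blast
  ultimately show ?thesis by (rule small_lepoll[rotated])
qed

text \<open>The union axiom concerns families of subsets of \<open>'u\<close> indexed by a subset of
  \<open>'u\<close>. A pairing \<open>\<pi>\<close> on the infinite type \<open>'u\<close> codes the
  dependent sum as such a union, the first coordinate being a tag that keeps the fibres
  apart.\<close>

lemma small_Sigma:
  assumes "universe (U :: 'u itself)" and "small U A" and "\<And>a. a \<in> A \<Longrightarrow> small U (F a)"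
  shows "small U (SIGMA a:A. F a)"
proof -
  have "(UNIV :: 'u set) \<times> (UNIV :: 'u set) \<lesssim> (UNIV :: 'u set)"
    using card_of_Times_same_infinite[OF infinite_universe[OF assms(1)]]
    by (metis eqpoll_iff_card_of_ordIso eqpoll_imp_lepoll)
  then obtain \<pi> :: "'u \<times> 'u \<Rightarrow> 'u" where \<pi>: "inj \<pi>"
    by (auto simp: lepoll_def)
  obtain e :: "'a \<Rightarrow> 'u" where e: "inj_on e A"
    using small_inj[OF assms(2)] .
  have "\<exists>h :: 'b \<Rightarrow> 'u. inj_on h (F a)" if "a \<in> A" for a
    using small_inj[OF assms(3)[OF that]] by metis
  then obtain h :: "'a \<Rightarrow> 'b \<Rightarrow> 'u" where h: "\<And>a. a \<in> A \<Longrightarrow> inj_on (h a) (F a)"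
    by metis
  define G where "G x = (\<lambda>b. \<pi> (x, h (inv_into A e x) b)) ` F (inv_into A e x)" for x
  have "small U (G x)" if "x \<in> e ` A" for x
    unfolding G_def by (rule small_image) (use that assms(3) e in auto)
  then have "small U (\<Union>x \<in> e ` A. G x)"
    using assms(1) small_image[OF assms(2), of e] unfolding universe_def by blast
  moreover have "(SIGMA a:A. F a) \<lesssim> (\<Union>x \<in> e ` A. G x)"
    unfolding lepoll_def
  proof (intro exI conjI)
    show "inj_on (\<lambda>(a, b). \<pi> (e a, h a b)) (SIGMA a:A. F a)"
    proof (rule inj_onI, clarify)
      fix a b a' b'
      assume ab: "a \<in> A" "b \<in> F a" "a' \<in> A" "b' \<in> F a'" "\<pi> (e a, h a b) = \<pi> (e a', h a' b')"
      then have "e a = e a'" "h a b = h a' b'" using injD[OF \<pi>] by blast+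
      then show "a = a' \<and> b = b'" using e h[OF ab(1)] ab(1-4) by (auto dest: inj_onD)
    qed
    show "(\<lambda>(a, b). \<pi> (e a, h a b)) ` (SIGMA a:A. F a) \<subseteq> (\<Union>x \<in> e ` A. G x)"
      by (auto simp: G_def e)
  qed
  ultimately show ?thesis by (rule small_lepoll[rotated])
qed

lemma small_Times: "universe U \<Longrightarrow> small U A \<Longrightarrow> small U B \<Longrightarrow> small U (A \<times> B)"
  by (rule small_Sigma)

lemma small_UN:
  assumes "universe U" and "small U A" and "\<And>a. a \<in> A \<Longrightarrow> small U (F a)"
  shows "small U (\<Union>a\<in>A. F a)"
proof -
  have "(\<Union>a\<in>A. F a) = snd ` (SIGMA a:A. F a)" by force
  then show ?thesis using small_image[OF small_Sigma[OF assms]] by simp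
qed

section \<open>Transport of diagrams along isomorphisms of index categories\<close>

section \<open>Change of index category\<close>

text \<open>The index categories built below (finite sets of cells, natural numbers, coslices, comma
  categories) live on types of their own, while finite presentability and cocompleteness range over
  index categories of type \<open>('u, 'u) cat\<close>. Isomorphisms of this kind move diagrams
  between the two.\<close>

definition index_iso ::
  "('a, 'b) cat \<Rightarrow> ('j, 'k) cat \<Rightarrow> ('a \<Rightarrow> 'j) \<Rightarrow> ('b \<Rightarrow> 'k) \<Rightarrow> bool" where
  "index_iso I J po pm \<longleftrightarrow>
     bij_betw po (Obj I) (Obj J) \<and> bij_betw pm (Mor I) (Mor J) \<and>
     (\<forall>f\<in>Mor I. Dom J (pm f) = po (Dom I f) \<and> Cod J (pm f) = po (Cod I f)) \<and>
     (\<forall>a\<in>Obj I. pm (Ident I a) = Ident J (po a)) \<and>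
     (\<forall>f\<in>Mor I. \<forall>g\<in>Mor I. Cod I f = Dom I g \<longrightarrow> pm (g \<cdot>\<^bsub>I\<^esub> f) = pm g \<cdot>\<^bsub>J\<^esub> pm f)"

definition reindex ::
  "('a \<Rightarrow> 'j) \<Rightarrow> ('b \<Rightarrow> 'k) \<Rightarrow> ('j, 'k, 'o, 'm) fctr \<Rightarrow> ('a, 'b, 'o, 'm) fctr" where
  "reindex po pm D = \<lparr>fobj = fobj D \<circ> po, fmor = fmor D \<circ> pm\<rparr>"

lemma small_index_iso:
  fixes J :: "('j, 'k) cat"
  assumes "category J" and "small (U :: 'u itself) (Obj J)" and "small U (Mor J)"
  obtains I :: "('u, 'u) cat" and po pm where "small_category U I" and "index_iso I J po pm"
proof -
  obtain e :: "'j \<Rightarrow> 'u" where e: "inj_on e (Obj J)" using small_inj[OF assms(2)] .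
  obtain m :: "'k \<Rightarrow> 'u" where m: "inj_on m (Mor J)" using small_inj[OF assms(3)] .
  interpret category J by fact
  define po where "po = inv_into (Obj J) e"
  define pm where "pm = inv_into (Mor J) m"
  define I :: "('u, 'u) cat" where
    "I = \<lparr>Obj = e ` Obj J, Mor = m ` Mor J, Dom = (\<lambda>x. e (Dom J (pm x))),
          Cod = (\<lambda>x. e (Cod J (pm x))), Ident = (\<lambda>a. m (Ident J (po a))),
          Comp = (\<lambda>g f. m (pm g \<cdot>\<^bsub>J\<^esub> pm f))\<rparr>"
  have po[simp]: "po (e a) = a" if "a \<in> Obj J" for a using that e by (simp add: po_def)
  have pm[simp]: "pm (m f) = f" if "f \<in> Mor J" for f using that m by (simp add: pm_def)
  have ih[simp]: "Ident J a \<in> Mor J" "Dom J (Ident J a) = a" "Cod J (Ident J a) = a"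
    if "a \<in> Obj J" for a using ident_hom[OF that] by (auto simp: hom_def)
  have ch[simp]: "g \<cdot>\<^bsub>J\<^esub> f \<in> Mor J" "Dom J (g \<cdot>\<^bsub>J\<^esub> f) = Dom J f" "Cod J (g \<cdot>\<^bsub>J\<^esub> f) = Cod J g"
    if "f \<in> Mor J" "g \<in> Mor J" "Cod J f = Dom J g" for f g
    using comp_hom[of f "Dom J f" "Cod J f" g "Cod J g"] that by (auto simp: hom_def)
  have e_eq[simp]: "e a = e b \<longleftrightarrow> a = b" if "a \<in> Obj J" "b \<in> Obj J" for a b
    using e that by (auto simp: inj_on_def)
  note [simp] = dom_obj cod_obj
  have "category I"
  proof
    fix f g h a b c d
    show "f \<in> Mor I \<Longrightarrow> Dom I f \<in> Obj I" "f \<in> Mor I \<Longrightarrow> Cod I f \<in> Obj I"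
      by (auto simp: I_def)
    show "a \<in> Obj I \<Longrightarrow> Ident I a \<in> hom I a a" by (auto simp: I_def hom_def)
    show "f \<in> hom I a b \<Longrightarrow> g \<in> hom I b c \<Longrightarrow> g \<cdot>\<^bsub>I\<^esub> f \<in> hom I a c"
      by (auto simp: I_def hom_def)
    show "f \<in> hom I a b \<Longrightarrow> f \<cdot>\<^bsub>I\<^esub> Ident I a = f"
      by (auto simp: I_def hom_def intro!: arg_cong[of _ _ m] comp_ident)
    show "f \<in> hom I a b \<Longrightarrow> Ident I b \<cdot>\<^bsub>I\<^esub> f = f"
      by (auto simp: I_def hom_def intro!: arg_cong[of _ _ m] ident_comp)
    show "f \<in> hom I a b \<Longrightarrow> g \<in> hom I b c \<Longrightarrow> h \<in> hom I c d \<Longrightarrow>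
        h \<cdot>\<^bsub>I\<^esub> g \<cdot>\<^bsub>I\<^esub> f = h \<cdot>\<^bsub>I\<^esub> (g \<cdot>\<^bsub>I\<^esub> f)"
      by (auto simp: I_def hom_def intro!: arg_cong[of _ _ m] comp_assoc)
  qed
  then have "small_category U I"
    unfolding small_category_def using assms by (simp add: I_def small_image)
  moreover have "index_iso I J po pm"
    unfolding index_iso_def
  proof (intro conjI ballI impI)
    show "bij_betw po (Obj I) (Obj J)"
      using bij_betw_inv_into[OF inj_on_imp_bij_betw[OF e]] by (simp add: I_def po_def)
    show "bij_betw pm (Mor I) (Mor J)"
      using bij_betw_inv_into[OF inj_on_imp_bij_betw[OF m]] by (simp add: I_def pm_def)
  qed (auto simp: I_def)
  ultimately show ?thesis by (rule that)
qed

text \<open>\<open>pm\<close> is onto all morphisms of \<open>J\<close> and \<open>po\<close> is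
  injective on objects, so the preimage of a morphism between \<open>po a\<close> and
  \<open>po b\<close> is forced to run from \<open>a\<close> to \<open>b\<close>.\<close>

lemma index_iso_hom:
  assumes "index_iso I J po pm" and "category J" and "category I"
  shows "a \<in> Obj I \<Longrightarrow> b \<in> Obj I \<Longrightarrow> hom J (po a) (po b) = pm ` hom I a b"
proof -
  assume ab: "a \<in> Obj I" "b \<in> Obj I"
  interpret J: category J by fact
  interpret I: category I by fact
  have inj: "po x = po y \<longleftrightarrow> x = y" if "x \<in> Obj I" "y \<in> Obj I" for x y
    using that assms(1) unfolding index_iso_def bij_betw_def inj_on_def by blast
  have "\<exists>f' \<in> Mor I. f = pm f'" if "f \<in> Mor J" for f
    using that assms(1) unfolding index_iso_def bij_betw_def by blast
  moreover have "pm f \<in> Mor J" if "f \<in> Mor I" for f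
    using that assms(1) unfolding index_iso_def bij_betw_def by blast
  ultimately show ?thesis
    using assms(1) ab I.dom_obj I.cod_obj unfolding index_iso_def hom_def
    by (auto simp: image_iff) (metis inj)+
qed

lemma index_iso_inv_into:
  assumes "index_iso I J po pm"
  shows "j \<in> Obj J \<Longrightarrow> inv_into (Obj I) po j \<in> Obj I \<and> po (inv_into (Obj I) po j) = j"
    and "i \<in> Obj I \<Longrightarrow> po i \<in> Obj J"
  using assms unfolding index_iso_def
  by (meson bij_betwE bij_betw_inv_into_right inv_into_into bij_betw_imp_surj_on
      bij_betw_def bij_betw_inv_into)+

lemma filtered_index_iso:
  assumes iso: "index_iso I J po pm" and J: "category J" and I: "category I" and "filtered J"
  shows "filtered I"
  unfolding filtered_def
proof (intro conjI ballI allI)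
  note ii = index_iso_inv_into[OF iso]
  note h = index_iso_hom[OF iso J I]
  interpret J: category J by fact
  interpret I: category I by fact
  show "Obj I \<noteq> {}"
    using ii(1) assms(4) unfolding filtered_def by blast
  show "\<exists>c\<in>Obj I. hom I a c \<noteq> {} \<and> hom I b c \<noteq> {}" if ab: "a \<in> Obj I" "b \<in> Obj I" for a b
  proof -
    obtain c where c: "c \<in> Obj J" "hom J (po a) c \<noteq> {}" "hom J (po b) c \<noteq> {}"
      using assms(4) ii(2)[OF ab(1)] ii(2)[OF ab(2)] unfolding filtered_def by blast
    then obtain c' where "c' \<in> Obj I" "c = po c'" using ii(1)[OF c(1)] by metis
    then show ?thesis using c h ab by auto
  qed
  show "\<exists>c. \<exists>k\<in>hom I b c. k \<cdot>\<^bsub>I\<^esub> f = k \<cdot>\<^bsub>I\<^esub> g" if fg: "f \<in> hom I a b" "g \<in> hom I a b" for a b f g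
  proof -
    have ab: "a \<in> Obj I" "b \<in> Obj I" using fg I.dom_obj I.cod_obj by (auto simp: hom_def)
    have "pm f \<in> hom J (po a) (po b)" "pm g \<in> hom J (po a) (po b)" using fg h[OF ab] by auto
    then obtain c k where k: "k \<in> hom J (po b) c" "k \<cdot>\<^bsub>J\<^esub> pm f = k \<cdot>\<^bsub>J\<^esub> pm g"
      using assms(4) unfolding filtered_def by meson
    then have "c \<in> Obj J" using J.cod_obj by (auto simp: hom_def)
    then obtain c' where c': "c' \<in> Obj I" "c = po c'" using ii(1) by metis
    then obtain k' where k': "k' \<in> hom I b c'" "k = pm k'" using k(1) h ab by auto
    have "pm (k' \<cdot>\<^bsub>I\<^esub> f) = pm (k' \<cdot>\<^bsub>I\<^esub> g)"
      using iso k' k(2) fg unfolding index_iso_def hom_def by auto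
    moreover have "k' \<cdot>\<^bsub>I\<^esub> f \<in> Mor I" "k' \<cdot>\<^bsub>I\<^esub> g \<in> Mor I"
      using I.comp_hom[OF fg(1) k'(1)] I.comp_hom[OF fg(2) k'(1)] by (auto simp: hom_def)
    ultimately have "k' \<cdot>\<^bsub>I\<^esub> f = k' \<cdot>\<^bsub>I\<^esub> g"
      using iso unfolding index_iso_def bij_betw_def inj_on_def by blast
    with k'(1) show ?thesis by blast
  qed
qed

lemma functor_reindex:
  assumes iso: "index_iso I J po pm" and J: "category J" and I: "category I"
    and "is_functor J C D"
  shows "is_functor I C (reindex po pm D)"
proof -
  note ii = index_iso_inv_into[OF iso]
  note h = index_iso_hom[OF iso J I]
  interpret J: category J by fact
  interpret I: category I by fact
  have hI: "a \<in> Obj I \<and> b \<in> Obj I \<and> pm f \<in> hom J (po a) (po b)" if "f \<in> hom I a b" for a b f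
    using that h I.dom_obj I.cod_obj by (auto simp: hom_def[of I])
  have "pm (g \<cdot>\<^bsub>I\<^esub> f) = pm g \<cdot>\<^bsub>J\<^esub> pm f" if "f \<in> hom I a b" "g \<in> hom I b c" for a b c f g
    using iso that unfolding index_iso_def hom_def by auto
  moreover have "pm (Ident I a) = Ident J (po a)" if "a \<in> Obj I" for a
    using iso that unfolding index_iso_def by auto
  ultimately show ?thesis
    using assms(4) hI ii(2) unfolding is_functor_def reindex_def by simp blast
qed

lemma cocone_reindex:
  assumes iso: "index_iso I J po pm" and J: "category J" and I: "category I"
  shows "is_cocone I C (reindex po pm D) c (l \<circ> po) \<longleftrightarrow> is_cocone J C D c l"
proof -
  note ii = index_iso_inv_into[OF iso]
  note h = index_iso_hom[OF iso J I]
  interpret J: category J by fact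
  interpret I: category I by fact
  have 1: "(\<forall>j\<in>Obj I. P (po j)) \<longleftrightarrow> (\<forall>j\<in>Obj J. P j)" for P
    using ii by metis
  have J': "u \<in> hom J j k \<Longrightarrow> j \<in> Obj J \<and> k \<in> Obj J" for u j k
    using J.dom_obj J.cod_obj by (auto simp: hom_def)
  have I': "u \<in> hom I j k \<Longrightarrow> j \<in> Obj I \<and> k \<in> Obj I" for u j k
    using I.dom_obj I.cod_obj by (auto simp: hom_def)
  have 2: "(\<forall>j k. \<forall>u\<in>hom I j k. Q (po j) (po k) (pm u)) \<longleftrightarrow> (\<forall>j k. \<forall>u\<in>hom J j k. Q j k u)" for Q
  proof (intro iffI allI ballI)
    fix j k u assume L: "\<forall>j k. \<forall>u\<in>hom I j k. Q (po j) (po k) (pm u)" and u: "u \<in> hom J j k"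
    obtain j' k' where jk: "j' \<in> Obj I" "k' \<in> Obj I" "j = po j'" "k = po k'"
      using J'[OF u] ii(1) by metis
    then obtain u' where "u' \<in> hom I j' k'" "u = pm u'" using u h by auto
    then show "Q j k u" using L jk by auto
  next
    fix j k u assume "\<forall>j k. \<forall>u\<in>hom J j k. Q j k u" and u: "u \<in> hom I j k"
    then show "Q (po j) (po k) (pm u)" using h I'[OF u] by auto
  qed
  show ?thesis
    unfolding is_cocone_def reindex_def
    using 1[of "\<lambda>j. l j \<in> hom C (fobj D j) c"]
      2[of "\<lambda>j k u. l k \<cdot>\<^bsub>C\<^esub> fmor D u = l j"] by simp
qed

lemma colimit_reindex:
  assumes iso: "index_iso I J po pm" and J: "category J" and I: "category I"
  shows "is_colimit I C (reindex po pm D) c (l \<circ> po) \<longleftrightarrow> is_colimit J C D c l"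
proof -
  note ii = index_iso_inv_into[OF iso]
  note cr = cocone_reindex[OF iso J I]
  interpret I: category I by fact
  \<comment> \<open>A cocone over \<open>I\<close> need not literally have the form
    \<open>l \<circ> po\<close>, because its legs form a total function. It agrees with such a
    cocone on \<open>Obj I\<close>, and \<open>is_cocone\<close> looks no further.\<close>
  have ext: "is_cocone I C (reindex po pm D) c' l' \<longleftrightarrow>
      is_cocone I C (reindex po pm D) c' (l' \<circ> inv_into (Obj I) po \<circ> po)" for c' l'
  proof -
    have l: "(l' \<circ> inv_into (Obj I) po \<circ> po) i = l' i" if "i \<in> Obj I" for i
      using iso that unfolding index_iso_def by (simp add: bij_betw_def inv_into_f_f)
    have "u \<in> hom I j k \<Longrightarrow> j \<in> Obj I \<and> k \<in> Obj I" for u j k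
      using I.dom_obj I.cod_obj by (auto simp: hom_def)
    then show ?thesis unfolding is_cocone_def using l by (metis (no_types, lifting))
  qed
  have 1: "(\<forall>j\<in>Obj I. h \<cdot>\<^bsub>C\<^esub> (l \<circ> po) j = (l' \<circ> po) j) \<longleftrightarrow> (\<forall>j\<in>Obj J. h \<cdot>\<^bsub>C\<^esub> l j = l' j)" for h l'
    using ii by (metis comp_apply)
  have l': "(\<forall>j\<in>Obj I. h \<cdot>\<^bsub>C\<^esub> (l \<circ> po) j = l' j) \<longleftrightarrow>
      (\<forall>j\<in>Obj I. h \<cdot>\<^bsub>C\<^esub> (l \<circ> po) j = (l' \<circ> inv_into (Obj I) po \<circ> po) j)" for h l'
    using iso unfolding index_iso_def by (simp add: bij_betw_def inv_into_f_f)
  show ?thesis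
    unfolding is_colimit_def cr
  proof (intro conj_cong refl iffI allI impI)
    fix c' l'
    assume "\<forall>c' l'. is_cocone I C (reindex po pm D) c' l' \<longrightarrow>
      (\<exists>!h. h \<in> hom C c c' \<and> (\<forall>j\<in>Obj I. h \<cdot>\<^bsub>C\<^esub> (l \<circ> po) j = l' j))"
      and "is_cocone J C D c' l'"
    then have "\<exists>!h. h \<in> hom C c c' \<and> (\<forall>j\<in>Obj I. h \<cdot>\<^bsub>C\<^esub> (l \<circ> po) j = (l' \<circ> po) j)"
      using iffD2[OF cr[where c=c' and l=l']] by metis
    then show "\<exists>!h. h \<in> hom C c c' \<and> (\<forall>j\<in>Obj J. h \<cdot>\<^bsub>C\<^esub> l j = l' j)"
      unfolding 1 .
  next
    fix c' l'
    assume L: "\<forall>c' l'. is_cocone J C D c' l' \<longrightarrow>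
      (\<exists>!h. h \<in> hom C c c' \<and> (\<forall>j\<in>Obj J. h \<cdot>\<^bsub>C\<^esub> l j = l' j))"
      and c': "is_cocone I C (reindex po pm D) c' l'"
    have l'': "(\<forall>j\<in>Obj I. h \<cdot>\<^bsub>C\<^esub> (l \<circ> po) j = l' j) \<longleftrightarrow>
        (\<forall>j\<in>Obj J. h \<cdot>\<^bsub>C\<^esub> l j = (l' \<circ> inv_into (Obj I) po) j)" for h
      using l'[of h l'] unfolding 1 .
    have "is_cocone J C D c' (l' \<circ> inv_into (Obj I) po)"
      by (rule iffD1[OF cr, OF iffD1[OF ext c']])
    then have "\<exists>!h. h \<in> hom C c c' \<and> (\<forall>j\<in>Obj J. h \<cdot>\<^bsub>C\<^esub> l j = (l' \<circ> inv_into (Obj I) po) j)"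
      using L by blast
    then show "\<exists>!h. h \<in> hom C c c' \<and> (\<forall>j\<in>Obj I. h \<cdot>\<^bsub>C\<^esub> (l \<circ> po) j = l' j)"
      unfolding l'' .
  qed
qed

section \<open>Rewriting of composites; uniqueness of maps out of colimits; filtered
  categories\<close>

section \<open>Composition\<close>

context category
begin

lemma homD: "f \<in> hom C a b \<Longrightarrow> f \<in> Mor C \<and> Dom C f = a \<and> Cod C f = b \<and> a \<in> Obj C \<and> b \<in> Obj C"
  using dom_obj cod_obj by (auto simp: hom_def)

lemma hom_Mor: "f \<in> Mor C \<Longrightarrow> f \<in> hom C (Dom C f) (Cod C f)"
  by (simp add: hom_def)

lemma comp_Mor [simp]:
  assumes "f \<in> Mor C" and "g \<in> Mor C" and "Cod C f = Dom C g"
  shows "g \<cdot> f \<in> Mor C" and "Dom C (g \<cdot> f) = Dom C f" and "Cod C (g \<cdot> f) = Cod C g"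
  using comp_hom[of f "Dom C f" "Cod C f" g "Cod C g"] assms by (auto simp: hom_def)

lemma ident_Mor [simp]:
  assumes "a \<in> Obj C"
  shows "Ident C a \<in> Mor C" and "Dom C (Ident C a) = a" and "Cod C (Ident C a) = a"
  using ident_hom[OF assms] by (auto simp: hom_def)

lemma assoc [simp]:
  assumes "f \<in> Mor C" and "g \<in> Mor C" and "h \<in> Mor C" and "Cod C f = Dom C g" and "Cod C g = Dom C h"
  shows "h \<cdot> g \<cdot> f = h \<cdot> (g \<cdot> f)"
  using comp_assoc[of f "Dom C f" "Cod C f" g "Cod C g" h "Cod C h"] assms by (auto simp: hom_def)

lemma ident_simps [simp]:
  assumes "f \<in> Mor C"
  shows "Dom C f = a \<Longrightarrow> f \<cdot> Ident C a = f" and "Cod C f = a \<Longrightarrow> Ident C a \<cdot> f = f"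
  using comp_ident[of f a "Cod C f"] ident_comp[of f "Dom C f" a] assms by (auto simp: hom_def)

text \<open>Composites are kept nested to the right. This form, like \<open>square_ext\<close>, lets
  a commuting diagram rewrite the head of a longer composite in one step, with the associativity
  already built in.\<close>

lemma triangle_ext:
  assumes "g \<cdot> f = k" and "f \<in> hom C a b" and "g \<in> hom C b c" and "x \<in> hom C z a"
  shows "g \<cdot> (f \<cdot> x) = k \<cdot> x"
  using comp_assoc[OF assms(4,2,3)] assms(1) by simp

lemma square_ext:
  assumes "g \<cdot> f = k \<cdot> h" and "f \<in> hom C a b" and "g \<in> hom C b c"
    and "h \<in> hom C a b'" and "k \<in> hom C b' c" and "x \<in> hom C z a"
  shows "g \<cdot> (f \<cdot> x) = k \<cdot> (h \<cdot> x)"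
  using comp_assoc[OF assms(6,2,3)] comp_assoc[OF assms(6,4,5)] assms(1) by simp

end

lemma functorD:
  assumes "is_functor J C D"
  shows "a \<in> Obj J \<Longrightarrow> fobj D a \<in> Obj C"
    and "u \<in> hom J a b \<Longrightarrow> fmor D u \<in> hom C (fobj D a) (fobj D b)"
    and "a \<in> Obj J \<Longrightarrow> fmor D (Ident J a) = Ident C (fobj D a)"
    and "u \<in> hom J a b \<Longrightarrow> v \<in> hom J b c \<Longrightarrow> fmor D (v \<cdot>\<^bsub>J\<^esub> u) = fmor D v \<cdot>\<^bsub>C\<^esub> fmor D u"
  using assms unfolding is_functor_def by blast+

lemma coconeD:
  assumes "is_cocone J C D c l"
  shows "c \<in> Obj C" and "j \<in> Obj J \<Longrightarrow> l j \<in> hom C (fobj D j) c"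
    and "u \<in> hom J j k \<Longrightarrow> l k \<cdot>\<^bsub>C\<^esub> fmor D u = l j"
  using assms unfolding is_cocone_def by blast+

lemma colimit_cocone: "is_colimit J C D c l \<Longrightarrow> is_cocone J C D c l"
  unfolding is_colimit_def by blast

lemma colimit_desc:
  assumes "is_colimit J C D c l" and "is_cocone J C D c' l'"
  obtains h where "h \<in> hom C c c'" and "\<And>j. j \<in> Obj J \<Longrightarrow> h \<cdot>\<^bsub>C\<^esub> l j = l' j"
  using assms unfolding is_colimit_def by blast

text \<open>Both \<open>h\<close> and \<open>h'\<close> are mediating maps for the cocone with legs
  \<open>h' \<cdot> l j\<close>, so uniqueness identifies them: the legs of a colimit are jointly
  epic.\<close>

lemma (in category) colimit_eqI:
  assumes "is_colimit J C D c l" and "category J" and "is_functor J C D"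
    and "h \<in> hom C c c'" and "h' \<in> hom C c c'"
    and "\<And>j. j \<in> Obj J \<Longrightarrow> h \<cdot> l j = h' \<cdot> l j"
  shows "h = h'"
proof -
  interpret J: category J by fact
  note l = coconeD[OF colimit_cocone[OF assms(1)]]
  have "is_cocone J C D c' (\<lambda>j. h' \<cdot> l j)"
    unfolding is_cocone_def
  proof (intro conjI ballI allI)
    show "c' \<in> Obj C" using homD[OF assms(5)] by blast
    show "h' \<cdot> l j \<in> hom C (fobj D j) c'" if "j \<in> Obj J" for j
      using l(2)[OF that] assms(5) by (rule comp_hom)
    show "h' \<cdot> l k \<cdot> fmor D u = h' \<cdot> l j" if u: "u \<in> hom J j k" for j k u
      using comp_assoc[OF functorD(2)[OF assms(3) u] l(2) assms(5)] l(3)[OF u] J.homD[OF u] by simp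
  qed
  then show ?thesis
    using assms(1,4-6) unfolding is_colimit_def by blast
qed

lemma (in category) filtered_bound:
  assumes "filtered C" and "a \<in> Obj C" and "b \<in> Obj C"
  obtains c u v where "u \<in> hom C a c" and "v \<in> hom C b c"
  using assms unfolding filtered_def by blast

lemma (in category) filtered_coeq:
  assumes "filtered C" and "u \<in> hom C a b" and "v \<in> hom C a b"
  obtains c w where "w \<in> hom C b c" and "w \<cdot> u = w \<cdot> v"
  using assms unfolding filtered_def by blast

text \<open>A common bound of \<open>b\<close> and \<open>c\<close> makes the two composites out of
  \<open>a\<close> parallel; a further map then equalizes them.\<close>

lemma (in category) filtered_span:
  assumes "filtered C" and "u \<in> hom C a b" and "v \<in> hom C a c"
  obtains d p q where "p \<in> hom C b d" and "q \<in> hom C c d" and "p \<cdot> u = q \<cdot> v"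
proof -
  obtain e p q where pq: "p \<in> hom C b e" "q \<in> hom C c e"
    using filtered_bound[OF assms(1)] homD[OF assms(2)] homD[OF assms(3)] by metis
  obtain d w where w: "w \<in> hom C e d" "w \<cdot> (p \<cdot> u) = w \<cdot> (q \<cdot> v)"
    using filtered_coeq[OF assms(1) comp_hom[OF assms(2) pq(1)] comp_hom[OF assms(3) pq(2)]] .
  show ?thesis
    by (rule that[OF comp_hom[OF pq(1) w(1)] comp_hom[OF pq(2) w(1)]])
      (use w pq assms(2,3) in \<open>simp add: comp_assoc[of _ _ _ _ _ _ d]\<close>)
qed

section \<open>Hom functors and filtered colimits: stagewise existence and stagewise
  equality\<close>

section \<open>Finite presentability in elementary terms\<close>

text \<open>Surjectivity and injectivity of the canonical map from the colimit of the sets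
  \<open>hom C x (fobj D j)\<close> to \<open>hom C x c\<close>. Injectivity is only asked for two
  elements at the same stage, since in a filtered diagram any two can be moved to a common
  one.\<close>

definition commutes_hom ::
  "('j, 'k) cat \<Rightarrow> ('o, 'm) cat \<Rightarrow> ('j, 'k, 'o, 'm) fctr \<Rightarrow> 'o \<Rightarrow> ('j \<Rightarrow> 'm) \<Rightarrow> 'o \<Rightarrow> bool" where
  "commutes_hom J C D c l x \<longleftrightarrow>
     (\<forall>g\<in>hom C x c. \<exists>j\<in>Obj J. \<exists>g'\<in>hom C x (fobj D j). l j \<cdot>\<^bsub>C\<^esub> g' = g) \<and>
     (\<forall>j\<in>Obj J. \<forall>g\<in>hom C x (fobj D j). \<forall>g'\<in>hom C x (fobj D j).
        l j \<cdot>\<^bsub>C\<^esub> g = l j \<cdot>\<^bsub>C\<^esub> g' \<longrightarrow>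
        (\<exists>k. \<exists>u\<in>hom J j k. fmor D u \<cdot>\<^bsub>C\<^esub> g = fmor D u \<cdot>\<^bsub>C\<^esub> g'))"

lemma commutes_hom_factor:
  assumes "commutes_hom J C D c l x" and "g \<in> hom C x c"
  obtains j g' where "j \<in> Obj J" and "g' \<in> hom C x (fobj D j)" and "l j \<cdot>\<^bsub>C\<^esub> g' = g"
  using assms unfolding commutes_hom_def by blast

lemma commutes_hom_eq:
  assumes "commutes_hom J C D c l x" and "j \<in> Obj J" and "g \<in> hom C x (fobj D j)"
    and "g' \<in> hom C x (fobj D j)" and "l j \<cdot>\<^bsub>C\<^esub> g = l j \<cdot>\<^bsub>C\<^esub> g'"
  obtains k u where "u \<in> hom J j k" and "fmor D u \<cdot>\<^bsub>C\<^esub> g = fmor D u \<cdot>\<^bsub>C\<^esub> g'"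
  using assms unfolding commutes_hom_def by blast

text \<open>Over a filtered index category the generated equivalence relation \<open>R\<close> has a
  one-step description: two elements are related iff their images agree at some later stage. This is
  \<open>rel\<close>; once it is known to be transitive, the quotient can be handled through
  representatives.\<close>

lemma (in category) bij_colim_hom_iff:
  assumes J: "category J" "filtered J" and D: "is_functor J C D" and l: "is_cocone J C D c l"
  shows "bij_betw (colim_hom_map C l) (colim_hom J C D x) (hom C x c) \<longleftrightarrow> commutes_hom J C D c l x"
proof -
  interpret J: category J by fact
  note D = functorD[OF D] and l = coconeD[OF l]
  define E where "E = (SIGMA j:Obj J. hom C x (fobj D j))"
  define st where "st = colim_hom_step J C D x"
  define R where "R = (st \<union> st\<inverse>)\<^sup>*"
  define rel where "rel y z \<longleftrightarrow> (\<exists>m. \<exists>u\<in>hom J (fst y) m. \<exists>v\<in>hom J (fst z) m.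
      fmor D u \<cdot> snd y = fmor D v \<cdot> snd z)" for y z
  have st: "(y, z) \<in> st \<longleftrightarrow> snd y \<in> hom C x (fobj D (fst y)) \<and>
      (\<exists>u\<in>hom J (fst y) (fst z). snd z = fmor D u \<cdot> snd y)" for y z
    unfolding st_def colim_hom_step_def by (cases y; cases z) auto
  have E: "y \<in> E \<longleftrightarrow> fst y \<in> Obj J \<and> snd y \<in> hom C x (fobj D (fst y))" for y
    unfolding E_def by (cases y) auto
  have move: "fmor D (w \<cdot>\<^bsub>J\<^esub> u) \<cdot> g = fmor D w \<cdot> (fmor D u \<cdot> g)"
    if "g \<in> hom C x (fobj D a)" "u \<in> hom J a b" "w \<in> hom J b d" for g a b d u w
    using D(4)[OF that(2,3)] comp_assoc[OF that(1) D(2)[OF that(2)] D(2)[OF that(3)]] by simp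
  \<comment> \<open>The two agreements take place at unrelated stages \<open>m\<close> and
    \<open>m'\<close>. A span completion over the middle element brings both to one stage
    \<open>n\<close> along maps that agree on it.\<close>
  have rel_trans: "rel y w" if rel: "rel y z" "rel z w" and e: "y \<in> E" "z \<in> E" "w \<in> E" for y z w
  proof -
    obtain m u v where 1: "u \<in> hom J (fst y) m" "v \<in> hom J (fst z) m"
      "fmor D u \<cdot> snd y = fmor D v \<cdot> snd z" using rel(1) unfolding rel_def by blast
    obtain m' u' v' where 2: "u' \<in> hom J (fst z) m'" "v' \<in> hom J (fst w) m'"
      "fmor D u' \<cdot> snd z = fmor D v' \<cdot> snd w" using rel(2) unfolding rel_def by blast
    obtain n p q where pq: "p \<in> hom J m n" "q \<in> hom J m' n" "p \<cdot>\<^bsub>J\<^esub> v = q \<cdot>\<^bsub>J\<^esub> u'"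
      using J.filtered_span[OF J(2) 1(2) 2(1)] .
    have ee: "snd y \<in> hom C x (fobj D (fst y))" "snd z \<in> hom C x (fobj D (fst z))"
      "snd w \<in> hom C x (fobj D (fst w))" using e unfolding E by auto
    have "fmor D (p \<cdot>\<^bsub>J\<^esub> u) \<cdot> snd y = fmor D (q \<cdot>\<^bsub>J\<^esub> v') \<cdot> snd w"
      using move[OF ee(1) 1(1) pq(1)] move[OF ee(2) 1(2) pq(1)] move[OF ee(2) 2(1) pq(2)]
        move[OF ee(3) 2(2) pq(2)] 1(3) 2(3) pq(3) by simp
    then show ?thesis
      unfolding rel_def using J.comp_hom[OF 1(1) pq(1)] J.comp_hom[OF 2(2) pq(2)] by blast
  qed
  have rel_R: "(y, z) \<in> R" if r: "rel y z" and e: "y \<in> E" "z \<in> E" for y z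
  proof -
    obtain m u v where 1: "u \<in> hom J (fst y) m" "v \<in> hom J (fst z) m"
      "fmor D u \<cdot> snd y = fmor D v \<cdot> snd z" using r unfolding rel_def by blast
    have "(y, (m, fmor D u \<cdot> snd y)) \<in> st" "(z, (m, fmor D u \<cdot> snd y)) \<in> st"
      using 1 e unfolding st E fst_conv snd_conv by (blast, metis)
    then show ?thesis unfolding R_def
      by (meson UnI1 UnI2 converseI converse_rtrancl_into_rtrancl r_into_rtrancl)
  qed
  have st_E: "rel y z \<and> rel z y \<and> y \<in> E \<and> z \<in> E" if yz: "(y, z) \<in> st" for y z
  proof -
    obtain u where u: "u \<in> hom J (fst y) (fst z)" "snd z = fmor D u \<cdot> snd y"
      "snd y \<in> hom C x (fobj D (fst y))" using yz unfolding st by blast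
    have o: "fst y \<in> Obj J" "fst z \<in> Obj J" using J.homD[OF u(1)] by auto
    have "snd z \<in> hom C x (fobj D (fst z))" using u D(2) comp_hom by metis
    moreover have "fmor D (Ident J (fst z)) \<cdot> snd z = fmor D u \<cdot> snd y"
      using calculation u(2) D(3)[OF o(2)] ident_comp by metis
    ultimately show ?thesis
      using u o J.ident_hom[OF o(2)] unfolding rel_def E by metis
  qed
  have refl: "rel y y" if "y \<in> E" for y
    using that J.ident_hom unfolding rel_def E by blast
  have R_rel: "rel y z \<and> z \<in> E" if "(y, z) \<in> R" "y \<in> E" for y z
    using that(1) unfolding R_def
  proof (induction rule: rtrancl_induct)
    case base then show ?case using refl that(2) by blast
  next
    case (step z w)
    then have "rel z w \<and> w \<in> E" using st_E by blast
    then show ?case using step rel_trans that(2) by blast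
  qed
  have symR: "(z, y) \<in> R" if "(y, z) \<in> R" for y z
    using that unfolding R_def
    by (metis converse_Un converse_converse rtrancl_converseD sup_commute)
  have transR: "(y, w) \<in> R" if "(y, z) \<in> R" "(z, w) \<in> R" for y z w
    using that unfolding R_def by (rule rtrancl_trans)
  have cls: "R `` {y} = R `` {z} \<longleftrightarrow> rel y z" if "y \<in> E" "z \<in> E" for y z
  proof
    assume "R `` {y} = R `` {z}"
    then have "(y, z) \<in> R" unfolding R_def by blast
    then show "rel y z" using R_rel that by blast
  next
    assume "rel y z"
    then have "(y, z) \<in> R" "(z, y) \<in> R" using rel_R symR that by blast+
    then show "R `` {y} = R `` {z}" using transR by blast
  qed
  have rel_l: "l (fst y) \<cdot> snd y = l (fst z) \<cdot> snd z" if r: "rel y z" and e: "y \<in> E" "z \<in> E" for y z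
  proof -
    have *: "l (fst y) \<cdot> snd y = l m \<cdot> (fmor D u \<cdot> snd y)"
      if "u \<in> hom J (fst y) m" "y \<in> E" for y m u
      using comp_assoc[of "snd y" x _ "fmor D u" _ "l m", OF _ D(2)[OF that(1)] l(2)]
        l(3)[OF that(1)] J.homD[OF that(1)] that(2) unfolding E by metis
    obtain m u v where 1: "u \<in> hom J (fst y) m" "v \<in> hom J (fst z) m"
      "fmor D u \<cdot> snd y = fmor D v \<cdot> snd z" using r unfolding rel_def by blast
    show ?thesis using *[OF 1(1) e(1)] *[OF 1(2) e(2)] 1(3) by simp
  qed
  have map: "colim_hom_map C l (R `` {y}) = l (fst y) \<cdot> snd y" if y: "y \<in> E" for y
  proof -
    have "(y, y) \<in> R" unfolding R_def by blast
    moreover have "(\<lambda>(j, g). l j \<cdot> g) z = l (fst y) \<cdot> snd y" if "z \<in> R `` {y}" for z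
      using R_rel[of y z] rel_l[of y z] y that by (simp add: case_prod_beta)
    ultimately have "(\<lambda>(j, g). l j \<cdot> g) ` (R `` {y}) = {l (fst y) \<cdot> snd y}"
      by (metis (no_types, lifting) ImageI image_constant image_cong singletonI)
    then show ?thesis unfolding colim_hom_map_def by simp
  qed
  have coll: "colim_hom J C D x = (\<lambda>y. R `` {y}) ` E"
    unfolding colim_hom_def E_def[symmetric] st_def[symmetric] R_def[symmetric] quotient_def by blast
  have "bij_betw (colim_hom_map C l) (colim_hom J C D x) (hom C x c) \<longleftrightarrow>
      (\<forall>y\<in>E. \<forall>z\<in>E. l (fst y) \<cdot> snd y = l (fst z) \<cdot> snd z \<longrightarrow> rel y z) \<and>
      (\<lambda>y. l (fst y) \<cdot> snd y) ` E = hom C x c"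
  proof -
    have "inj_on (colim_hom_map C l) (colim_hom J C D x) \<longleftrightarrow>
        (\<forall>y\<in>E. \<forall>z\<in>E. l (fst y) \<cdot> snd y = l (fst z) \<cdot> snd z \<longrightarrow> rel y z)"
      unfolding inj_on_def coll using map cls by auto
    moreover have "colim_hom_map C l ` colim_hom J C D x = (\<lambda>y. l (fst y) \<cdot> snd y) ` E"
      unfolding coll image_image using map by auto
    ultimately show ?thesis unfolding bij_betw_def by simp
  qed
  also have "(\<lambda>y. l (fst y) \<cdot> snd y) ` E = hom C x c \<longleftrightarrow>
      (\<forall>g\<in>hom C x c. \<exists>j\<in>Obj J. \<exists>g'\<in>hom C x (fobj D j). l j \<cdot> g' = g)"
  proof -
    have "l (fst y) \<cdot> snd y \<in> hom C x c" if "y \<in> E" for y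
      using comp_hom[OF _ l(2)] that unfolding E by blast
    moreover have "(\<exists>y\<in>E. g = l (fst y) \<cdot> snd y) \<longleftrightarrow>
        (\<exists>j\<in>Obj J. \<exists>g'\<in>hom C x (fobj D j). l j \<cdot> g' = g)" for g
      unfolding E_def by auto
    moreover have "(\<lambda>y. l (fst y) \<cdot> snd y) ` E = hom C x c \<longleftrightarrow>
        (\<forall>g\<in>hom C x c. \<exists>y\<in>E. g = l (fst y) \<cdot> snd y)"
      using calculation(1) by blast
    ultimately show ?thesis by simp
  qed
  also have "(\<forall>y\<in>E. \<forall>z\<in>E. l (fst y) \<cdot> snd y = l (fst z) \<cdot> snd z \<longrightarrow> rel y z) \<longleftrightarrow>
     (\<forall>j\<in>Obj J. \<forall>g\<in>hom C x (fobj D j). \<forall>g'\<in>hom C x (fobj D j). l j \<cdot> g = l j \<cdot> g' \<longrightarrow>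
        (\<exists>k. \<exists>u\<in>hom J j k. fmor D u \<cdot> g = fmor D u \<cdot> g'))" (is "?L \<longleftrightarrow> ?R")
  proof (intro iffI ballI impI)
    fix j g g' assume L: ?L and j: "j \<in> Obj J" and g: "g \<in> hom C x (fobj D j)" "g' \<in> hom C x (fobj D j)"
      and "l j \<cdot> g = l j \<cdot> g'"
    then have "rel (j, g) (j, g')" unfolding E_def by auto
    then obtain m u v where 1: "u \<in> hom J j m" "v \<in> hom J j m"
      "fmor D u \<cdot> g = fmor D v \<cdot> g'" unfolding rel_def by auto
    \<comment> \<open>\<open>rel\<close> allows two different transition maps \<open>u\<close> and
      \<open>v\<close> even when both elements sit at stage \<open>j\<close>; a coequalizing
      \<open>w\<close> turns them into a single one.\<close>
    obtain k w where w: "w \<in> hom J m k" "w \<cdot>\<^bsub>J\<^esub> u = w \<cdot>\<^bsub>J\<^esub> v"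
      using J.filtered_coeq[OF J(2) 1(1,2)] .
    have "fmor D (w \<cdot>\<^bsub>J\<^esub> u) \<cdot> g = fmor D (w \<cdot>\<^bsub>J\<^esub> u) \<cdot> g'"
      using move[OF g(1) 1(1) w(1)] move[OF g(2) 1(2) w(1)] w(2) 1(3) by simp
    then show "\<exists>k. \<exists>u\<in>hom J j k. fmor D u \<cdot> g = fmor D u \<cdot> g'"
      using J.comp_hom[OF 1(1) w(1)] by blast
  next
    fix y z assume R: ?R and yz: "y \<in> E" "z \<in> E" and eq: "l (fst y) \<cdot> snd y = l (fst z) \<cdot> snd z"
    have o: "fst y \<in> Obj J" "fst z \<in> Obj J" using yz unfolding E by auto
    obtain m u v where uv: "u \<in> hom J (fst y) m" "v \<in> hom J (fst z) m"
      using J.filtered_bound[OF J(2) o] .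
    have s: "snd y \<in> hom C x (fobj D (fst y))" "snd z \<in> hom C x (fobj D (fst z))"
      using yz unfolding E by auto
    have h: "fmor D u \<cdot> snd y \<in> hom C x (fobj D m)" "fmor D v \<cdot> snd z \<in> hom C x (fobj D m)"
      using comp_hom[OF s(1) D(2)[OF uv(1)]] comp_hom[OF s(2) D(2)[OF uv(2)]] by auto
    have m: "m \<in> Obj J" using J.homD[OF uv(1)] by blast
    have "l m \<cdot> (fmor D u \<cdot> snd y) = l m \<cdot> (fmor D v \<cdot> snd z)"
      using triangle_ext[OF l(3)[OF uv(1)] D(2)[OF uv(1)] l(2)[OF m] s(1)]
        triangle_ext[OF l(3)[OF uv(2)] D(2)[OF uv(2)] l(2)[OF m] s(2)] eq by simp
    then obtain k w where w: "w \<in> hom J m k"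
      "fmor D w \<cdot> (fmor D u \<cdot> snd y) = fmor D w \<cdot> (fmor D v \<cdot> snd z)"
      using R m h by blast
    then have "fmor D (w \<cdot>\<^bsub>J\<^esub> u) \<cdot> snd y = fmor D (w \<cdot>\<^bsub>J\<^esub> v) \<cdot> snd z"
      using move[OF s(1) uv(1) w(1)] move[OF s(2) uv(2) w(1)] by simp
    then show "rel y z" unfolding rel_def using J.comp_hom[OF uv(1) w(1)] J.comp_hom[OF uv(2) w(1)] by blast
  qed
  finally show ?thesis unfolding commutes_hom_def by blast
qed

lemma (in category) finitely_presentableI:
  fixes U :: "'u itself"
  assumes "x \<in> Obj C"
    and "\<And>(J :: ('u, 'u) cat) D c l. category J \<Longrightarrow> small U (Obj J) \<Longrightarrow> small U (Mor J) \<Longrightarrow>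
      filtered J \<Longrightarrow> is_functor J C D \<Longrightarrow> is_colimit J C D c l \<Longrightarrow> commutes_hom J C D c l x"
  shows "finitely_presentable U C x"
  unfolding finitely_presentable_def small_category_def
proof (intro conjI allI impI, goal_cases)
  case 1 show ?case by fact
next
  case (2 J D c l)
  then have J: "category J" "small U (Obj J)" "small U (Mor J)" "filtered J"
    and D: "is_functor J C D" and c: "is_colimit J C D c l" by blast+
  show ?case
    by (rule iffD2[OF bij_colim_hom_iff[OF J(1,4) D colimit_cocone[OF c]] assms(2)[OF J D c]])
qed

text \<open>Lifts the restriction to index categories on \<open>'u\<close>: a small filtered index
  category on any type is replaced by an isomorphic one there, and the elementary property is
  carried back.\<close>

lemma (in category) finitely_presentable_commutes:
  fixes U :: "'u itself"
  assumes fp: "finitely_presentable U C x"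
    and J: "category J" "small U (Obj J)" "small U (Mor J)" "filtered J"
    and D: "is_functor J C D" and c: "is_colimit J C D c l"
  shows "commutes_hom J C D c l x"
proof -
  obtain I :: "('u, 'u) cat" and po pm where I: "small_category U I" and iso: "index_iso I J po pm"
    using small_index_iso[OF J(1-3)] .
  have I': "category I" using I unfolding small_category_def by blast
  interpret J: category J by fact
  interpret I: category I by fact
  have F: "filtered I" using filtered_index_iso[OF iso J(1) I' J(4)] .
  have D': "is_functor I C (reindex po pm D)" using functor_reindex[OF iso J(1) I' D] .
  have c': "is_colimit I C (reindex po pm D) c (l \<circ> po)" by (rule iffD2[OF colimit_reindex[OF iso J(1) I'] c])
  have "bij_betw (colim_hom_map C (l \<circ> po)) (colim_hom I C (reindex po pm D) x) (hom C x c)"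
    using fp I F D' c' unfolding finitely_presentable_def by blast
  then have "commutes_hom I C (reindex po pm D) c (l \<circ> po) x"
    by (rule iffD1[OF bij_colim_hom_iff[OF I' F D' colimit_cocone[OF c']]])
  note ch = this[unfolded commutes_hom_def reindex_def, simplified]
  note ii = index_iso_inv_into[OF iso]
  show ?thesis
    unfolding commutes_hom_def
  proof (intro conjI ballI impI)
    show "\<exists>j\<in>Obj J. \<exists>g'\<in>hom C x (fobj D j). l j \<cdot> g' = g" if "g \<in> hom C x c" for g
      using ch that ii(2) by blast
    fix j g g' assume j: "j \<in> Obj J" and g: "g \<in> hom C x (fobj D j)" "g' \<in> hom C x (fobj D j)"
      and eq: "l j \<cdot> g = l j \<cdot> g'"
    obtain i where i: "i \<in> Obj I" "j = po i" using ii(1)[OF j] by metis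
    then obtain k u where u: "u \<in> hom I i k" "fmor D (pm u) \<cdot> g = fmor D (pm u) \<cdot> g'"
      using ch g eq by blast
    then have "pm u \<in> hom J j (po k)"
      using index_iso_hom[OF iso J(1) I', of i k] I.homD[OF u(1)] i by blast
    then show "\<exists>k. \<exists>u\<in>hom J j k. fmor D u \<cdot> g = fmor D u \<cdot> g'" using u(2) by blast
  qed
qed

section \<open>Pushouts, initial objects, coproducts and coequalizers of finitely presentable
  objects\<close>

section \<open>Finite colimits of finitely presentable objects\<close>

text \<open>Preorders supply all the concrete shapes that are needed: the span, the empty diagram,
  finite subsets under inclusion, and the natural numbers.\<close>

definition poset_cat :: "'a set \<Rightarrow> ('a \<Rightarrow> 'a \<Rightarrow> bool) \<Rightarrow> ('a, 'a \<times> 'a) cat" where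
  "poset_cat A r = \<lparr>Obj = A, Mor = {(a, b). a \<in> A \<and> b \<in> A \<and> r a b}, Dom = fst, Cod = snd,
     Ident = (\<lambda>a. (a, a)), Comp = (\<lambda>g f. (fst f, snd g))\<rparr>"

lemma Obj_poset_cat [simp]: "Obj (poset_cat A r) = A"
  by (simp add: poset_cat_def)

lemma Ident_poset_cat [simp]: "Ident (poset_cat A r) a = (a, a)"
  by (simp add: poset_cat_def)

lemma hom_poset_cat: "u \<in> hom (poset_cat A r) a b \<longleftrightarrow> u = (a, b) \<and> a \<in> A \<and> b \<in> A \<and> r a b"
  by (auto simp: poset_cat_def hom_def)

lemma comp_poset_cat [simp]: "(b, c) \<cdot>\<^bsub>poset_cat A r\<^esub> (a, b') = (a, c)"
  by (simp add: poset_cat_def)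

lemma category_poset_cat:
  assumes "\<And>a. a \<in> A \<Longrightarrow> r a a"
    and "\<And>a b c. a \<in> A \<Longrightarrow> b \<in> A \<Longrightarrow> c \<in> A \<Longrightarrow> r a b \<Longrightarrow> r b c \<Longrightarrow> r a c"
  shows "category (poset_cat A r)"
  by unfold_locales (auto simp: poset_cat_def hom_def intro: assms)

lemma small_poset_cat:
  assumes "universe U" and "small U A"
  shows "small U (Obj (poset_cat A r))" and "small U (Mor (poset_cat A r))"
  using assms small_Times[OF assms(1,2,2)]
  by (auto simp: poset_cat_def intro: small_subset[of _ "A \<times> A"])

lemma functor_poset_catI:
  assumes "\<And>a. a \<in> A \<Longrightarrow> fobj D a \<in> Obj C"
    and "\<And>a b. a \<in> A \<Longrightarrow> b \<in> A \<Longrightarrow> r a b \<Longrightarrow> fmor D (a, b) \<in> hom C (fobj D a) (fobj D b)"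
    and "\<And>a. a \<in> A \<Longrightarrow> fmor D (a, a) = Ident C (fobj D a)"
    and "\<And>a b c. a \<in> A \<Longrightarrow> b \<in> A \<Longrightarrow> c \<in> A \<Longrightarrow> r a b \<Longrightarrow> r b c \<Longrightarrow>
      fmor D (a, c) = fmor D (b, c) \<cdot>\<^bsub>C\<^esub> fmor D (a, b)"
  shows "is_functor (poset_cat A r) C D"
  unfolding is_functor_def using assms by (simp add: hom_poset_cat)

lemma cocone_poset_catI:
  assumes "c \<in> Obj C" and "\<And>a. a \<in> A \<Longrightarrow> l a \<in> hom C (fobj D a) c"
    and "\<And>a b. a \<in> A \<Longrightarrow> b \<in> A \<Longrightarrow> r a b \<Longrightarrow> l b \<cdot>\<^bsub>C\<^esub> fmor D (a, b) = l a"
  shows "is_cocone (poset_cat A r) C D c l"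
  unfolding is_cocone_def using assms by (simp add: hom_poset_cat)

text \<open>\<open>is_pushout\<close> with the four corners as parameters instead of bound
  existentially, so that the facts on domains and codomains need not be extracted again at each
  use.\<close>

definition pushout_square ::
  "('o, 'm) cat \<Rightarrow> 'o \<Rightarrow> 'o \<Rightarrow> 'o \<Rightarrow> 'o \<Rightarrow> 'm \<Rightarrow> 'm \<Rightarrow> 'm \<Rightarrow> 'm \<Rightarrow> bool" where
  "pushout_square C a b c s f g i j \<longleftrightarrow>
     f \<in> hom C a b \<and> g \<in> hom C a c \<and> i \<in> hom C b s \<and> j \<in> hom C c s \<and>
     i \<cdot>\<^bsub>C\<^esub> f = j \<cdot>\<^bsub>C\<^esub> g \<and>
     (\<forall>x. \<forall>i'\<in>hom C b x. \<forall>j'\<in>hom C c x. i' \<cdot>\<^bsub>C\<^esub> f = j' \<cdot>\<^bsub>C\<^esub> g \<longrightarrow>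
        (\<exists>!h. h \<in> hom C s x \<and> h \<cdot>\<^bsub>C\<^esub> i = i' \<and> h \<cdot>\<^bsub>C\<^esub> j = j'))"

lemma is_pushoutI: "pushout_square C a b c s f g i j \<Longrightarrow> is_pushout C f g i j"
  unfolding pushout_square_def is_pushout_def by blast

lemma pushoutD:
  assumes "pushout_square C a b c s f g i j"
  shows "f \<in> hom C a b" and "g \<in> hom C a c" and "i \<in> hom C b s" and "j \<in> hom C c s"
    and "i \<cdot>\<^bsub>C\<^esub> f = j \<cdot>\<^bsub>C\<^esub> g"
  using assms unfolding pushout_square_def by blast+

lemma pushout_desc:
  assumes "pushout_square C a b c s f g i j"
    and "i' \<in> hom C b x" and "j' \<in> hom C c x" and "i' \<cdot>\<^bsub>C\<^esub> f = j' \<cdot>\<^bsub>C\<^esub> g"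
  obtains h where "h \<in> hom C s x" and "h \<cdot>\<^bsub>C\<^esub> i = i'" and "h \<cdot>\<^bsub>C\<^esub> j = j'"
  using assms unfolding pushout_square_def by blast

lemma (in category) pushout_eqI:
  assumes po: "pushout_square C a b c s f g i j" and h: "h \<in> hom C s x" "h' \<in> hom C s x"
    and eq: "h \<cdot> i = h' \<cdot> i" "h \<cdot> j = h' \<cdot> j"
  shows "h = h'"
proof -
  note D = pushoutD[OF po]
  have "(h' \<cdot> i) \<cdot> f = (h' \<cdot> j) \<cdot> g"
    using comp_assoc[OF D(1,3) h(2)] comp_assoc[OF D(2,4) h(2)] D(5) by simp
  then have "\<exists>!k. k \<in> hom C s x \<and> k \<cdot> i = h' \<cdot> i \<and> k \<cdot> j = h' \<cdot> j"
    using po comp_hom[OF D(3) h(2)] comp_hom[OF D(4) h(2)] unfolding pushout_square_def by blast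
  then show ?thesis using h eq by metis
qed

lemma (in category) pushout_squareI:
  assumes "f \<in> hom C a b" and "g \<in> hom C a c" and "i \<in> hom C b s" and "j \<in> hom C c s"
    and "i \<cdot> f = j \<cdot> g"
    and "\<And>x i' j'. i' \<in> hom C b x \<Longrightarrow> j' \<in> hom C c x \<Longrightarrow> i' \<cdot> f = j' \<cdot> g \<Longrightarrow>
      \<exists>h\<in>hom C s x. h \<cdot> i = i' \<and> h \<cdot> j = j'"
    and "\<And>x h h'. h \<in> hom C s x \<Longrightarrow> h' \<in> hom C s x \<Longrightarrow> h \<cdot> i = h' \<cdot> i \<Longrightarrow> h \<cdot> j = h' \<cdot> j \<Longrightarrow> h = h'"
  shows "pushout_square C a b c s f g i j"
  unfolding pushout_square_def
proof (intro conjI allI ballI impI)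
  fix x i' j'
  assume *: "i' \<in> hom C b x" "j' \<in> hom C c x" "i' \<cdot> f = j' \<cdot> g"
  show "\<exists>!h. h \<in> hom C s x \<and> h \<cdot> i = i' \<and> h \<cdot> j = j'"
  proof (rule ex_ex1I)
    show "\<exists>h. h \<in> hom C s x \<and> h \<cdot> i = i' \<and> h \<cdot> j = j'" using assms(6)[OF *] by blast
  next
    fix h h' assume "h \<in> hom C s x \<and> h \<cdot> i = i' \<and> h \<cdot> j = j'" "h' \<in> hom C s x \<and> h' \<cdot> i = i' \<and> h' \<cdot> j = j'"
    then show "h = h'" using assms(7)[of h x h'] by simp
  qed
qed fact+

lemma (in category) pushout_sym:
  assumes "pushout_square C a b c s f g i j"
  shows "pushout_square C a c b s g f j i"
proof (rule pushout_squareI)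
  note D = pushoutD[OF assms]
  show "g \<in> hom C a c" "f \<in> hom C a b" "j \<in> hom C c s" "i \<in> hom C b s" by (fact D)+
  show "j \<cdot> g = i \<cdot> f" using D(5) by simp
  show "\<exists>h\<in>hom C s x. h \<cdot> j = i' \<and> h \<cdot> i = j'"
    if "i' \<in> hom C c x" "j' \<in> hom C b x" "i' \<cdot> g = j' \<cdot> f" for x i' j'
    using pushout_desc[OF assms that(2,1) that(3)[symmetric]] by blast
  show "h = h'" if "h \<in> hom C s x" "h' \<in> hom C s x" "h \<cdot> j = h' \<cdot> j" "h \<cdot> i = h' \<cdot> i" for x h h'
    by (rule pushout_eqI[OF assms that(1,2,4,3)])
qed

lemma coproduct_desc:
  assumes "is_coproduct C a b s in0 in1" and "f \<in> hom C a x" and "g \<in> hom C b x"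
  obtains h where "h \<in> hom C s x" and "h \<cdot>\<^bsub>C\<^esub> in0 = f" and "h \<cdot>\<^bsub>C\<^esub> in1 = g"
  using assms unfolding is_coproduct_def by blast

lemma coproductD:
  assumes "is_coproduct C a b s in0 in1"
  shows "in0 \<in> hom C a s" and "in1 \<in> hom C b s"
  using assms unfolding is_coproduct_def by blast+

lemma (in category) coproduct_eqI:
  assumes s: "is_coproduct C a b s in0 in1" and h: "h \<in> hom C s x" "h' \<in> hom C s x"
    and eq: "h \<cdot> in0 = h' \<cdot> in0" "h \<cdot> in1 = h' \<cdot> in1"
  shows "h = h'"
proof -
  have "\<exists>!k. k \<in> hom C s x \<and> k \<cdot> in0 = h' \<cdot> in0 \<and> k \<cdot> in1 = h' \<cdot> in1"
    using s comp_hom[OF coproductD(1)[OF s] h(2)] comp_hom[OF coproductD(2)[OF s] h(2)]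
    unfolding is_coproduct_def by blast
  then show ?thesis using h eq by metis
qed

definition inverse_arrows :: "('o, 'm) cat \<Rightarrow> 'o \<Rightarrow> 'o \<Rightarrow> 'm \<Rightarrow> 'm \<Rightarrow> bool" where
  "inverse_arrows C a b f g \<longleftrightarrow> f \<in> hom C a b \<and> g \<in> hom C b a \<and>
     g \<cdot>\<^bsub>C\<^esub> f = Ident C a \<and> f \<cdot>\<^bsub>C\<^esub> g = Ident C b"

lemma inverse_arrowsD:
  assumes "inverse_arrows C a b f g"
  shows "f \<in> hom C a b" and "g \<in> hom C b a" and "g \<cdot>\<^bsub>C\<^esub> f = Ident C a" and "f \<cdot>\<^bsub>C\<^esub> g = Ident C b"
  using assms unfolding inverse_arrows_def by auto

locale lfp_category = category C for C :: "('o, 'm) cat" (structure) +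
  fixes U :: "'u itself"
  assumes universe: "universe U" and lfp: "locally_finitely_presentable U C"
begin

abbreviation fp :: "'o \<Rightarrow> bool" where
  "fp x \<equiv> finitely_presentable U C x"

lemma fp_Obj: "fp x \<Longrightarrow> x \<in> Obj C"
  unfolding finitely_presentable_def by blast

lemma small_hom: "a \<in> Obj C \<Longrightarrow> b \<in> Obj C \<Longrightarrow> small U (hom C a b)"
  using lfp unfolding locally_finitely_presentable_def finitely_accessible_def locally_small_def
  by blast

lemma colimit_exists:
  assumes "category J" and "small U (Obj J)" and "small U (Mor J)" and "is_functor J C D"
  obtains c l where "is_colimit J C D c l"
proof -
  obtain I :: "('u, 'u) cat" and po pm where I: "small_category U I" and iso: "index_iso I J po pm"
    using small_index_iso[OF assms(1-3)] .
  have I': "category I" using I unfolding small_category_def by blast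
  obtain c l where cl: "is_colimit I C (reindex po pm D) c l"
    using lfp I functor_reindex[OF iso assms(1) I' assms(4)]
    unfolding locally_finitely_presentable_def small_cocomplete_def has_colimits_of_shape_def
    by blast
  define l' where "l' j = l (inv_into (Obj I) po j)" for j
  have l: "(l' \<circ> po) i = l i" if "i \<in> Obj I" for i
    using iso that unfolding index_iso_def by (simp add: bij_betw_def inv_into_f_f l'_def)
  have cc: "is_cocone I C (reindex po pm D) c (l' \<circ> po)"
  proof -
    interpret I: category I by fact
    note k = coconeD[OF colimit_cocone[OF cl]]
    show ?thesis
      unfolding is_cocone_def
    proof (intro conjI ballI allI)
      show "(l' \<circ> po) k \<cdot> fmor (reindex po pm D) u = (l' \<circ> po) j" if u: "u \<in> hom I j k" for j k u
        using k(3)[OF u] l I.homD[OF u] by metis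
    qed (use k l in auto)
  qed
  have "is_colimit I C (reindex po pm D) c (l' \<circ> po)"
    unfolding is_colimit_def
  proof (intro conjI allI impI)
    fix c' m assume "is_cocone I C (reindex po pm D) c' m"
    then have "\<exists>!h. h \<in> hom C c c' \<and> (\<forall>j\<in>Obj I. h \<cdot> l j = m j)"
      using cl unfolding is_colimit_def by blast
    moreover have "(\<forall>j\<in>Obj I. h \<cdot> l j = m j) \<longleftrightarrow> (\<forall>j\<in>Obj I. h \<cdot> (l' \<circ> po) j = m j)" for h
      using l by simp
    ultimately show "\<exists>!h. h \<in> hom C c c' \<and> (\<forall>j\<in>Obj I. h \<cdot> (l' \<circ> po) j = m j)" by simp
  qed (fact cc)
  then have "is_colimit J C D c l'"
    by (rule iffD1[OF colimit_reindex[OF iso assms(1) I']])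
  then show ?thesis by (rule that)
qed

lemma presentation:
  assumes "x \<in> Obj C"
  obtains J :: "('u, 'u) cat" and D l where "category J" and "small U (Obj J)" and "small U (Mor J)"
    and "filtered J" and "is_functor J C D" and "\<And>j. j \<in> Obj J \<Longrightarrow> fp (fobj D j)"
    and "is_colimit J C D x l"
proof -
  obtain S where S: "\<forall>x\<in>S. fp x" "generates_under_filtered_colimits U C S"
    using lfp unfolding locally_finitely_presentable_def finitely_accessible_def by blast
  then show ?thesis
    using assms that unfolding generates_under_filtered_colimits_def small_category_def by metis
qed

lemma pushout_exists:
  assumes f: "f \<in> hom C a b" and g: "g \<in> hom C a c"
  obtains s i j where "pushout_square C a b c s f g i j"
proof -
  \<comment> \<open>On \<open>{0, 1, 2}\<close> this relation puts \<open>0\<close> below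
    \<open>1\<close> and below \<open>2\<close>, which is the shape of the span.\<close>
  define r :: "nat \<Rightarrow> nat \<Rightarrow> bool" where "r m n \<longleftrightarrow> m = n \<or> m = 0" for m n
  define A :: "nat set" where "A = {0, 1, 2}"
  define D where "D = \<lparr>fobj = (\<lambda>n::nat. if n = 0 then a else if n = 1 then b else c),
    fmor = (\<lambda>(m :: nat, n :: nat). if m = n then Ident C (if n = 0 then a else if n = 1 then b else c)
      else if n = 1 then f else g)\<rparr>"
  note o = homD[OF f] homD[OF g]
  have J: "category (poset_cat A r)" by (rule category_poset_cat) (auto simp: r_def)
  have D: "is_functor (poset_cat A r) C D"
    by (rule functor_poset_catI) (use f g o in \<open>auto simp: A_def r_def D_def ident_hom\<close>)
  obtain s l where l: "is_colimit (poset_cat A r) C D s l"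
    using colimit_exists[OF J small_poset_cat[OF universe small_finite[OF universe]] D]
    unfolding A_def by blast
  note L = coconeD[OF colimit_cocone[OF l], unfolded Obj_poset_cat]
  have l1: "l 1 \<in> hom C b s" and l2: "l 2 \<in> hom C c s"
    using L(2)[of 1] L(2)[of 2] by (simp_all add: A_def D_def)
  have l0: "l 1 \<cdot> f = l 0" "l 2 \<cdot> g = l 0"
    using L(3)[of "(0, 1)" 0 1] L(3)[of "(0, 2)" 0 2] by (simp_all add: hom_poset_cat A_def D_def r_def)
  have "pushout_square C a b c s f g (l 1) (l 2)"
  proof (rule pushout_squareI[OF f g l1 l2])
    show "l 1 \<cdot> f = l 2 \<cdot> g" using l0 by simp
  next
    fix x i' j' assume ij: "i' \<in> hom C b x" "j' \<in> hom C c x" "i' \<cdot> f = j' \<cdot> g"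
    define m where "m n = (if n = 0 then i' \<cdot> f else if n = 1 then i' else j')" for n :: nat
    have "is_cocone (poset_cat A r) C D x m"
      by (rule cocone_poset_catI)
        (use ij f g homD[OF ij(1)] homD[OF ij(2)] o comp_hom[OF f ij(1)]
          in \<open>auto simp: A_def r_def D_def m_def split: if_splits\<close>)
    then obtain h where "h \<in> hom C s x" "\<And>n. n \<in> A \<Longrightarrow> h \<cdot> l n = m n"
      using colimit_desc[OF l] unfolding Obj_poset_cat by metis
    then show "\<exists>h\<in>hom C s x. h \<cdot> l 1 = i' \<and> h \<cdot> l 2 = j'"
      by (intro bexI[of _ h]) (auto simp: A_def m_def)
  next
    fix x h h' assume h: "h \<in> hom C s x" "h' \<in> hom C s x" "h \<cdot> l 1 = h' \<cdot> l 1" "h \<cdot> l 2 = h' \<cdot> l 2"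
    have "h \<cdot> l n = h' \<cdot> l n" if n: "n \<in> A" for n
    proof (cases "n = 0")
      case True
      then show ?thesis
        using l0(1) comp_assoc[OF f l1 h(1)] comp_assoc[OF f l1 h(2)] h(3) by simp
    qed (use n h in \<open>auto simp: A_def\<close>)
    then show "h = h'" using colimit_eqI[OF l J D h(1,2)] by simp
  qed
  then show ?thesis by (rule that)
qed

text \<open>Maps out of a pushout form a pullback of hom sets, and finite limits of sets commute
  with filtered colimits. The argument is carried out on elements: components are found at stages of
  the diagram and their compatibility is reached at a later stage.\<close>

lemma fp_pushout:
  assumes po: "pushout_square C a b c s f g i j" and a: "fp a" and b: "fp b" and c: "fp c"
  shows "fp s"
proof (rule finitely_presentableI)
  note po' = pushoutD[OF po]
  show "s \<in> Obj C" using homD[OF po'(3)] by blast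
  fix J :: "('u, 'u) cat" and D z l
  assume J: "category J" "small U (Obj J)" "small U (Mor J)" "filtered J"
    and D: "is_functor J C D" and z: "is_colimit J C D z l"
  interpret J: category J by fact
  note comm = finitely_presentable_commutes[OF _ J D z]
  note L = coconeD[OF colimit_cocone[OF z]] and F = functorD[OF D]
  have move: "fmor D (v \<cdot>\<^bsub>J\<^esub> u) \<cdot> t = fmor D v \<cdot> (fmor D u \<cdot> t)"
    if "t \<in> hom C y (fobj D k)" "u \<in> hom J k k'" "v \<in> hom J k' k''" for t y k k' k'' u v
    using F(4)[OF that(2,3)] comp_assoc[OF that(1) F(2)[OF that(2)] F(2)[OF that(3)]] by simp
  have push: "l k' \<cdot> (fmor D u \<cdot> t) = l k \<cdot> t"
    if "t \<in> hom C y (fobj D k)" "u \<in> hom J k k'" for t y k k' u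
    using triangle_ext[OF L(3)[OF that(2)] F(2)[OF that(2)] L(2) that(1)] J.homD[OF that(2)] by blast
  show "commutes_hom J C D z l s"
    unfolding commutes_hom_def
  proof (intro conjI ballI impI)
    fix t assume t: "t \<in> hom C s z"
    obtain m p where p: "m \<in> Obj J" "p \<in> hom C b (fobj D m)" "l m \<cdot> p = t \<cdot> i"
      using commutes_hom_factor[OF comm[OF b] comp_hom[OF po'(3) t]] .
    obtain n q where q: "n \<in> Obj J" "q \<in> hom C c (fobj D n)" "l n \<cdot> q = t \<cdot> j"
      using commutes_hom_factor[OF comm[OF c] comp_hom[OF po'(4) t]] .
    obtain k u v where uv: "u \<in> hom J m k" "v \<in> hom J n k" using J.filtered_bound[OF J(4) p(1) q(1)] .
    have k: "k \<in> Obj J" using J.homD[OF uv(1)] by blast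
    define p' where "p' = fmor D u \<cdot> p"
    define q' where "q' = fmor D v \<cdot> q"
    have p': "p' \<in> hom C b (fobj D k)" "l k \<cdot> p' = t \<cdot> i"
      unfolding p'_def using comp_hom[OF p(2) F(2)[OF uv(1)]] push[OF p(2) uv(1)] p(3) by auto
    have q': "q' \<in> hom C c (fobj D k)" "l k \<cdot> q' = t \<cdot> j"
      unfolding q'_def using comp_hom[OF q(2) F(2)[OF uv(2)]] push[OF q(2) uv(2)] q(3) by auto
    have "l k \<cdot> (p' \<cdot> f) = l k \<cdot> (q' \<cdot> g)"
      using triangle_ext[OF p'(2) p'(1) L(2)[OF k] po'(1)] triangle_ext[OF q'(2) q'(1) L(2)[OF k] po'(2)]
        comp_assoc[OF po'(1,3) t] comp_assoc[OF po'(2,4) t] po'(5) by simp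
    \<comment> \<open>The components on \<open>b\<close> and \<open>c\<close> are only known to
      agree on \<open>a\<close> after mapping into the colimit; finite presentability of
      \<open>a\<close> makes them agree at the stage \<open>k'\<close>, where they can be
      glued.\<close>
    then obtain k' w where w: "w \<in> hom J k k'" "fmor D w \<cdot> (p' \<cdot> f) = fmor D w \<cdot> (q' \<cdot> g)"
      using commutes_hom_eq[OF comm[OF a] k comp_hom[OF po'(1) p'(1)] comp_hom[OF po'(2) q'(1)]] by blast
    have k': "k' \<in> Obj J" using J.homD[OF w(1)] by blast
    obtain h where h: "h \<in> hom C s (fobj D k')" "h \<cdot> i = fmor D w \<cdot> p'" "h \<cdot> j = fmor D w \<cdot> q'"
      using pushout_desc[OF po comp_hom[OF p'(1) F(2)[OF w(1)]] comp_hom[OF q'(1) F(2)[OF w(1)]]]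
        w(2) comp_assoc[OF po'(1) p'(1) F(2)[OF w(1)]] comp_assoc[OF po'(2) q'(1) F(2)[OF w(1)]]
      by metis
    have "l k' \<cdot> h = t"
    proof (rule pushout_eqI[OF po comp_hom[OF h(1) L(2)[OF k']] t])
      show "(l k' \<cdot> h) \<cdot> i = t \<cdot> i"
        using comp_assoc[OF po'(3) h(1) L(2)[OF k']] h(2) push[OF p'(1) w(1)] p'(2) by simp
      show "(l k' \<cdot> h) \<cdot> j = t \<cdot> j"
        using comp_assoc[OF po'(4) h(1) L(2)[OF k']] h(3) push[OF q'(1) w(1)] q'(2) by simp
    qed
    then show "\<exists>j\<in>Obj J. \<exists>g'\<in>hom C s (fobj D j). l j \<cdot> g' = t" using k' h(1) by blast
  next
    fix k t t' assume k: "k \<in> Obj J" and t: "t \<in> hom C s (fobj D k)" "t' \<in> hom C s (fobj D k)"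
      and eq: "l k \<cdot> t = l k \<cdot> t'"
    have "l k \<cdot> (t \<cdot> i) = l k \<cdot> (t' \<cdot> i)" "l k \<cdot> (t \<cdot> j) = l k \<cdot> (t' \<cdot> j)"
      using square_ext[OF eq t(1) L(2)[OF k] t(2) L(2)[OF k]] po'(3,4) by blast+
    then obtain m u n v where
      u: "u \<in> hom J k m" "fmor D u \<cdot> (t \<cdot> i) = fmor D u \<cdot> (t' \<cdot> i)" and
      v: "v \<in> hom J k n" "fmor D v \<cdot> (t \<cdot> j) = fmor D v \<cdot> (t' \<cdot> j)"
      using commutes_hom_eq[OF comm[OF b] k comp_hom[OF po'(3) t(1)] comp_hom[OF po'(3) t(2)]]
        commutes_hom_eq[OF comm[OF c] k comp_hom[OF po'(4) t(1)] comp_hom[OF po'(4) t(2)]] by metis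
    \<comment> \<open>The restrictions to \<open>b\<close> and to \<open>c\<close> become equal at
      different stages. The span completion makes the two transition maps coincide, so that a single
      map out of \<open>k\<close> equalizes both.\<close>
    obtain k' p q where pq: "p \<in> hom J m k'" "q \<in> hom J n k'" "p \<cdot>\<^bsub>J\<^esub> u = q \<cdot>\<^bsub>J\<^esub> v"
      using J.filtered_span[OF J(4) u(1) v(1)] .
    define w where "w = p \<cdot>\<^bsub>J\<^esub> u"
    have w: "w \<in> hom J k k'" unfolding w_def using J.comp_hom[OF u(1) pq(1)] .
    have "fmor D w \<cdot> t = fmor D w \<cdot> t'"
    proof (rule pushout_eqI[OF po comp_hom[OF t(1) F(2)[OF w]] comp_hom[OF t(2) F(2)[OF w]]])
      show "(fmor D w \<cdot> t) \<cdot> i = (fmor D w \<cdot> t') \<cdot> i"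
        using comp_assoc[OF po'(3) t(1) F(2)[OF w]] comp_assoc[OF po'(3) t(2) F(2)[OF w]]
          move[OF comp_hom[OF po'(3) t(1)] u(1) pq(1)] move[OF comp_hom[OF po'(3) t(2)] u(1) pq(1)]
          u(2) unfolding w_def by simp
      show "(fmor D w \<cdot> t) \<cdot> j = (fmor D w \<cdot> t') \<cdot> j"
        using comp_assoc[OF po'(4) t(1) F(2)[OF w]] comp_assoc[OF po'(4) t(2) F(2)[OF w]]
          move[OF comp_hom[OF po'(4) t(1)] v(1) pq(2)] move[OF comp_hom[OF po'(4) t(2)] v(1) pq(2)]
          v(2) unfolding w_def pq(3) by simp
    qed
    then show "\<exists>m. \<exists>u\<in>hom J k m. fmor D u \<cdot> t = fmor D u \<cdot> t'" using w by blast
  qed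
qed

text \<open>The colimit of the empty diagram. It is finitely presentable because all the hom sets
  out of it are singletons and a filtered index category is nonempty.\<close>

lemma initial_exists:
  obtains z where "is_initial C z" and "fp z"
proof -
  define J :: "(nat, nat \<times> nat) cat" where "J = poset_cat {} (\<lambda>_ _. True)"
  have J: "category J" unfolding J_def by (rule category_poset_cat) auto
  have D: "is_functor J C D" for D unfolding J_def by (rule functor_poset_catI) auto
  obtain z l where z: "is_colimit J C undefined z l"
    using colimit_exists[OF J _ _ D] small_poset_cat[OF universe small_finite[OF universe]]
    unfolding J_def by blast
  have "is_initial C z"
    unfolding is_initial_def
  proof (intro conjI ballI)
    show "z \<in> Obj C" using coconeD(1)[OF colimit_cocone[OF z]] .
    fix a assume "a \<in> Obj C"
    then have "is_cocone J C undefined a l" unfolding J_def by (intro cocone_poset_catI) auto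
    then show "\<exists>!f. f \<in> hom C z a" using z unfolding is_colimit_def J_def by auto
  qed
  moreover have "fp z"
  proof (rule finitely_presentableI)
    show "z \<in> Obj C" using calculation unfolding is_initial_def by blast
    fix K :: "('u, 'u) cat" and D c l
    assume K: "category K" "filtered K" and D: "is_functor K C D" and c: "is_colimit K C D c l"
    interpret K: category K by fact
    note L = coconeD[OF colimit_cocone[OF c]]
    obtain k where k: "k \<in> Obj K" using K(2) unfolding filtered_def by blast
    have u: "\<exists>!f. f \<in> hom C z (fobj D j)" if "j \<in> Obj K" for j
      using \<open>is_initial C z\<close> functorD(1)[OF D that] unfolding is_initial_def by blast
    have "\<exists>!f. f \<in> hom C z c" using \<open>is_initial C z\<close> L(1) unfolding is_initial_def by blast
    then show "commutes_hom K C D c l z"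
      unfolding commutes_hom_def using k u[OF k] comp_hom[OF _ L(2)[OF k]] u K.ident_hom by metis
  qed
  ultimately show ?thesis by (rule that)
qed

lemma coproduct_exists:
  assumes a: "a \<in> Obj C" and b: "b \<in> Obj C"
  obtains s in0 in1 z f g where "is_coproduct C a b s in0 in1" and "is_initial C z"
    and "pushout_square C z a b s f g in0 in1" and "fp a \<Longrightarrow> fp b \<Longrightarrow> fp s"
proof -
  obtain z where z: "is_initial C z" "fp z" using initial_exists .
  have u: "\<exists>!f. f \<in> hom C z x" if "x \<in> Obj C" for x
    using z that unfolding is_initial_def by blast
  obtain f g where fg: "f \<in> hom C z a" "g \<in> hom C z b" using u a b by metis
  obtain s i j where po: "pushout_square C z a b s f g i j" using pushout_exists[OF fg] .
  note po' = pushoutD[OF po]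
  have "is_coproduct C a b s i j"
    unfolding is_coproduct_def
  proof (intro conjI allI ballI)
    fix x p q assume p: "p \<in> hom C a x" and q: "q \<in> hom C b x"
    then have "p \<cdot> f = q \<cdot> g" using u comp_hom[OF fg(1) p] comp_hom[OF fg(2) q] homD[OF p] by metis
    then show "\<exists>!h. h \<in> hom C s x \<and> h \<cdot> i = p \<and> h \<cdot> j = q"
      using po p q unfolding pushout_square_def by blast
  qed (fact po')+
  then show ?thesis using that z po fp_pushout[OF po z(2)] by blast
qed

text \<open>The coequalizer of a parallel pair is the pushout of the induced map
  \<open>y \<squnion> y \<rightarrow> c\<close> along the fold map of \<open>y\<close>. In this form
  finite presentability is inherited from the pushout.\<close>

lemma coequalizer_exists:
  assumes g: "g \<in> hom C y c" "g' \<in> hom C y c" and fp: "fp y" "fp c"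
  shows "\<exists>q e. e \<in> hom C c q \<and> e \<cdot> g = e \<cdot> g' \<and> fp q \<and>
    (\<forall>x. \<forall>k\<in>hom C c x. k \<cdot> g = k \<cdot> g' \<longrightarrow> (\<exists>h\<in>hom C q x. h \<cdot> e = k)) \<and>
    (\<forall>x. \<forall>h\<in>hom C q x. \<forall>h'\<in>hom C q x. h \<cdot> e = h' \<cdot> e \<longrightarrow> h = h')"
proof -
  have y: "y \<in> Obj C" using homD[OF g(1)] by blast
  obtain t i0 i1 where t: "is_coproduct C y y t i0 i1" "fp y \<Longrightarrow> fp y \<Longrightarrow> fp t"
    using coproduct_exists[OF y y] by metis
  note i = coproductD[OF t(1)]
  obtain G where G: "G \<in> hom C t c" "G \<cdot> i0 = g" "G \<cdot> i1 = g'" using coproduct_desc[OF t(1) g] .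
  obtain d where d: "d \<in> hom C t y" "d \<cdot> i0 = Ident C y" "d \<cdot> i1 = Ident C y"
    using coproduct_desc[OF t(1) ident_hom[OF y] ident_hom[OF y]] .
  obtain q e m where po: "pushout_square C t c y q G d e m" using pushout_exists[OF G(1) d(1)] .
  note po' = pushoutD[OF po]
  \<comment> \<open>The second leg \<open>m\<close> of the pushout is the common value of both
    composites, by restricting the square to the two copies of \<open>y\<close>.\<close>
  have eg: "e \<cdot> g = m" "e \<cdot> g' = m"
    using square_ext[OF po'(5,1,3,2,4) i(1)] square_ext[OF po'(5,1,3,2,4) i(2)] G d comp_ident[OF po'(4)]
    by simp_all
  show ?thesis
  proof (intro exI conjI allI ballI impI)
    show "e \<in> hom C c q" by (fact po')
    show "e \<cdot> g = e \<cdot> g'" using eg by simp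
    show "fp q" using fp_pushout[OF po] t(2) fp by blast
  next
    fix x k assume k: "k \<in> hom C c x" "k \<cdot> g = k \<cdot> g'"
    have kg: "k \<cdot> g \<in> hom C y x" using comp_hom[OF g(1) k(1)] .
    have "k \<cdot> G = (k \<cdot> g) \<cdot> d"
      by (rule coproduct_eqI[OF t(1) comp_hom[OF G(1) k(1)] comp_hom[OF d(1) kg]])
        (use comp_assoc[OF i(1) G(1) k(1)] comp_assoc[OF i(2) G(1) k(1)] comp_assoc[OF i(1) d(1) kg]
          comp_assoc[OF i(2) d(1) kg] G d k comp_ident[OF kg] in simp_all)
    then show "\<exists>h\<in>hom C q x. h \<cdot> e = k" using pushout_desc[OF po k(1) kg] by metis
  next
    fix x h h' assume h: "h \<in> hom C q x" "h' \<in> hom C q x" "h \<cdot> e = h' \<cdot> e"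
    show "h = h'"
      using pushout_eqI[OF po h] eg(1) comp_assoc[OF g(1) po'(3) h(1)] comp_assoc[OF g(1) po'(3) h(2)]
        h(3) by simp
  qed
qed

section \<open>Detecting colimits by finitely presentable objects; a small skeleton\<close>

section \<open>Canonical presentations\<close>

text \<open>The legs of a presentation of \<open>c\<close> as a filtered colimit of finitely
  presentable objects are already jointly epic.\<close>

lemma fp_jointly_epi:
  assumes h: "h \<in> hom C c c'" "h' \<in> hom C c c'"
    and eq: "\<And>x t. fp x \<Longrightarrow> t \<in> hom C x c \<Longrightarrow> h \<cdot> t = h' \<cdot> t"
  shows "h = h'"
proof -
  have "c \<in> Obj C" using homD[OF h(1)] by blast
  then obtain J :: "('u, 'u) cat" and D l where J: "category J" "is_functor J C D"
    "\<And>j. j \<in> Obj J \<Longrightarrow> fp (fobj D j)" and l: "is_colimit J C D c l"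
    using presentation by metis
  show ?thesis
    by (rule colimit_eqI[OF l J(1,2) h]) (use eq J(3) coconeD(2)[OF colimit_cocone[OF l]] in blast)
qed

text \<open>Finitely presentable objects detect filtered colimits. The apex is presented by finitely
  presentable objects \<open>E k\<close>; each leg of that presentation factors through some stage
  of \<open>D\<close>, so a competing cocone \<open>m\<close> on \<open>D\<close> induces one on
  \<open>E\<close>, and the mediating map comes from the colimit of \<open>E\<close>.\<close>

lemma colimit_if_commutes_hom:
  assumes J: "category J" "filtered J" and D: "is_functor J C D" and c: "is_cocone J C D c l"
    and comm: "\<And>x. fp x \<Longrightarrow> commutes_hom J C D c l x"
  shows "is_colimit J C D c l"
  unfolding is_colimit_def
proof (intro conjI allI impI)
  interpret J: category J by fact
  note L = coconeD[OF c] and F = functorD[OF D]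
  fix c' m assume m: "is_cocone J C D c' m"
  note M = coconeD[OF m]
  \<comment> \<open>Independence of the choice of stage: two factorizations of the same map into the
    apex agree at a later stage, hence have the same image under any cocone
    \<open>m\<close>.\<close>
  have wd: "m j \<cdot> g = m j' \<cdot> g'"
    if x: "fp x" and j: "j \<in> Obj J" "j' \<in> Obj J" and g: "g \<in> hom C x (fobj D j)" "g' \<in> hom C x (fobj D j')"
      and eq: "l j \<cdot> g = l j' \<cdot> g'" for x j j' g g'
  proof -
    obtain k u v where uv: "u \<in> hom J j k" "v \<in> hom J j' k" using J.filtered_bound[OF J(2) j] .
    have k: "k \<in> Obj J" using J.homD[OF uv(1)] by blast
    note Dg = comp_hom[OF g(1) F(2)[OF uv(1)]] comp_hom[OF g(2) F(2)[OF uv(2)]]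
    have "l k \<cdot> (fmor D u \<cdot> g) = l k \<cdot> (fmor D v \<cdot> g')"
      using triangle_ext[OF L(3)[OF uv(1)] F(2)[OF uv(1)] L(2)[OF k] g(1)]
        triangle_ext[OF L(3)[OF uv(2)] F(2)[OF uv(2)] L(2)[OF k] g(2)] eq by simp
    then obtain k' w where w: "w \<in> hom J k k'" "fmor D w \<cdot> (fmor D u \<cdot> g) = fmor D w \<cdot> (fmor D v \<cdot> g')"
      using commutes_hom_eq[OF comm[OF x] k Dg] by blast
    have k': "k' \<in> Obj J" using J.homD[OF w(1)] by blast
    have "m k \<cdot> (fmor D u \<cdot> g) = m k \<cdot> (fmor D v \<cdot> g')"
      using triangle_ext[OF M(3)[OF w(1)] F(2)[OF w(1)] M(2)[OF k'] Dg(1)]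
        triangle_ext[OF M(3)[OF w(1)] F(2)[OF w(1)] M(2)[OF k'] Dg(2)] w(2) by simp
    then show ?thesis
      using triangle_ext[OF M(3)[OF uv(1)] F(2)[OF uv(1)] M(2)[OF k] g(1)]
        triangle_ext[OF M(3)[OF uv(2)] F(2)[OF uv(2)] M(2)[OF k] g(2)] by simp
  qed
  obtain K :: "('u, 'u) cat" and E e where K: "category K" "small U (Obj K)" "small U (Mor K)" "filtered K"
    and E: "is_functor K C E" "\<And>k. k \<in> Obj K \<Longrightarrow> fp (fobj E k)" and e: "is_colimit K C E c e"
    using presentation[OF L(1)] by metis
  interpret K: category K by fact
  note N = coconeD[OF colimit_cocone[OF e]]
  have "\<exists>j g. j \<in> Obj J \<and> g \<in> hom C (fobj E k) (fobj D j) \<and> l j \<cdot> g = e k" if "k \<in> Obj K" for k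
    using commutes_hom_factor[OF comm[OF E(2)[OF that]] N(2)[OF that]] by metis
  then obtain jj gg where jg: "\<And>k. k \<in> Obj K \<Longrightarrow> jj k \<in> Obj J"
      "\<And>k. k \<in> Obj K \<Longrightarrow> gg k \<in> hom C (fobj E k) (fobj D (jj k))"
      "\<And>k. k \<in> Obj K \<Longrightarrow> l (jj k) \<cdot> gg k = e k" by metis
  \<comment> \<open>The stage \<open>jj k\<close> and the factorization \<open>gg k\<close> are
    chosen without any naturality; compatibility of the maps \<open>n k\<close> is exactly
    \<open>wd\<close>.\<close>
  define n where "n k = m (jj k) \<cdot> gg k" for k
  have "is_cocone K C E c' n"
    unfolding is_cocone_def
  proof (intro conjI ballI allI)
    show "c' \<in> Obj C" by (fact M)
    show "n k \<in> hom C (fobj E k) c'" if "k \<in> Obj K" for k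
      unfolding n_def using comp_hom[OF jg(2) M(2)[OF jg(1)]] that by blast
    show "n k' \<cdot> fmor E t = n k" if t: "t \<in> hom K k k'" for k k' t
    proof -
      have k: "k \<in> Obj K" "k' \<in> Obj K" using K.homD[OF t] by auto
      note Et = functorD(2)[OF E(1) t]
      have "l (jj k') \<cdot> (gg k' \<cdot> fmor E t) = l (jj k) \<cdot> gg k"
        using triangle_ext[OF jg(3)[OF k(2)] jg(2)[OF k(2)] L(2)[OF jg(1)[OF k(2)]] Et] N(3)[OF t] jg(3)[OF k(1)]
        by simp
      from wd[OF E(2)[OF k(1)] jg(1)[OF k(2)] jg(1)[OF k(1)] comp_hom[OF Et jg(2)[OF k(2)]] jg(2)[OF k(1)] this]
      show ?thesis
        unfolding n_def using comp_assoc[OF Et jg(2)[OF k(2)] M(2)[OF jg(1)[OF k(2)]]] by simp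
    qed
  qed
  then obtain h where h: "h \<in> hom C c c'" "\<And>k. k \<in> Obj K \<Longrightarrow> h \<cdot> e k = n k"
    using colimit_desc[OF e] by metis
  have hl: "h \<cdot> l j = m j" if j: "j \<in> Obj J" for j
  proof (rule fp_jointly_epi[OF comp_hom[OF L(2)[OF j] h(1)] M(2)[OF j]])
    fix x t assume x: "fp x" and t: "t \<in> hom C x (fobj D j)"
    obtain k s where k: "k \<in> Obj K" and s: "s \<in> hom C x (fobj E k)" "e k \<cdot> s = l j \<cdot> t"
      using commutes_hom_factor[OF finitely_presentable_commutes[OF x K E(1) e] comp_hom[OF t L(2)[OF j]]] .
    note A = triangle_ext[OF jg(3)[OF k] jg(2)[OF k] L(2)[OF jg(1)[OF k]] s(1)]
    have "m (jj k) \<cdot> (gg k \<cdot> s) = m j \<cdot> t"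
      by (rule wd[OF x jg(1)[OF k] j comp_hom[OF s(1) jg(2)[OF k]] t]) (use A s(2) in simp)
    moreover have "(h \<cdot> l j) \<cdot> t = (h \<cdot> e k) \<cdot> s"
      using comp_assoc[OF t L(2)[OF j] h(1)] comp_assoc[OF s(1) N(2)[OF k] h(1)] s(2) by simp
    moreover have "n k \<cdot> s = m (jj k) \<cdot> (gg k \<cdot> s)"
      unfolding n_def using comp_assoc[OF s(1) jg(2)[OF k] M(2)[OF jg(1)[OF k]]] .
    ultimately show "(h \<cdot> l j) \<cdot> t = m j \<cdot> t" using h(2)[OF k] by simp
  qed
  show "\<exists>!h. h \<in> hom C c c' \<and> (\<forall>j\<in>Obj J. h \<cdot> l j = m j)"
  proof (rule ex1I[of _ h])
    show "h \<in> hom C c c' \<and> (\<forall>j\<in>Obj J. h \<cdot> l j = m j)" using h hl by blast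
    fix h' assume h': "h' \<in> hom C c c' \<and> (\<forall>j\<in>Obj J. h' \<cdot> l j = m j)"
    show "h' = h"
    proof (rule colimit_eqI[OF e K(1) E(1) _ h(1)])
      show "h' \<in> hom C c c'" using h' by blast
      fix k assume k: "k \<in> Obj K"
      have "h' \<cdot> e k = (h' \<cdot> l (jj k)) \<cdot> gg k"
        using comp_assoc[OF jg(2)[OF k] L(2)[OF jg(1)[OF k]], of h' c'] h' unfolding jg(3)[OF k] by simp
      then show "h' \<cdot> e k = h \<cdot> e k" using h' jg(1)[OF k] h(2)[OF k] unfolding n_def by simp
    qed
  qed
qed (fact c)

text \<open>Factoring its identity through a presentation makes a finitely presentable object a
  retract of some \<open>s\<close> in the small generating set \<open>S\<close>. A retract is
  determined up to isomorphism by its idempotent on \<open>s\<close>, and there is only a small set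
  of pairs \<open>(s, \<epsilon>)\<close>; one splitting is chosen for each.\<close>

lemma small_fp_representatives:
  obtains R where "small U R" and "\<And>x. x \<in> R \<Longrightarrow> fp x"
    and "\<And>x. fp x \<Longrightarrow> \<exists>r\<in>R. \<exists>f g. inverse_arrows C x r f g"
proof -
  obtain S where S: "small U S" "\<And>x. x \<in> S \<Longrightarrow> fp x" "generates_under_filtered_colimits U C S"
    using lfp unfolding locally_finitely_presentable_def finitely_accessible_def by metis
  define Q where "Q s \<epsilon> x \<longleftrightarrow> fp x \<and> (\<exists>g\<in>hom C x s. \<exists>r\<in>hom C s x. r \<cdot> g = Ident C x \<and> g \<cdot> r = \<epsilon>)" for s \<epsilon> x
  define T where "T = {(s, \<epsilon>). s \<in> S \<and> \<epsilon> \<in> hom C s s \<and> (\<exists>x. Q s \<epsilon> x)}"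
  define R where "R = (\<lambda>(s, \<epsilon>). SOME x. Q s \<epsilon> x) ` T"
  have "small U (SIGMA s:S. hom C s s)"
    by (rule small_Sigma[OF universe S(1)]) (intro small_hom fp_Obj S(2); assumption)
  then have "small U T" by (rule small_subset[rotated]) (auto simp: T_def)
  then have "small U R" unfolding R_def by (rule small_image)
  have Q: "Q s \<epsilon> (SOME x. Q s \<epsilon> x)" if "(s, \<epsilon>) \<in> T" for s \<epsilon>
    by (rule someI_ex) (use that in \<open>simp add: T_def\<close>)
  have Q_fp: "fp x" if "Q s \<epsilon> x" for s \<epsilon> x
    using that unfolding Q_def by blast
  show ?thesis
  proof (rule that[OF \<open>small U R\<close>])
    show "fp x" if "x \<in> R" for x using that Q_fp[OF Q] unfolding R_def by auto
    fix x assume x: "fp x"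
    obtain J :: "('u, 'u) cat" and D l where J': "small_category U J" "filtered J" "is_functor J C D"
      "\<forall>j\<in>Obj J. fobj D j \<in> S" and l: "is_colimit J C D x l"
      using bspec[OF S(3)[unfolded generates_under_filtered_colimits_def] fp_Obj[OF x]] by blast
    have J: "category J" "small U (Obj J)" "small U (Mor J)" "filtered J" "is_functor J C D"
      "\<forall>j\<in>Obj J. fobj D j \<in> S" using J' unfolding small_category_def by auto
    obtain j g where j: "j \<in> Obj J" and g: "g \<in> hom C x (fobj D j)" "l j \<cdot> g = Ident C x"
      using commutes_hom_factor[OF finitely_presentable_commutes[OF x J(1-5) l] ident_hom[OF fp_Obj[OF x]]] .
    define s where "s = fobj D j"
    define r where "r = l j"
    have r: "r \<in> hom C s x" "r \<cdot> g = Ident C x" and g: "g \<in> hom C x s"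
      using g coconeD(2)[OF colimit_cocone[OF l] j] unfolding s_def r_def by auto
    have "Q s (g \<cdot> r) x" using x g r unfolding Q_def by blast
    moreover have "s \<in> S" using J(6) j unfolding s_def by blast
    ultimately have T: "(s, g \<cdot> r) \<in> T" unfolding T_def using comp_hom[OF r(1) g] by blast
    define y where "y = (SOME y. Q s (g \<cdot> r) y)"
    have "Q s (g \<cdot> r) y" unfolding y_def by (rule Q[OF T])
    then obtain g' r' where y: "fp y" "g' \<in> hom C y s" "r' \<in> hom C s y" "r' \<cdot> g' = Ident C y"
      "g' \<cdot> r' = g \<cdot> r" unfolding Q_def by blast
    \<comment> \<open>\<open>x\<close> and the chosen object \<open>y\<close> split the same
      idempotent of \<open>s\<close>; comparing through \<open>s\<close> gives mutually inverse
      maps.\<close>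
    have "inverse_arrows C x y (r' \<cdot> g) (r \<cdot> g')"
      unfolding inverse_arrows_def
    proof (intro conjI)
      show "r' \<cdot> g \<in> hom C x y" "r \<cdot> g' \<in> hom C y x" using comp_hom g r y by blast+
      have "(r \<cdot> g') \<cdot> (r' \<cdot> g) = r \<cdot> ((g' \<cdot> r') \<cdot> g)" using g r y(2,3) by (simp add: hom_def)
      also have "\<dots> = (r \<cdot> g) \<cdot> (r \<cdot> g)" unfolding y(5) using g r(1) by (simp add: hom_def)
      also have "\<dots> = Ident C x" unfolding r(2) using fp_Obj[OF x] by simp
      finally show "(r \<cdot> g') \<cdot> (r' \<cdot> g) = Ident C x" .
      have "(r' \<cdot> g) \<cdot> (r \<cdot> g') = r' \<cdot> ((g \<cdot> r) \<cdot> g')" using g r(1) y(2,3) by (simp add: hom_def)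
      also have "\<dots> = (r' \<cdot> g') \<cdot> (r' \<cdot> g')" unfolding y(5)[symmetric] using y(2,3) by (simp add: hom_def)
      also have "\<dots> = Ident C y" unfolding y(4) using fp_Obj[OF y(1)] by simp
      finally show "(r' \<cdot> g) \<cdot> (r \<cdot> g') = Ident C y" .
    qed
    moreover have "y \<in> R" unfolding R_def y_def using imageI[OF T, of "\<lambda>(s, \<epsilon>). SOME x. Q s \<epsilon> x"] by simp
    ultimately show "\<exists>r\<in>R. \<exists>f g. inverse_arrows C x r f g" by blast
  qed
qed

end

section \<open>Closure properties of left lifting classes\<close>

section \<open>Lifting properties\<close>

context category
begin

lemma has_liftingD:
  assumes "has_lifting C i q" and "i \<in> hom C a b" and "q \<in> hom C x y"
    and "u \<in> hom C a x" and "v \<in> hom C b y" and "q \<cdot> u = v \<cdot> i"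
  obtains h where "h \<in> hom C b x" and "h \<cdot> i = u" and "q \<cdot> h = v"
proof -
  have e: "Dom C i = a" "Cod C i = b" "Dom C q = x" "Cod C q = y"
    using assms(2,3) by (auto simp: hom_def)
  show ?thesis
    using assms(1,4-6) that unfolding has_lifting_def e by blast
qed

lemma has_liftingI:
  assumes "i \<in> hom C a b" and "q \<in> hom C x y"
    and "\<And>u v. u \<in> hom C a x \<Longrightarrow> v \<in> hom C b y \<Longrightarrow> q \<cdot> u = v \<cdot> i \<Longrightarrow>
      \<exists>h\<in>hom C b x. h \<cdot> i = u \<and> q \<cdot> h = v"
  shows "has_lifting C i q"
  using assms unfolding has_lifting_def by (simp add: hom_def)

lemma llpD: "i \<in> llp C Q \<Longrightarrow> q \<in> Q \<Longrightarrow> has_lifting C i q"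
  unfolding llp_def by blast

lemma llp_comp:
  assumes Q: "Q \<subseteq> Mor C" and i: "i \<in> llp C Q" "i \<in> hom C a b" and j: "j \<in> llp C Q" "j \<in> hom C b c"
  shows "j \<cdot> i \<in> llp C Q"
proof -
  have "has_lifting C (j \<cdot> i) q" if q: "q \<in> Q" for q
  proof (rule has_liftingI[OF comp_hom[OF i(2) j(2)] hom_Mor])
    show "q \<in> Mor C" using Q q by blast
    note qh = hom_Mor[OF this]
    fix u v
    assume u: "u \<in> hom C a (Dom C q)" and v: "v \<in> hom C c (Cod C q)" and eq: "q \<cdot> u = v \<cdot> (j \<cdot> i)"
    have "q \<cdot> u = (v \<cdot> j) \<cdot> i" using eq comp_assoc[OF i(2) j(2) v] by simp
    then obtain h where h: "h \<in> hom C b (Dom C q)" "h \<cdot> i = u" "q \<cdot> h = v \<cdot> j"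
      using has_liftingD[OF llpD[OF i(1) q] i(2) qh u comp_hom[OF j(2) v]] by metis
    obtain k where k: "k \<in> hom C c (Dom C q)" "k \<cdot> j = h" "q \<cdot> k = v"
      using has_liftingD[OF llpD[OF j(1) q] j(2) qh h(1) v h(3)] .
    have "k \<cdot> (j \<cdot> i) = u" using comp_assoc[OF i(2) j(2) k(1)] k(2) h(2) by simp
    then show "\<exists>h\<in>hom C c (Dom C q). h \<cdot> (j \<cdot> i) = u \<and> q \<cdot> h = v" using k by blast
  qed
  then show ?thesis unfolding llp_def using comp_hom[OF i(2) j(2)] by (simp add: hom_def)
qed

lemma llp_pushout:
  assumes Q: "Q \<subseteq> Mor C" and f: "f \<in> llp C Q" and po: "pushout_square C a b c s f g i j"
  shows "j \<in> llp C Q"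
proof -
  note D = pushoutD[OF po]
  have "has_lifting C j q" if q: "q \<in> Q" for q
  proof (rule has_liftingI[OF D(4) hom_Mor])
    show "q \<in> Mor C" using Q q by blast
    note qh = hom_Mor[OF this]
    fix u v
    assume u: "u \<in> hom C c (Dom C q)" and v: "v \<in> hom C s (Cod C q)" and eq: "q \<cdot> u = v \<cdot> j"
    have "q \<cdot> (u \<cdot> g) = (v \<cdot> i) \<cdot> f"
      using square_ext[OF eq u qh D(4) v D(2)] comp_assoc[OF D(1,3) v] D(5) by simp
    then obtain h where h: "h \<in> hom C b (Dom C q)" "h \<cdot> f = u \<cdot> g" "q \<cdot> h = v \<cdot> i"
      using has_liftingD[OF llpD[OF f q] D(1) qh comp_hom[OF D(2) u] comp_hom[OF D(3) v]] by metis
    obtain k where k: "k \<in> hom C s (Dom C q)" "k \<cdot> i = h" "k \<cdot> j = u"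
      using pushout_desc[OF po h(1) u h(2)] .
    have "q \<cdot> k = v"
      by (rule pushout_eqI[OF po comp_hom[OF k(1) qh] v])
        (use comp_assoc[OF D(3) k(1) qh] comp_assoc[OF D(4) k(1) qh] k h eq in simp_all)
    then show "\<exists>h\<in>hom C s (Dom C q). h \<cdot> j = u \<and> q \<cdot> h = v" using k by blast
  qed
  then show ?thesis unfolding llp_def using D(4) by (simp add: hom_def)
qed

lemma llp_inverse_arrows:
  assumes Q: "Q \<subseteq> Mor C" and iso: "inverse_arrows C a b f g"
  shows "f \<in> llp C Q"
proof -
  note F = inverse_arrowsD[OF iso]
  have "has_lifting C f q" if q: "q \<in> Q" for q
  proof (rule has_liftingI[OF F(1) hom_Mor])
    show "q \<in> Mor C" using Q q by blast
    note qh = hom_Mor[OF this]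
    fix u v
    assume u: "u \<in> hom C a (Dom C q)" and v: "v \<in> hom C b (Cod C q)" and eq: "q \<cdot> u = v \<cdot> f"
    have "(u \<cdot> g) \<cdot> f = u" using comp_assoc[OF F(1,2) u] F(3) comp_ident[OF u] by simp
    moreover have "q \<cdot> (u \<cdot> g) = v" using square_ext[OF eq u qh F(1) v F(2)] F(4) comp_ident[OF v] by simp
    ultimately show "\<exists>h\<in>hom C b (Dom C q). h \<cdot> f = u \<and> q \<cdot> h = v" using comp_hom[OF F(2) u] by blast
  qed
  then show ?thesis unfolding llp_def using F(1) by (simp add: hom_def)
qed

lemma llp_ident: "Q \<subseteq> Mor C \<Longrightarrow> a \<in> Obj C \<Longrightarrow> Ident C a \<in> llp C Q"
  by (rule llp_inverse_arrows[of _ a a _ "Ident C a"]) (auto simp: inverse_arrows_def hom_def)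

lemma rlp_Mor: "rlp C I \<subseteq> Mor C"
  unfolding rlp_def by blast

end

section \<open>Approximable maps and their closure properties\<close>

section \<open>Approximation by maps between finitely presentable objects\<close>

context lfp_category
begin

text \<open>In the arrow category: the map \<open>(u, v)\<close> from \<open>a\<close> to
  \<open>g\<close> is the composite of \<open>(s, t)\<close> from \<open>a\<close> to
  \<open>w\<close> and \<open>(u', v')\<close> from \<open>w\<close> to \<open>g\<close>, for some
  \<open>w\<close> in \<open>T\<close>.\<close>

definition approximates ::
  "'m set \<Rightarrow> 'o \<Rightarrow> 'o \<Rightarrow> 'm \<Rightarrow> 'o \<Rightarrow> 'o \<Rightarrow> 'm \<Rightarrow> 'm \<Rightarrow> 'm \<Rightarrow> bool" where
  "approximates T x y g c d a u v \<longleftrightarrow>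
     (\<exists>c' d' w s t u' v'. w \<in> T \<and> w \<in> hom C c' d' \<and> s \<in> hom C c c' \<and> t \<in> hom C d d' \<and>
        u' \<in> hom C c' x \<and> v' \<in> hom C d' y \<and>
        w \<cdot> s = t \<cdot> a \<and> g \<cdot> u' = v' \<cdot> w \<and> u' \<cdot> s = u \<and> v' \<cdot> t = v)"

text \<open>\<open>a\<close> ranges over all maps between finitely presentable objects, not only
  over members of \<open>T\<close>. This makes the condition testable at stages of filtered
  diagrams, and it later permits squares built from coproducts and coequalizers, for which
  membership in \<open>T\<close> is not known.\<close>

definition approximable :: "'m set \<Rightarrow> 'o \<Rightarrow> 'o \<Rightarrow> 'm \<Rightarrow> bool" where
  "approximable T x y g \<longleftrightarrow> g \<in> hom C x y \<and>
     (\<forall>c d a u v. fp c \<and> fp d \<and> a \<in> hom C c d \<and> u \<in> hom C c x \<and> v \<in> hom C d y \<and> g \<cdot> u = v \<cdot> a \<longrightarrow>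
        approximates T x y g c d a u v)"

lemma approximatesI:
  assumes "w \<in> T" and "w \<in> hom C c' d'" and "s \<in> hom C c c'" and "t \<in> hom C d d'"
    and "u' \<in> hom C c' x" and "v' \<in> hom C d' y"
    and "w \<cdot> s = t \<cdot> a" and "g \<cdot> u' = v' \<cdot> w" and "u' \<cdot> s = u" and "v' \<cdot> t = v"
  shows "approximates T x y g c d a u v"
  unfolding approximates_def using assms by blast

lemma approximableI:
  assumes "g \<in> hom C x y"
    and "\<And>c d a u v. fp c \<Longrightarrow> fp d \<Longrightarrow> a \<in> hom C c d \<Longrightarrow> u \<in> hom C c x \<Longrightarrow> v \<in> hom C d y \<Longrightarrow>
      g \<cdot> u = v \<cdot> a \<Longrightarrow> approximates T x y g c d a u v"
  shows "approximable T x y g"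
  unfolding approximable_def using assms by blast

lemma approximable_hom: "approximable T x y g \<Longrightarrow> g \<in> hom C x y"
  unfolding approximable_def by blast

lemma approximableE:
  assumes "approximable T x y g" and "fp c" and "fp d" and "a \<in> hom C c d" and "u \<in> hom C c x"
    and "v \<in> hom C d y" and "g \<cdot> u = v \<cdot> a"
  obtains c' d' w s t u' v' where "w \<in> T" and "w \<in> hom C c' d'" and "s \<in> hom C c c'" and "t \<in> hom C d d'"
    and "u' \<in> hom C c' x" and "v' \<in> hom C d' y"
    and "w \<cdot> s = t \<cdot> a" and "g \<cdot> u' = v' \<cdot> w" and "u' \<cdot> s = u" and "v' \<cdot> t = v"
proof -
  have "approximates T x y g c d a u v" using assms unfolding approximable_def by blast
  then show ?thesis unfolding approximates_def using that by metis
qed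

text \<open>The domain \<open>x\<close> is fixed and only the codomain varies, so just
  \<open>v\<close> and the commutativity of the square have to descend to a stage; there the
  approximation of \<open>p k'\<close> applies.\<close>

lemma approximable_filtered_colimit:
  assumes K: "category K" "small U (Obj K)" "small U (Mor K)" "filtered K"
    and E: "is_functor K C E" and e: "is_colimit K C E z e"
    and p: "\<And>k. k \<in> Obj K \<Longrightarrow> approximable T x (fobj E k) (p k)"
    and nat: "\<And>k k' t. t \<in> hom K k k' \<Longrightarrow> fmor E t \<cdot> p k = p k'"
    and g: "g \<in> hom C x z" "\<And>k. k \<in> Obj K \<Longrightarrow> e k \<cdot> p k = g"
  shows "approximable T x z g"
proof (rule approximableI[OF g(1)])
  interpret K: category K by fact
  note L = coconeD[OF colimit_cocone[OF e]] and F = functorD[OF E]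
  note comm = finitely_presentable_commutes[OF _ K E e]
  note ph = approximable_hom[OF p]
  fix c d a u v
  assume c: "fp c" and d: "fp d" and a: "a \<in> hom C c d" and u: "u \<in> hom C c x" and v: "v \<in> hom C d z"
    and eq: "g \<cdot> u = v \<cdot> a"
  obtain k v0 where k: "k \<in> Obj K" and v0: "v0 \<in> hom C d (fobj E k)" "e k \<cdot> v0 = v"
    using commutes_hom_factor[OF comm[OF d] v] .
  have "e k \<cdot> (p k \<cdot> u) = e k \<cdot> (v0 \<cdot> a)"
    using triangle_ext[OF g(2)[OF k] ph[OF k] L(2)[OF k] u] triangle_ext[OF v0(2,1) L(2)[OF k] a] eq by simp
  then obtain k' t where t: "t \<in> hom K k k'" "fmor E t \<cdot> (p k \<cdot> u) = fmor E t \<cdot> (v0 \<cdot> a)"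
    using commutes_hom_eq[OF comm[OF c] k comp_hom[OF u ph[OF k]] comp_hom[OF a v0(1)]] by blast
  have k': "k' \<in> Obj K" using K.homD[OF t(1)] by blast
  have "p k' \<cdot> u = (fmor E t \<cdot> v0) \<cdot> a"
    using triangle_ext[OF nat[OF t(1)] ph[OF k] F(2)[OF t(1)] u] comp_assoc[OF a v0(1) F(2)[OF t(1)]] t(2) by simp
  from approximableE[OF p[OF k'] c d a u comp_hom[OF v0(1) F(2)[OF t(1)]] this]
  obtain c' d' w s q u' v' where w: "w \<in> T" "w \<in> hom C c' d'" "s \<in> hom C c c'" "q \<in> hom C d d'"
    "u' \<in> hom C c' x" "v' \<in> hom C d' (fobj E k')" "w \<cdot> s = q \<cdot> a" "p k' \<cdot> u' = v' \<cdot> w" "u' \<cdot> s = u"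
    "v' \<cdot> q = fmor E t \<cdot> v0" .
  show "approximates T x z g c d a u v"
  proof (rule approximatesI[OF w(1-5) comp_hom[OF w(6) L(2)[OF k']] w(7) _ w(9)])
    show "g \<cdot> u' = (e k' \<cdot> v') \<cdot> w"
      using comp_assoc[OF w(2,6) L(2)[OF k']] w(8) triangle_ext[OF g(2)[OF k'] ph[OF k'] L(2)[OF k'] w(5)] by simp
    show "(e k' \<cdot> v') \<cdot> q = v"
      using comp_assoc[OF w(4,6) L(2)[OF k']] w(10) v0(2)
        triangle_ext[OF L(3)[OF t(1)] F(2)[OF t(1)] L(2)[OF k'] v0(1)] by simp
  qed
qed

text \<open>\<open>i\<close> is a retract of \<open>e\<close> under \<open>x\<close>. A square into
  \<open>i\<close> is carried to \<open>e\<close> by \<open>h\<close>, approximated there, and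
  carried back by \<open>q\<close>. This is the final step of the retract argument for left lifting
  classes.\<close>

lemma approximable_retract:
  assumes e: "approximable T x y e" and q: "q \<in> hom C y z" and h: "h \<in> hom C z y"
    and i: "i \<in> hom C x z" "h \<cdot> i = e" "q \<cdot> e = i" "q \<cdot> h = Ident C z"
  shows "approximable T x z i"
proof (rule approximableI[OF i(1)])
  fix c d a u v
  assume c: "fp c" and d: "fp d" and a: "a \<in> hom C c d" and u: "u \<in> hom C c x" and v: "v \<in> hom C d z"
    and eq: "i \<cdot> u = v \<cdot> a"
  note eh = approximable_hom[OF e]
  have "e \<cdot> u = (h \<cdot> v) \<cdot> a"
    using triangle_ext[OF i(2) i(1) h u] comp_assoc[OF a v h] eq by simp
  from approximableE[OF e c d a u comp_hom[OF v h] this]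
  obtain c' d' w s t u' v' where w: "w \<in> T" "w \<in> hom C c' d'" "s \<in> hom C c c'" "t \<in> hom C d d'"
    "u' \<in> hom C c' x" "v' \<in> hom C d' y" "w \<cdot> s = t \<cdot> a" "e \<cdot> u' = v' \<cdot> w" "u' \<cdot> s = u" "v' \<cdot> t = h \<cdot> v" .
  show "approximates T x z i c d a u v"
  proof (rule approximatesI[OF w(1-5) comp_hom[OF w(6) q] w(7) _ w(9)])
    show "i \<cdot> u' = (q \<cdot> v') \<cdot> w"
      using comp_assoc[OF w(2,6) q] w(8) triangle_ext[OF i(3) eh q w(5)] by simp
    show "(q \<cdot> v') \<cdot> t = v"
      using comp_assoc[OF w(4,6) q] w(10) triangle_ext[OF i(4) h q v] ident_comp[OF v] by simp
  qed
qed

definition fp_llp :: "'m set \<Rightarrow> 'm set" where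
  "fp_llp Q = {w \<in> llp C Q. fp (Dom C w) \<and> fp (Cod C w)}"

lemma fp_llpI: "w \<in> llp C Q \<Longrightarrow> w \<in> hom C c d \<Longrightarrow> fp c \<Longrightarrow> fp d \<Longrightarrow> w \<in> fp_llp Q"
  unfolding fp_llp_def hom_def by blast

lemma fp_llpD: "w \<in> fp_llp Q \<Longrightarrow> w \<in> hom C c d \<Longrightarrow> w \<in> llp C Q \<and> fp c \<and> fp d"
  unfolding fp_llp_def hom_def by blast

lemma approximable_ident:
  assumes Q: "Q \<subseteq> Mor C" and x: "x \<in> Obj C"
  shows "approximable (fp_llp Q) x x (Ident C x)"
proof (rule approximableI[OF ident_hom[OF x]])
  fix c d a u v
  assume c: "fp c" and d: "fp d" and a: "a \<in> hom C c d" and u: "u \<in> hom C c x" and v: "v \<in> hom C d x"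
    and eq: "Ident C x \<cdot> u = v \<cdot> a"
  note dI = ident_hom[OF fp_Obj[OF d]]
  show "approximates (fp_llp Q) x x (Ident C x) c d a u v"
    \<comment> \<open>The approximating map is the identity of \<open>d\<close>: since
      \<open>u\<close> equals \<open>v \<cdot> a\<close>, the square factors through it by
      \<open>a\<close> on the domain side.\<close>
    by (rule approximatesI[OF fp_llpI[OF llp_ident[OF Q fp_Obj[OF d]] dI d d] dI a dI v v])
      (use eq ident_comp[OF u] ident_comp[OF v] comp_ident[OF v] ident_comp[OF a] in simp_all)
qed

text \<open>\<open>g\<close> is approximated before \<open>f\<close>. The map \<open>s1\<close> into
  the new domain \<open>c1\<close> then serves as source of a square into \<open>f\<close>, which
  gives \<open>w2\<close> with codomain \<open>d2\<close> and a map \<open>t2\<close> from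
  \<open>c1\<close> to \<open>d2\<close>. Pushing \<open>w1\<close> out along \<open>t2\<close>
  makes it composable with \<open>w2\<close>, and the left lifting class is closed under both
  operations.\<close>

lemma approximable_comp:
  assumes Q: "Q \<subseteq> Mor C" and f: "approximable (fp_llp Q) x y f" and g: "approximable (fp_llp Q) y z g"
  shows "approximable (fp_llp Q) x z (g \<cdot> f)"
proof (rule approximableI)
  note fh = approximable_hom[OF f] and gh = approximable_hom[OF g]
  show "g \<cdot> f \<in> hom C x z" using comp_hom[OF fh gh] .
  fix c d a u v
  assume c: "fp c" and d: "fp d" and a: "a \<in> hom C c d" and u: "u \<in> hom C c x" and v: "v \<in> hom C d z"
    and eq: "(g \<cdot> f) \<cdot> u = v \<cdot> a"
  have "g \<cdot> (f \<cdot> u) = v \<cdot> a" using eq comp_assoc[OF u fh gh] by simp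
  from approximableE[OF g c d a comp_hom[OF u fh] v this]
  obtain c1 d1 w1 s1 t1 u1 v1 where 1: "w1 \<in> fp_llp Q" "w1 \<in> hom C c1 d1" "s1 \<in> hom C c c1" "t1 \<in> hom C d d1"
    "u1 \<in> hom C c1 y" "v1 \<in> hom C d1 z" and e1: "w1 \<cdot> s1 = t1 \<cdot> a" "g \<cdot> u1 = v1 \<cdot> w1" "u1 \<cdot> s1 = f \<cdot> u" "v1 \<cdot> t1 = v" .
  have c1: "fp c1" "fp d1" "w1 \<in> llp C Q" using fp_llpD[OF 1(1,2)] by auto
  from approximableE[OF f c c1(1) 1(3) u 1(5) e1(3)[symmetric]]
  obtain c2 d2 w2 s2 t2 u2 v2 where 2: "w2 \<in> fp_llp Q" "w2 \<in> hom C c2 d2" "s2 \<in> hom C c c2" "t2 \<in> hom C c1 d2"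
    "u2 \<in> hom C c2 x" "v2 \<in> hom C d2 y" and e2: "w2 \<cdot> s2 = t2 \<cdot> s1" "f \<cdot> u2 = v2 \<cdot> w2" "u2 \<cdot> s2 = u" "v2 \<cdot> t2 = u1" .
  have c2: "fp c2" "fp d2" "w2 \<in> llp C Q" using fp_llpD[OF 2(1,2)] by auto
  obtain d3 i j where po: "pushout_square C c1 d1 d2 d3 w1 t2 i j" using pushout_exists[OF 1(2) 2(4)] .
  note D = pushoutD[OF po]
  have "v1 \<cdot> w1 = (g \<cdot> v2) \<cdot> t2" using e1(2) e2(4) comp_assoc[OF 2(4,6) gh] by simp
  then obtain v3 where v3: "v3 \<in> hom C d3 z" "v3 \<cdot> i = v1" "v3 \<cdot> j = g \<cdot> v2"
    using pushout_desc[OF po 1(6) comp_hom[OF 2(6) gh]] by blast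
  note w = comp_hom[OF 2(2) D(4)]
  show "approximates (fp_llp Q) x z (g \<cdot> f) c d a u v"
  proof (rule approximatesI[OF _ w 2(3) comp_hom[OF 1(4) D(3)] 2(5) v3(1) _ _ e2(3)])
    show "j \<cdot> w2 \<in> fp_llp Q"
      using fp_llpI[OF llp_comp[OF Q c2(3) 2(2) llp_pushout[OF Q c1(3) po] D(4)] w c2(1)]
        fp_pushout[OF po c1(1,2) c2(2)] by blast
    show "(j \<cdot> w2) \<cdot> s2 = (i \<cdot> t1) \<cdot> a"
      using comp_assoc[OF 2(3,2) D(4)] comp_assoc[OF a 1(4) D(3)] e2(1) e1(1) square_ext[OF D(5) 1(2) D(3) 2(4) D(4) 1(3)] by simp
    show "(g \<cdot> f) \<cdot> u2 = v3 \<cdot> (j \<cdot> w2)"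
      using comp_assoc[OF 2(5) fh gh] e2(2) triangle_ext[OF v3(3) D(4) v3(1) 2(2)] comp_assoc[OF 2(2,6) gh] by simp
    show "v3 \<cdot> (i \<cdot> t1) = v" using triangle_ext[OF v3(2) D(3) v3(1) 1(4)] e1(4) by simp
  qed
qed

section \<open>Cobase changes of small maps along arbitrary maps\<close>

subsection \<open>Pushouts\<close>

text \<open>An object is a morphism \<open>u\<close> out of \<open>k0\<close>. A morphism is coded
  by its source \<open>u\<close> and the map \<open>t\<close> out of the codomain of
  \<open>u\<close>; its target \<open>t \<cdot> u\<close> is computed rather than stored.\<close>

definition coslice :: "('j, 'k) cat \<Rightarrow> 'j \<Rightarrow> ('k, 'k \<times> 'k) cat" where
  "coslice K k0 = \<lparr>Obj = {u \<in> Mor K. Dom K u = k0},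
     Mor = {(u, t). u \<in> Mor K \<and> t \<in> Mor K \<and> Dom K u = k0 \<and> Dom K t = Cod K u},
     Dom = fst, Cod = (\<lambda>(u, t). t \<cdot>\<^bsub>K\<^esub> u), Ident = (\<lambda>u. (u, Ident K (Cod K u))),
     Comp = (\<lambda>g f. (fst f, snd g \<cdot>\<^bsub>K\<^esub> snd f))\<rparr>"

lemma hom_coslice:
  "m \<in> hom (coslice K k0) u v \<longleftrightarrow> (\<exists>t. m = (u, t) \<and> u \<in> hom K k0 (Cod K u) \<and>
     t \<in> hom K (Cod K u) (Cod K t) \<and> v = t \<cdot>\<^bsub>K\<^esub> u)"
  by (auto simp: coslice_def hom_def)

lemma category_coslice:
  assumes "category K"
  shows "category (coslice K k0)"
proof -
  interpret K: category K by fact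
  show ?thesis
    by unfold_locales (auto simp: coslice_def hom_def K.cod_obj)
qed

lemma filtered_coslice:
  assumes "category K" and "filtered K" and k0: "k0 \<in> Obj K"
  shows "filtered (coslice K k0)"
  unfolding filtered_def
proof (intro conjI ballI allI)
  interpret K: category K by fact
  have "Ident K k0 \<in> Obj (coslice K k0)" using k0 by (simp add: coslice_def)
  then show "Obj (coslice K k0) \<noteq> {}" by blast
  show "\<exists>c\<in>Obj (coslice K k0). hom (coslice K k0) u c \<noteq> {} \<and> hom (coslice K k0) v c \<noteq> {}"
    if "u \<in> Obj (coslice K k0)" "v \<in> Obj (coslice K k0)" for u v
  proof -
    have uv: "u \<in> hom K k0 (Cod K u)" "v \<in> hom K k0 (Cod K v)" using that by (auto simp: coslice_def hom_def)
    obtain d p q where pq: "p \<in> hom K (Cod K u) d" "q \<in> hom K (Cod K v) d" "p \<cdot>\<^bsub>K\<^esub> u = q \<cdot>\<^bsub>K\<^esub> v"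
      using K.filtered_span[OF assms(2) uv] .
    have "(u, p) \<in> hom (coslice K k0) u (p \<cdot>\<^bsub>K\<^esub> u)" "(v, q) \<in> hom (coslice K k0) v (p \<cdot>\<^bsub>K\<^esub> u)"
      unfolding hom_coslice using uv pq by (auto simp: hom_def)
    moreover have "p \<cdot>\<^bsub>K\<^esub> u \<in> Obj (coslice K k0)" using uv pq by (auto simp: coslice_def hom_def)
    ultimately show ?thesis by blast
  qed
  show "\<exists>c. \<exists>h\<in>hom (coslice K k0) v c. h \<cdot>\<^bsub>coslice K k0\<^esub> f = h \<cdot>\<^bsub>coslice K k0\<^esub> g"
    if f: "f \<in> hom (coslice K k0) u v" and g: "g \<in> hom (coslice K k0) u v" for u v f g
  proof -
    obtain s t where st: "f = (u, s)" "g = (u, t)" "u \<in> hom K k0 (Cod K u)"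
      "s \<in> hom K (Cod K u) (Cod K s)" "t \<in> hom K (Cod K u) (Cod K t)" "v = s \<cdot>\<^bsub>K\<^esub> u" "v = t \<cdot>\<^bsub>K\<^esub> u"
      using f g unfolding hom_coslice by blast
    have cv: "Cod K v = Cod K s" using st by (simp add: hom_def)
    have "Cod K v = Cod K t" unfolding st(7) using st(3,5) by (simp add: hom_def)
    then have t': "t \<in> hom K (Cod K u) (Cod K s)" using st(5) cv by simp
    obtain c w where w: "w \<in> hom K (Cod K s) c" "w \<cdot>\<^bsub>K\<^esub> s = w \<cdot>\<^bsub>K\<^esub> t"
      using K.filtered_coeq[OF assms(2) st(4) t'] .
    have "(v, w) \<in> hom (coslice K k0) v (w \<cdot>\<^bsub>K\<^esub> v)"
      unfolding hom_coslice using w cv K.comp_hom[OF st(3,4)] st(6) by (auto simp: hom_def)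
    then show ?thesis using w(2) st(1,2) by (intro exI bexI) (auto simp: coslice_def)
  qed
qed

lemma small_coslice:
  assumes "small U (Mor K)"
  shows "small U (Obj (coslice K k0))" and "small U (Mor (coslice K k0))"
  using small_subset[OF _ assms, of "Obj (coslice K k0)"]
    small_subset[OF _ small_Times[OF universe assms assms], of "Mor (coslice K k0)"]
  by (auto simp: coslice_def)

text \<open>The projection from the coslice of a filtered category is cofinal. Instead of a general
  theory of cofinality, finitely presentable objects detect that the restricted diagram has the same
  colimit.\<close>

lemma colimit_coslice:
  assumes K: "category K" "small U (Obj K)" "small U (Mor K)" "filtered K"
    and D: "is_functor K C D" and x: "is_colimit K C D x l" and k0: "k0 \<in> Obj K"
  defines "D' \<equiv> \<lparr>fobj = (\<lambda>u. fobj D (Cod K u)), fmor = (\<lambda>m. fmor D (snd m))\<rparr>"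
  shows "is_functor (coslice K k0) C D'" and "is_colimit (coslice K k0) C D' x (\<lambda>u. l (Cod K u))"
proof -
  interpret K: category K by fact
  note L = coconeD[OF colimit_cocone[OF x]] and F = functorD[OF D]
  have m: "\<exists>t. m = (u, t) \<and> t \<in> hom K (Cod K u) (Cod K v) \<and> v = t \<cdot>\<^bsub>K\<^esub> u \<and> u \<in> hom K k0 (Cod K u)"
    if "m \<in> hom (coslice K k0) u v" for m u v
    using that K.comp_hom unfolding hom_coslice by (fastforce simp: hom_def)
  have o: "u \<in> hom K k0 (Cod K u) \<and> Cod K u \<in> Obj K" if "u \<in> Obj (coslice K k0)" for u
    using that K.cod_obj by (auto simp: coslice_def hom_def)
  show D': "is_functor (coslice K k0) C D'"
    unfolding is_functor_def
  proof (intro conjI ballI allI)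
    show "fobj D' u \<in> Obj C" if "u \<in> Obj (coslice K k0)" for u
      using F(1) o[OF that] by (simp add: D'_def)
    show "fmor D' f \<in> hom C (fobj D' u) (fobj D' v)" if "f \<in> hom (coslice K k0) u v" for u v f
      using F(2) m[OF that] by (auto simp: D'_def)
    show "fmor D' (Ident (coslice K k0) u) = Ident C (fobj D' u)" if "u \<in> Obj (coslice K k0)" for u
      using F(3) o[OF that] by (simp add: D'_def coslice_def)
    show "fmor D' (g \<cdot>\<^bsub>coslice K k0\<^esub> f) = fmor D' g \<cdot> fmor D' f"
      if "f \<in> hom (coslice K k0) u v" "g \<in> hom (coslice K k0) v w" for u v w f g
      using F(4) m[OF that(1)] m[OF that(2)] by (auto simp: D'_def coslice_def)
  qed
  have cc: "is_cocone (coslice K k0) C D' x (\<lambda>u. l (Cod K u))"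
    unfolding is_cocone_def
  proof (intro conjI ballI allI)
    show "l (Cod K v) \<cdot> fmor D' f = l (Cod K u)" if "f \<in> hom (coslice K k0) u v" for u v f
      using L(3) m[OF that] by (auto simp: D'_def)
  qed (use L(1,2) o in \<open>auto simp: D'_def\<close>)
  show "is_colimit (coslice K k0) C D' x (\<lambda>u. l (Cod K u))"
  proof (rule colimit_if_commutes_hom[OF category_coslice[OF K(1)] filtered_coslice[OF K(1,4) k0] D' cc])
    fix y assume y: "fp y"
    note comm = finitely_presentable_commutes[OF y K D x]
    show "commutes_hom (coslice K k0) C D' x (\<lambda>u. l (Cod K u)) y"
      unfolding commutes_hom_def
    proof (intro conjI ballI impI)
      fix g assume "g \<in> hom C y x"
      then obtain k g' where k: "k \<in> Obj K" "g' \<in> hom C y (fobj D k)" "l k \<cdot> g' = g"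
        using commutes_hom_factor[OF comm] by metis
      obtain k' u v where uv: "u \<in> hom K k0 k'" "v \<in> hom K k k'" using K.filtered_bound[OF K(4) k0 k(1)] .
      have k': "k' \<in> Obj K" "Cod K u = k'" using K.homD[OF uv(1)] by auto
      have "l k' \<cdot> (fmor D v \<cdot> g') = g"
        using triangle_ext[OF L(3)[OF uv(2)] F(2)[OF uv(2)] L(2)[OF k'(1)] k(2)] k(3) by simp
      moreover have "u \<in> Obj (coslice K k0)" using uv(1) by (simp add: coslice_def hom_def)
      ultimately show "\<exists>u\<in>Obj (coslice K k0). \<exists>g'\<in>hom C y (fobj D' u). l (Cod K u) \<cdot> g' = g"
        using comp_hom[OF k(2) F(2)[OF uv(2)]] k'(2) unfolding D'_def by force
    next
      fix u g g' assume u: "u \<in> Obj (coslice K k0)" and g: "g \<in> hom C y (fobj D' u)" "g' \<in> hom C y (fobj D' u)"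
        and eq: "l (Cod K u) \<cdot> g = l (Cod K u) \<cdot> g'"
      have uk: "u \<in> hom K k0 (Cod K u)" "Cod K u \<in> Obj K" using o[OF u] by auto
      have g': "g \<in> hom C y (fobj D (Cod K u))" "g' \<in> hom C y (fobj D (Cod K u))"
        using g by (simp_all add: D'_def)
      obtain k t where t: "t \<in> hom K (Cod K u) k" "fmor D t \<cdot> g = fmor D t \<cdot> g'"
        using commutes_hom_eq[OF comm uk(2) g' eq] .
      have "(u, t) \<in> hom (coslice K k0) u (t \<cdot>\<^bsub>K\<^esub> u)" unfolding hom_coslice using uk t by (auto simp: hom_def)
      then show "\<exists>v. \<exists>f\<in>hom (coslice K k0) u v. fmor D' f \<cdot> g = fmor D' f \<cdot> g'"
        using t(2) by (intro exI bexI) (auto simp: D'_def)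
    qed
  qed
qed

text \<open>Although \<open>x\<close> is large, its presentation exhibits \<open>j\<close> as the
  filtered colimit, in the arrow category, of the maps \<open>\<xi> u\<close> obtained by pushing
  \<open>w\<close> out along maps into the finitely presentable stages. Each \<open>\<xi> u\<close>
  lies in \<open>fp_llp Q\<close>, and a small square into \<open>j\<close> factors through one of
  them.\<close>

lemma approximable_pushout:
  assumes Q: "Q \<subseteq> Mor C" and w: "w \<in> fp_llp Q" and po: "pushout_square C a b x x' w \<alpha> i j"
  shows "approximable (fp_llp Q) x x' j"
proof -
  note D0 = pushoutD[OF po]
  have ab: "fp a" "fp b" "w \<in> llp C Q" using fp_llpD[OF w D0(1)] by auto
  have x: "x \<in> Obj C" using homD[OF D0(4)] by blast
  obtain K0 :: "('u, 'u) cat" and D0 l0 where K0: "category K0" "small U (Obj K0)" "small U (Mor K0)" "filtered K0"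
    and D0': "is_functor K0 C D0" "\<And>k. k \<in> Obj K0 \<Longrightarrow> fp (fobj D0 k)" and l0: "is_colimit K0 C D0 x l0"
    using presentation[OF x] by metis
  interpret K0: category K0 by fact
  obtain k0 \<alpha>0 where k0: "k0 \<in> Obj K0" and a0: "\<alpha>0 \<in> hom C a (fobj D0 k0)" "l0 k0 \<cdot> \<alpha>0 = \<alpha>"
    using commutes_hom_factor[OF finitely_presentable_commutes[OF ab(1) K0 D0'(1) l0] D0(2)] .
  \<comment> \<open>\<open>\<alpha>\<close> factors through a stage only from \<open>k0\<close> on;
    restricting to the coslice below \<open>k0\<close> supplies compatible factorizations
    \<open>\<alpha>' u\<close> at every stage.\<close>
  define K where "K = coslice K0 k0"
  define D where "D = \<lparr>fobj = (\<lambda>u. fobj D0 (Cod K0 u)), fmor = (\<lambda>m :: 'u \<times> 'u. fmor D0 (snd m))\<rparr>"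
  define l where "l u = l0 (Cod K0 u)" for u
  have K: "category K" "small U (Obj K)" "small U (Mor K)" "filtered K"
    unfolding K_def using category_coslice[OF K0(1)] small_coslice[OF K0(3)] filtered_coslice[OF K0(1,4) k0] by auto
  have D: "is_functor K C D" and l: "is_colimit K C D x l"
    using colimit_coslice[OF K0 D0'(1) l0 k0] unfolding K_def D_def l_def by auto
  interpret K: category K by fact
  note L = coconeD[OF colimit_cocone[OF l]] and F = functorD[OF D]
  have o: "u \<in> hom K0 k0 (Cod K0 u) \<and> fp (fobj D u)" if "u \<in> Obj K" for u
    using that D0'(2) K0.cod_obj by (auto simp: K_def D_def coslice_def hom_def)
  define \<alpha>' where "\<alpha>' u = fmor D0 u \<cdot> \<alpha>0" for u
  have a': "\<alpha>' u \<in> hom C a (fobj D u)" "l u \<cdot> \<alpha>' u = \<alpha>" if u: "u \<in> Obj K" for u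
  proof -
    have uh: "u \<in> hom K0 k0 (Cod K0 u)" using o[OF u] by blast
    show "\<alpha>' u \<in> hom C a (fobj D u)"
      unfolding \<alpha>'_def D_def using comp_hom[OF a0(1) functorD(2)[OF D0'(1) uh]] by simp
    show "l u \<cdot> \<alpha>' u = \<alpha>"
      unfolding \<alpha>'_def l_def
      using triangle_ext[OF coconeD(3)[OF colimit_cocone[OF l0] uh] functorD(2)[OF D0'(1) uh]
          coconeD(2)[OF colimit_cocone[OF l0]] a0(1)] a0(2) K0.homD[OF uh] by simp
  qed
  have a'_nat: "fmor D m \<cdot> \<alpha>' u = \<alpha>' v" if m: "m \<in> hom K u v" for m u v
  proof -
    obtain t where t: "m = (u, t)" "u \<in> hom K0 k0 (Cod K0 u)" "t \<in> hom K0 (Cod K0 u) (Cod K0 t)" "v = t \<cdot>\<^bsub>K0\<^esub> u"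
      using m unfolding K_def hom_coslice by blast
    then show ?thesis
      unfolding \<alpha>'_def D_def
      using functorD(4)[OF D0'(1) t(2,3)] comp_assoc[OF a0(1) functorD(2)[OF D0'(1) t(2)] functorD(2)[OF D0'(1) t(3)]]
      by simp
  qed
  have "\<exists>P p q. pushout_square C a b (fobj D u) P w (\<alpha>' u) p q" if "u \<in> Obj K" for u
    using pushout_exists[OF D0(1) a'(1)[OF that]] by metis
  then obtain P \<beta> \<xi> where P: "\<And>u. u \<in> Obj K \<Longrightarrow> pushout_square C a b (fobj D u) (P u) w (\<alpha>' u) (\<beta> u) (\<xi> u)"
    by metis
  note PD = pushoutD[OF P]
  \<comment> \<open>The objects \<open>P u\<close> are chosen independently of each other, but the
    transition maps are then unique, and the functor laws follow from that uniqueness.\<close>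
  define \<epsilon> where "\<epsilon> m = (THE h. h \<in> hom C (P (Dom K m)) (P (Cod K m)) \<and> h \<cdot> \<beta> (Dom K m) = \<beta> (Cod K m) \<and>
    h \<cdot> \<xi> (Dom K m) = \<xi> (Cod K m) \<cdot> fmor D m)" for m
  have \<epsilon>: "\<epsilon> m \<in> hom C (P u) (P v) \<and> \<epsilon> m \<cdot> \<beta> u = \<beta> v \<and> \<epsilon> m \<cdot> \<xi> u = \<xi> v \<cdot> fmor D m" if m: "m \<in> hom K u v" for m u v
  proof -
    have uv: "u \<in> Obj K" "v \<in> Obj K" "Dom K m = u" "Cod K m = v" using K.homD[OF m] by auto
    have "\<beta> v \<cdot> w = (\<xi> v \<cdot> fmor D m) \<cdot> \<alpha>' u"
      using PD(5)[OF uv(2)] comp_assoc[OF a'(1)[OF uv(1)] F(2)[OF m] PD(4)[OF uv(2)]] a'_nat[OF m] by simp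
    then have "\<exists>!h. h \<in> hom C (P u) (P v) \<and> h \<cdot> \<beta> u = \<beta> v \<and> h \<cdot> \<xi> u = \<xi> v \<cdot> fmor D m"
      using P[OF uv(1)] PD(3)[OF uv(2)] comp_hom[OF F(2)[OF m] PD(4)[OF uv(2)]]
      unfolding pushout_square_def by blast
    from theI'[OF this] show ?thesis unfolding \<epsilon>_def uv .
  qed
  define E where "E = \<lparr>fobj = P, fmor = \<epsilon>\<rparr>"
  have E: "is_functor K C E"
    unfolding is_functor_def E_def fctr.simps
  proof (intro conjI ballI allI)
    show "P u \<in> Obj C" if "u \<in> Obj K" for u using homD[OF PD(3)[OF that]] by blast
    show "\<epsilon> m \<in> hom C (P u) (P v)" if "m \<in> hom K u v" for m u v using \<epsilon>[OF that] by blast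
    show "\<epsilon> (Ident K u) = Ident C (P u)" if u: "u \<in> Obj K" for u
    proof (rule pushout_eqI[OF P[OF u]])
      note e = \<epsilon>[OF K.ident_hom[OF u]]
      show "\<epsilon> (Ident K u) \<in> hom C (P u) (P u)" using e by blast
      show "Ident C (P u) \<in> hom C (P u) (P u)" using homD[OF PD(3)[OF u]] ident_hom by blast
      show "\<epsilon> (Ident K u) \<cdot> \<beta> u = Ident C (P u) \<cdot> \<beta> u" using e ident_comp[OF PD(3)[OF u]] by simp
      show "\<epsilon> (Ident K u) \<cdot> \<xi> u = Ident C (P u) \<cdot> \<xi> u"
        using e ident_comp[OF PD(4)[OF u]] F(3)[OF u] comp_ident[OF PD(4)[OF u]] by simp
    qed
    show "\<epsilon> (n \<cdot>\<^bsub>K\<^esub> m) = \<epsilon> n \<cdot> \<epsilon> m" if m: "m \<in> hom K u v" and n: "n \<in> hom K v z" for u v z m n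
    proof -
      have u: "u \<in> Obj K" "v \<in> Obj K" "z \<in> Obj K" using K.homD[OF m] K.homD[OF n] by auto
      note e = \<epsilon>[OF K.comp_hom[OF m n]] and em = \<epsilon>[OF m] and en = \<epsilon>[OF n]
      have emh: "\<epsilon> m \<in> hom C (P u) (P v)" and enh: "\<epsilon> n \<in> hom C (P v) (P z)" using em en by auto
      show ?thesis
      proof (rule pushout_eqI[OF P[OF u(1)] _ comp_hom[OF emh enh]])
        show "\<epsilon> (n \<cdot>\<^bsub>K\<^esub> m) \<in> hom C (P u) (P z)" using e by blast
        show "\<epsilon> (n \<cdot>\<^bsub>K\<^esub> m) \<cdot> \<beta> u = (\<epsilon> n \<cdot> \<epsilon> m) \<cdot> \<beta> u"
          using e em en comp_assoc[OF PD(3)[OF u(1)] emh enh] by simp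
        have "(\<epsilon> n \<cdot> \<epsilon> m) \<cdot> \<xi> u = \<epsilon> n \<cdot> (\<xi> v \<cdot> fmor D m)"
          using em comp_assoc[OF PD(4)[OF u(1)] emh enh] by simp
        also have "\<dots> = (\<xi> z \<cdot> fmor D n) \<cdot> fmor D m"
          using en comp_assoc[OF F(2)[OF m] PD(4)[OF u(2)] enh] by simp
        also have "\<dots> = \<xi> z \<cdot> fmor D (n \<cdot>\<^bsub>K\<^esub> m)"
          using F(4)[OF m n] comp_assoc[OF F(2)[OF m] F(2)[OF n] PD(4)[OF u(3)]] by simp
        finally show "\<epsilon> (n \<cdot>\<^bsub>K\<^esub> m) \<cdot> \<xi> u = (\<epsilon> n \<cdot> \<epsilon> m) \<cdot> \<xi> u" using e by simp
      qed
    qed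
  qed
  have "\<exists>h. h \<in> hom C (P u) x' \<and> h \<cdot> \<beta> u = i \<and> h \<cdot> \<xi> u = j \<cdot> l u" if u: "u \<in> Obj K" for u
  proof -
    have lu: "l u \<in> hom C (fobj D u) x" using L(2)[OF u] .
    have "i \<cdot> w = (j \<cdot> l u) \<cdot> \<alpha>' u"
      using D0(5) comp_assoc[OF a'(1)[OF u] lu D0(4)] a'(2)[OF u] by simp
    then show ?thesis using pushout_desc[OF P[OF u] D0(3) comp_hom[OF lu D0(4)]] by metis
  qed
  then obtain e where e: "\<And>u. u \<in> Obj K \<Longrightarrow> e u \<in> hom C (P u) x'" "\<And>u. u \<in> Obj K \<Longrightarrow> e u \<cdot> \<beta> u = i"
    "\<And>u. u \<in> Obj K \<Longrightarrow> e u \<cdot> \<xi> u = j \<cdot> l u" by metis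
  have ecc: "is_cocone K C E x' e"
    unfolding is_cocone_def E_def fctr.simps
  proof (intro conjI ballI allI)
    show "x' \<in> Obj C" using homD[OF D0(4)] by blast
    show "e u \<in> hom C (P u) x'" if "u \<in> Obj K" for u using e(1)[OF that] .
    show "e v \<cdot> \<epsilon> m = e u" if m: "m \<in> hom K u v" for u v m
    proof -
      have u: "u \<in> Obj K" "v \<in> Obj K" using K.homD[OF m] by auto
      have em: "\<epsilon> m \<in> hom C (P u) (P v)" using \<epsilon>[OF m] by blast
      show ?thesis
      proof (rule pushout_eqI[OF P[OF u(1)] comp_hom[OF em e(1)[OF u(2)]] e(1)[OF u(1)]])
        show "(e v \<cdot> \<epsilon> m) \<cdot> \<beta> u = e u \<cdot> \<beta> u"
          using comp_assoc[OF PD(3)[OF u(1)] em e(1)[OF u(2)]] \<epsilon>[OF m] e(2) u by simp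
        show "(e v \<cdot> \<epsilon> m) \<cdot> \<xi> u = e u \<cdot> \<xi> u"
          using comp_assoc[OF PD(4)[OF u(1)] em e(1)[OF u(2)]] \<epsilon>[OF m]
            triangle_ext[OF e(3)[OF u(2)] PD(4)[OF u(2)] e(1)[OF u(2)] F(2)[OF m]]
            comp_assoc[OF F(2)[OF m] L(2)[OF u(2)] D0(4)] L(3)[OF m] e(3)[OF u(1)] by simp
      qed
    qed
  qed
  \<comment> \<open>The identity of \<open>k0\<close> is a least stage: every \<open>u\<close>
    receives a map from it. Hence the restrictions to \<open>b\<close> of the legs of a cocone on
    \<open>E\<close> all coincide with the one at \<open>u0\<close>, which supplies the component on
    \<open>b\<close> of the mediating map.\<close>
  define u0 where "u0 = Ident K0 k0"
  have u0: "u0 \<in> Obj K" unfolding u0_def K_def coslice_def using k0 by simp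
  have from_u0: "\<exists>m. m \<in> hom K u0 u" if "u \<in> Obj K" for u
  proof -
    have "u \<in> hom K0 k0 (Cod K0 u)" using o[OF that] by blast
    then have "(u0, u) \<in> hom K u0 u"
      unfolding K_def hom_coslice u0_def using k0 by (auto simp: hom_def)
    then show ?thesis by blast
  qed
  have ecol: "is_colimit K C E x' e"
    unfolding is_colimit_def
  proof (intro conjI allI impI)
    fix z m assume m: "is_cocone K C E z m"
    note M = coconeD[OF m, unfolded E_def fctr.simps]
    define n where "n u = m u \<cdot> \<xi> u" for u
    define bb where "bb = m u0 \<cdot> \<beta> u0"
    have nh: "n u \<in> hom C (fobj D u) z" if "u \<in> Obj K" for u
      unfolding n_def using comp_hom[OF PD(4) M(2)] that by blast
    have bbh: "bb \<in> hom C b z" unfolding bb_def using comp_hom[OF PD(3) M(2)] u0 by blast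
    have bb: "m u \<cdot> \<beta> u = bb" if u: "u \<in> Obj K" for u
    proof -
      obtain t where t: "t \<in> hom K u0 u" using from_u0[OF u] by blast
      have "m u \<cdot> (\<epsilon> t \<cdot> \<beta> u0) = m u0 \<cdot> \<beta> u0"
        using triangle_ext[OF M(3)[OF t] _ M(2)[OF u] PD(3)[OF u0]] \<epsilon>[OF t] by blast
      then show ?thesis using \<epsilon>[OF t] bb_def by simp
    qed
    have "is_cocone K C D z n"
      unfolding is_cocone_def
    proof (intro conjI ballI allI)
      show "n v \<cdot> fmor D t = n u" if t: "t \<in> hom K u v" for u v t
      proof -
        have u: "u \<in> Obj K" "v \<in> Obj K" using K.homD[OF t] by auto
        have et: "\<epsilon> t \<in> hom C (P u) (P v)" using \<epsilon>[OF t] by blast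
        have "n v \<cdot> fmor D t = m v \<cdot> (\<epsilon> t \<cdot> \<xi> u)"
          unfolding n_def using comp_assoc[OF F(2)[OF t] PD(4)[OF u(2)] M(2)[OF u(2)]] \<epsilon>[OF t] by simp
        then show ?thesis
          unfolding n_def using triangle_ext[OF M(3)[OF t] et M(2)[OF u(2)] PD(4)[OF u(1)]] by simp
      qed
    qed (use M(1) nh in auto)
    then obtain h where h: "h \<in> hom C x z" "\<And>u. u \<in> Obj K \<Longrightarrow> h \<cdot> l u = n u"
      using colimit_desc[OF l] by metis
    have "bb \<cdot> w = h \<cdot> \<alpha>"
    proof -
      have "bb \<cdot> w = m u0 \<cdot> (\<xi> u0 \<cdot> \<alpha>' u0)"
        unfolding bb_def using comp_assoc[OF D0(1) PD(3)[OF u0] M(2)[OF u0]] PD(5)[OF u0] by simp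
      also have "\<dots> = n u0 \<cdot> \<alpha>' u0"
        unfolding n_def using comp_assoc[OF a'(1)[OF u0] PD(4)[OF u0] M(2)[OF u0]] by simp
      also have "\<dots> = h \<cdot> \<alpha>"
        using comp_assoc[OF a'(1)[OF u0] L(2)[OF u0] h(1)] h(2)[OF u0] a'(2)[OF u0] by simp
      finally show ?thesis .
    qed
    then obtain g where g: "g \<in> hom C x' z" "g \<cdot> i = bb" "g \<cdot> j = h" using pushout_desc[OF po bbh h(1)] by metis
    have ge: "g \<cdot> e u = m u" if u: "u \<in> Obj K" for u
    proof (rule pushout_eqI[OF P[OF u] comp_hom[OF e(1)[OF u] g(1)] M(2)[OF u]])
      show "(g \<cdot> e u) \<cdot> \<beta> u = m u \<cdot> \<beta> u"
        using comp_assoc[OF PD(3)[OF u] e(1)[OF u] g(1)] e(2)[OF u] g(2) bb[OF u] by simp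
      show "(g \<cdot> e u) \<cdot> \<xi> u = m u \<cdot> \<xi> u"
        using comp_assoc[OF PD(4)[OF u] e(1)[OF u] g(1)] e(3)[OF u] triangle_ext[OF g(3) D0(4) g(1) L(2)[OF u]]
          h(2)[OF u] n_def by simp
    qed
    show "\<exists>!g. g \<in> hom C x' z \<and> (\<forall>u\<in>Obj K. g \<cdot> e u = m u)"
    proof (rule ex1I[of _ g])
      show "g \<in> hom C x' z \<and> (\<forall>u\<in>Obj K. g \<cdot> e u = m u)" using g(1) ge by blast
      fix g' assume "g' \<in> hom C x' z \<and> (\<forall>u\<in>Obj K. g' \<cdot> e u = m u)"
      then have g': "g' \<in> hom C x' z" "\<And>u. u \<in> Obj K \<Longrightarrow> g' \<cdot> e u = m u" by auto
      show "g' = g"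
      proof (rule pushout_eqI[OF po g'(1) g(1)])
        show "g' \<cdot> i = g \<cdot> i"
          using triangle_ext[OF g'(2)[OF u0] e(1)[OF u0] g'(1) PD(3)[OF u0]] e(2)[OF u0] g(2) bb_def by simp
        show "g' \<cdot> j = g \<cdot> j"
          unfolding g(3)
        proof (rule colimit_eqI[OF l K(1) D comp_hom[OF D0(4) g'(1)] h(1)])
          fix u assume u: "u \<in> Obj K"
          show "(g' \<cdot> j) \<cdot> l u = h \<cdot> l u"
            using comp_assoc[OF L(2)[OF u] D0(4) g'(1)] e(3)[OF u, symmetric]
              triangle_ext[OF g'(2)[OF u] e(1)[OF u] g'(1) PD(4)[OF u]] h(2)[OF u] n_def by simp
        qed
      qed
    qed
  qed (fact ecc)
  note commE = finitely_presentable_commutes[OF _ K E ecol]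
  note commD = finitely_presentable_commutes[OF _ K D l]
  have Em: "fmor E t = \<epsilon> t" "fobj E u = P u" for t u unfolding E_def by auto
  show ?thesis
  proof (rule approximableI[OF D0(4)])
    fix c d a' y v
    assume c: "fp c" and d: "fp d" and a': "a' \<in> hom C c d" and y: "y \<in> hom C c x" and v: "v \<in> hom C d x'"
      and eq: "j \<cdot> y = v \<cdot> a'"
    obtain u1 v0 where u1: "u1 \<in> Obj K" and v0: "v0 \<in> hom C d (P u1)" "e u1 \<cdot> v0 = v"
      using commutes_hom_factor[OF commE[OF d] v] unfolding Em by metis
    obtain u2 y0 where u2: "u2 \<in> Obj K" and y0: "y0 \<in> hom C c (fobj D u2)" "l u2 \<cdot> y0 = y"
      using commutes_hom_factor[OF commD[OF c] y] .
    obtain u t1 t2 where t: "t1 \<in> hom K u1 u" "t2 \<in> hom K u2 u" using K.filtered_bound[OF K(4) u1 u2] .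
    have u: "u \<in> Obj K" using K.homD[OF t(1)] by blast
    have t1h: "\<epsilon> t1 \<in> hom C (P u1) (P u)" using \<epsilon>[OF t(1)] by blast
    define v1 where "v1 = \<epsilon> t1 \<cdot> v0"
    define y1 where "y1 = fmor D t2 \<cdot> y0"
    have v1: "v1 \<in> hom C d (P u)" "e u \<cdot> v1 = v"
      unfolding v1_def using comp_hom[OF v0(1) t1h]
        triangle_ext[OF coconeD(3)[OF ecc t(1), unfolded Em] t1h e(1)[OF u] v0(1)] v0(2) by auto
    have y1: "y1 \<in> hom C c (fobj D u)" "l u \<cdot> y1 = y"
      unfolding y1_def using comp_hom[OF y0(1) F(2)[OF t(2)]]
        triangle_ext[OF L(3)[OF t(2)] F(2)[OF t(2)] L(2)[OF u] y0(1)] y0(2) by auto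
    have "e u \<cdot> (\<xi> u \<cdot> y1) = e u \<cdot> (v1 \<cdot> a')"
      using triangle_ext[OF e(3)[OF u] PD(4)[OF u] e(1)[OF u] y1(1)] comp_assoc[OF y1(1) L(2)[OF u] D0(4)] y1(2)
        triangle_ext[OF v1(2,1) e(1)[OF u] a'] eq by simp
    \<comment> \<open>At the common stage \<open>u\<close> the square commutes only after passing to
      \<open>x'\<close>. Finite presentability of \<open>c\<close> makes it commute at the later
      stage \<open>u'\<close>, where \<open>\<xi> u'\<close> is the approximating map.\<close>
    then obtain u' t where t: "t \<in> hom K u u'" "\<epsilon> t \<cdot> (\<xi> u \<cdot> y1) = \<epsilon> t \<cdot> (v1 \<cdot> a')"
      using commutes_hom_eq[OF commE[OF c] u, unfolded Em, OF comp_hom[OF y1(1) PD(4)[OF u]] comp_hom[OF a' v1(1)]]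
      by metis
    have u': "u' \<in> Obj K" using K.homD[OF t(1)] by blast
    have th: "\<epsilon> t \<in> hom C (P u) (P u')" and tx: "\<epsilon> t \<cdot> \<xi> u = \<xi> u' \<cdot> fmor D t" using \<epsilon>[OF t(1)] by auto
    show "approximates (fp_llp Q) x x' j c d a' y v"
    proof (rule approximatesI[OF _ PD(4)[OF u'] comp_hom[OF y1(1) F(2)[OF t(1)]] comp_hom[OF v1(1) th] L(2)[OF u'] e(1)[OF u']])
      show "\<xi> u' \<in> fp_llp Q"
        using fp_llpI[OF llp_pushout[OF Q ab(3) P[OF u']] PD(4)[OF u']] o[OF u'] fp_pushout[OF P[OF u'] ab(1,2)] by blast
      show "\<xi> u' \<cdot> (fmor D t \<cdot> y1) = (\<epsilon> t \<cdot> v1) \<cdot> a'"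
        using square_ext[OF tx PD(4)[OF u] th F(2)[OF t(1)] PD(4)[OF u'] y1(1)] t(2) comp_assoc[OF a' v1(1) th] by simp
      show "j \<cdot> l u' = e u' \<cdot> \<xi> u'" using e(3)[OF u'] by simp
      show "l u' \<cdot> (fmor D t \<cdot> y1) = y"
        using triangle_ext[OF L(3)[OF t(1)] F(2)[OF t(1)] L(2)[OF u'] y1(1)] y1(2) by simp
      show "e u' \<cdot> (\<epsilon> t \<cdot> v1) = v"
        using triangle_ext[OF coconeD(3)[OF ecc t(1), unfolded Em] th e(1)[OF u'] v1(1)] v1(2) by simp
    qed
  qed
qed

end

section \<open>Cells, finite cell complexes, and the countable chain of stages\<close>

section \<open>The small object argument\<close>

lemma filtered_poset_cat:
  assumes "A \<noteq> {}" and "\<And>a b. a \<in> A \<Longrightarrow> b \<in> A \<Longrightarrow> \<exists>c\<in>A. r a c \<and> r b c"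
    and "\<And>a. a \<in> A \<Longrightarrow> r a a"
  shows "filtered (poset_cat A r)"
  unfolding filtered_def
proof (intro conjI ballI allI)
  show "\<exists>c\<in>Obj (poset_cat A r). hom (poset_cat A r) a c \<noteq> {} \<and> hom (poset_cat A r) b c \<noteq> {}"
    if "a \<in> Obj (poset_cat A r)" "b \<in> Obj (poset_cat A r)" for a b
  proof -
    have ab: "a \<in> A" "b \<in> A" using that by auto
    obtain c where c: "c \<in> A" "r a c" "r b c" using assms(2)[OF ab] by blast
    then have "(a, c) \<in> hom (poset_cat A r) a c" "(b, c) \<in> hom (poset_cat A r) b c"
      using ab by (auto simp: hom_poset_cat)
    then show ?thesis using c(1) by auto
  qed
  show "\<exists>c. \<exists>h\<in>hom (poset_cat A r) b c. h \<cdot>\<^bsub>poset_cat A r\<^esub> f = h \<cdot>\<^bsub>poset_cat A r\<^esub> g"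
    if "f \<in> hom (poset_cat A r) a b" "g \<in> hom (poset_cat A r) a b" for a b f g
  proof -
    have "(b, b) \<in> hom (poset_cat A r) b b" "f = g" using that assms(3) by (auto simp: hom_poset_cat)
    then show ?thesis by blast
  qed
qed (use assms(1) in simp)

context lfp_category
begin

text \<open>
  A triple \<open>(i, f, g)\<close> stands for a commutative square from the generator \<open>i\<close> to a fixed map
  \<open>h\<close>, with \<open>f\<close> and \<open>g\<close> between the domains and the codomains; attaching it glues a copy of the
  codomain of \<open>i\<close> along \<open>f\<close>.
\<close>

definition attachment :: "'o \<Rightarrow> ('m \<times> 'm \<times> 'm) set \<Rightarrow> 'o \<Rightarrow> 'm \<Rightarrow> ('m \<times> 'm \<times> 'm \<Rightarrow> 'm) \<Rightarrow> bool" where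
  "attachment x F y e b \<longleftrightarrow> e \<in> hom C x y \<and>
     (\<forall>s\<in>F. b s \<in> hom C (Cod C (fst s)) y \<and> b s \<cdot> fst s = e \<cdot> fst (snd s))"

text \<open>The pushout of the coproduct of all generators in \<open>F\<close>, expressed by its
  universal property: all cells are attached directly to \<open>x\<close>. No large coproduct has to
  be formed, and an inclusion of sets of cells induces a canonical map of complexes.\<close>

definition cell_complex :: "'o \<Rightarrow> ('m \<times> 'm \<times> 'm) set \<Rightarrow> 'o \<Rightarrow> 'm \<Rightarrow> ('m \<times> 'm \<times> 'm \<Rightarrow> 'm) \<Rightarrow> bool" where
  "cell_complex x F y e b \<longleftrightarrow> attachment x F y e b \<and>
     (\<forall>y' e' b'. attachment x F y' e' b' \<longrightarrow>
        (\<exists>k. k \<in> hom C y y' \<and> k \<cdot> e = e' \<and> (\<forall>s\<in>F. k \<cdot> b s = b' s))) \<and>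
     (\<forall>y' k k'. k \<in> hom C y y' \<longrightarrow> k' \<in> hom C y y' \<longrightarrow> k \<cdot> e = k' \<cdot> e \<longrightarrow>
        (\<forall>s\<in>F. k \<cdot> b s = k' \<cdot> b s) \<longrightarrow> k = k')"

lemma attachmentD:
  assumes "attachment x F y e b"
  shows "e \<in> hom C x y" and "s \<in> F \<Longrightarrow> b s \<in> hom C (Cod C (fst s)) y"
    and "s \<in> F \<Longrightarrow> b s \<cdot> fst s = e \<cdot> fst (snd s)"
  using assms unfolding attachment_def by blast+

lemma cell_complex_attachment: "cell_complex x F y e b \<Longrightarrow> attachment x F y e b"
  unfolding cell_complex_def by blast

lemma cell_complex_desc:
  assumes "cell_complex x F y e b" and "attachment x F y' e' b'"
  obtains k where "k \<in> hom C y y'" and "k \<cdot> e = e'" and "\<And>s. s \<in> F \<Longrightarrow> k \<cdot> b s = b' s"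
  using assms unfolding cell_complex_def by blast

lemma cell_complex_eqI:
  assumes "cell_complex x F y e b" and "k \<in> hom C y y'" and "k' \<in> hom C y y'" and "k \<cdot> e = k' \<cdot> e"
    and "\<And>s. s \<in> F \<Longrightarrow> k \<cdot> b s = k' \<cdot> b s"
  shows "k = k'"
  using assms unfolding cell_complex_def by blast

lemma attachment_comp:
  assumes a: "attachment x F y e b" and k: "k \<in> hom C y y'"
    and F: "\<And>s. s \<in> F \<Longrightarrow> fst s \<in> Mor C \<and> fst (snd s) \<in> hom C (Dom C (fst s)) x"
  shows "attachment x F y' (k \<cdot> e) (\<lambda>s. k \<cdot> b s)"
  unfolding attachment_def
proof (intro conjI ballI)
  note D = attachmentD[OF a]
  show "k \<cdot> e \<in> hom C x y'" using comp_hom[OF D(1) k] .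
  fix s assume s: "s \<in> F"
  show "k \<cdot> b s \<in> hom C (Cod C (fst s)) y'" using comp_hom[OF D(2)[OF s] k] .
  have "fst s \<in> hom C (Dom C (fst s)) (Cod C (fst s))" "fst (snd s) \<in> hom C (Dom C (fst s)) x"
    using F[OF s] hom_Mor by auto
  then show "(k \<cdot> b s) \<cdot> fst s = (k \<cdot> e) \<cdot> fst (snd s)"
    using comp_assoc[OF _ D(2)[OF s] k] comp_assoc[OF _ D(1) k] D(3)[OF s] by simp
qed

lemma attachment_subset: "attachment x G y e b \<Longrightarrow> F \<subseteq> G \<Longrightarrow> attachment x F y e b"
  unfolding attachment_def by blast

text \<open>Cells are attached one at a time. Each attachment is a cobase change of a small map of
  the left class, so approximability of the whole inclusion follows from the cases of identities,
  pushouts and composites.\<close>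

lemma cell_complex_exists:
  assumes x: "x \<in> Obj C" and Q: "Q \<subseteq> Mor C" and "finite F"
    and F: "\<And>s. s \<in> F \<Longrightarrow> fst s \<in> fp_llp Q \<and> fst s \<in> Mor C \<and> fst (snd s) \<in> hom C (Dom C (fst s)) x"
  shows "\<exists>y e b. cell_complex x F y e b \<and> approximable (fp_llp Q) x y e"
  using \<open>finite F\<close> F
proof (induction F rule: finite_induct)
  case empty
  have "cell_complex x {} x (Ident C x) (\<lambda>_. undefined)"
    unfolding cell_complex_def attachment_def
    using ident_hom[OF x] comp_ident by (metis empty_iff)
  then show ?case using approximable_ident[OF Q x] by blast
next
  case (insert s F)
  then obtain y e b where y: "cell_complex x F y e b" "approximable (fp_llp Q) x y e"
    by (meson insertCI)
  note A = cell_complex_attachment[OF y(1)]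
  note D = attachmentD[OF A]
  have s: "fst s \<in> fp_llp Q" "fst s \<in> hom C (Dom C (fst s)) (Cod C (fst s))" "fst (snd s) \<in> hom C (Dom C (fst s)) x"
    using insert.prems[of s] hom_Mor by auto
  have F: "\<And>s. s \<in> F \<Longrightarrow> fst s \<in> Mor C \<and> fst (snd s) \<in> hom C (Dom C (fst s)) x"
    using insert.prems by blast
  \<comment> \<open>The attaching map of \<open>s\<close> goes into \<open>x\<close>; composing it
    with \<open>e\<close> attaches the cell to the complex \<open>y\<close> built so far without
    making it depend on the earlier cells.\<close>
  obtain y' \<beta> j where po: "pushout_square C (Dom C (fst s)) (Cod C (fst s)) y y' (fst s) (e \<cdot> fst (snd s)) \<beta> j"
    using pushout_exists[OF s(2) comp_hom[OF s(3) D(1)]] .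
  note P = pushoutD[OF po]
  define b' where "b' r = (if r = s then \<beta> else j \<cdot> b r)" for r
  have b'F: "b' r = j \<cdot> b r" if "r \<in> F" for r using that insert.hyps by (auto simp: b'_def)
  have b's: "b' s = \<beta>" by (simp add: b'_def)
  have je: "attachment x F y' (j \<cdot> e) (\<lambda>s. j \<cdot> b s)" by (rule attachment_comp[OF A P(4) F])
  have "cell_complex x (insert s F) y' (j \<cdot> e) b'"
    unfolding cell_complex_def
  proof (intro conjI allI impI)
    show "attachment x (insert s F) y' (j \<cdot> e) b'"
      unfolding attachment_def
    proof (intro conjI ballI)
      show "j \<cdot> e \<in> hom C x y'" using attachmentD(1)[OF je] .
      fix r assume "r \<in> insert s F"
      then consider "r = s" | "r \<in> F" by blast
      then have "b' r \<in> hom C (Cod C (fst r)) y' \<and> b' r \<cdot> fst r = (j \<cdot> e) \<cdot> fst (snd r)"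
      proof cases
        case 1
        then show ?thesis using P(3,5) comp_assoc[OF s(3) D(1) P(4)] b's by simp
      next
        case 2
        then show ?thesis using attachmentD(2,3)[OF je 2] b'F by simp
      qed
      then show "b' r \<in> hom C (Cod C (fst r)) y'" "b' r \<cdot> fst r = (j \<cdot> e) \<cdot> fst (snd r)" by auto
    qed
  next
    fix z e' c assume z: "attachment x (insert s F) z e' c"
    note Z = attachmentD[OF z]
    obtain k where k: "k \<in> hom C y z" "k \<cdot> e = e'" "\<And>r. r \<in> F \<Longrightarrow> k \<cdot> b r = c r"
      using cell_complex_desc[OF y(1) attachment_subset[OF z]] by blast
    have "c s \<cdot> fst s = k \<cdot> (e \<cdot> fst (snd s))"
      using Z(3)[of s] triangle_ext[OF k(2) D(1) k(1) s(3)] by simp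
    then obtain m where m: "m \<in> hom C y' z" "m \<cdot> \<beta> = c s" "m \<cdot> j = k"
      using pushout_desc[OF po Z(2)[of s] k(1)] by blast
    have "m \<cdot> (j \<cdot> e) = e'" using triangle_ext[OF m(3) P(4) m(1) D(1)] k(2) by simp
    moreover have "m \<cdot> b' r = c r" if "r \<in> insert s F" for r
    proof (cases "r = s")
      case True
      then show ?thesis using m(2) b's by simp
    next
      case False
      then have r: "r \<in> F" using that by blast
      then show ?thesis using triangle_ext[OF m(3) P(4) m(1) D(2)[OF r]] k(3) b'F by simp
    qed
    ultimately show "\<exists>m. m \<in> hom C y' z \<and> m \<cdot> (j \<cdot> e) = e' \<and> (\<forall>r\<in>insert s F. m \<cdot> b' r = c r)"
      using m(1) by blast
  next
    fix z k k' assume k: "k \<in> hom C y' z" "k' \<in> hom C y' z" "k \<cdot> (j \<cdot> e) = k' \<cdot> (j \<cdot> e)"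
      "\<forall>r\<in>insert s F. k \<cdot> b' r = k' \<cdot> b' r"
    show "k = k'"
    proof (rule pushout_eqI[OF po k(1,2)])
      show "k \<cdot> \<beta> = k' \<cdot> \<beta>" using k(4) b's by auto
      show "k \<cdot> j = k' \<cdot> j"
      proof (rule cell_complex_eqI[OF y(1) comp_hom[OF P(4) k(1)] comp_hom[OF P(4) k(2)]])
        show "(k \<cdot> j) \<cdot> e = (k' \<cdot> j) \<cdot> e"
          using comp_assoc[OF D(1) P(4) k(1)] comp_assoc[OF D(1) P(4) k(2)] k(3) by simp
        fix r assume r: "r \<in> F"
        show "(k \<cdot> j) \<cdot> b r = (k' \<cdot> j) \<cdot> b r"
          using comp_assoc[OF D(2)[OF r] P(4) k(1)] comp_assoc[OF D(2)[OF r] P(4) k(2)]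
            bspec[OF k(4) insertI2[OF r]] unfolding b'F[OF r] by simp
      qed
    qed
  qed
  moreover have "approximable (fp_llp Q) x y' (j \<cdot> e)"
    by (rule approximable_comp[OF Q y(2) approximable_pushout[OF Q s(1) po]])
  ultimately show ?case by blast
qed

lemma llp_rlp_generator: "I \<subseteq> Mor C \<Longrightarrow> i \<in> I \<Longrightarrow> i \<in> llp C (rlp C I)"
  unfolding llp_def rlp_def by blast

text \<open>One stage attaches a cell for every square into \<open>h\<close>, a small but in general
  infinite set \<open>S\<close>. The result is formed as the colimit over the finite subsets of
  \<open>S\<close>, ordered by inclusion; this colimit is filtered and has fixed domain
  \<open>x\<close>, so approximability of \<open>e\<close> is inherited from finite
  complexes.\<close>

lemma small_object_step:
  assumes I: "I \<subseteq> Mor C" "small U I" "\<And>i. i \<in> I \<Longrightarrow> fp (Dom C i) \<and> fp (Cod C i)"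
    and h: "h \<in> hom C x z"
  shows "\<exists>x' e h'. approximable (fp_llp (rlp C I)) x x' e \<and> h' \<in> hom C x' z \<and> h' \<cdot> e = h \<and>
    (\<forall>i\<in>I. \<forall>f\<in>hom C (Dom C i) x. \<forall>g\<in>hom C (Cod C i) z. h \<cdot> f = g \<cdot> i \<longrightarrow>
       (\<exists>k\<in>hom C (Cod C i) x'. k \<cdot> i = e \<cdot> f \<and> h' \<cdot> k = g))"
proof -
  define Q where "Q = rlp C I"
  have Q: "Q \<subseteq> Mor C" unfolding Q_def by (rule rlp_Mor)
  have x: "x \<in> Obj C" "z \<in> Obj C" using homD[OF h] by auto
  define S where "S = {(i, f, g). i \<in> I \<and> f \<in> hom C (Dom C i) x \<and> g \<in> hom C (Cod C i) z \<and> h \<cdot> f = g \<cdot> i}"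
  have "small U (SIGMA i:I. hom C (Dom C i) x \<times> hom C (Cod C i) z)"
    by (rule small_Sigma[OF universe I(2)]) (use I(3) fp_Obj x in \<open>blast intro: small_Times[OF universe] small_hom\<close>)
  then have "small U S" by (rule small_subset[rotated]) (auto simp: S_def)
  have gen: "fst s \<in> fp_llp Q \<and> fst s \<in> Mor C \<and> fst (snd s) \<in> hom C (Dom C (fst s)) x" if "s \<in> S" for s
    using that I llp_rlp_generator[OF I(1)] unfolding S_def Q_def fp_llp_def by auto
  define A where "A = {F. F \<subseteq> S \<and> finite F}"
  have A: "F \<subseteq> S" "finite F" if "F \<in> A" for F using that unfolding A_def by auto
  have "\<exists>y e b. cell_complex x F y e b \<and> approximable (fp_llp Q) x y e" if "F \<in> A" for F
    by (rule cell_complex_exists[OF x(1) Q A(2)[OF that]]) (use gen A(1)[OF that] in blast)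
  then obtain P \<eta> b where P: "\<And>F. F \<in> A \<Longrightarrow> cell_complex x F (P F) (\<eta> F) (b F)"
    "\<And>F. F \<in> A \<Longrightarrow> approximable (fp_llp Q) x (P F) (\<eta> F)" by metis
  note Pa = cell_complex_attachment[OF P(1)]
  have gen': "fst s \<in> Mor C \<and> fst (snd s) \<in> hom C (Dom C (fst s)) x" if "F \<in> A" "s \<in> F" for F s
    using gen A(1) that by blast
  have ex\<tau>: "\<exists>k. k \<in> hom C (P F) (P G) \<and> k \<cdot> \<eta> F = \<eta> G \<and> (\<forall>s\<in>F. k \<cdot> b F s = b G s)"
    if "F \<in> A" "G \<in> A" "F \<subseteq> G" for F G
    using cell_complex_desc[OF P(1)[OF that(1)] attachment_subset[OF Pa[OF that(2)] that(3)]] by metis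
  \<comment> \<open>The universal property of \<open>P F\<close> determines these maps uniquely, so
    the arbitrary choice still yields a functor.\<close>
  define \<tau> where "\<tau> F G = (SOME k. k \<in> hom C (P F) (P G) \<and> k \<cdot> \<eta> F = \<eta> G \<and> (\<forall>s\<in>F. k \<cdot> b F s = b G s))" for F G
  have \<tau>: "\<And>F G. F \<in> A \<Longrightarrow> G \<in> A \<Longrightarrow> F \<subseteq> G \<Longrightarrow> \<tau> F G \<in> hom C (P F) (P G)"
    "\<And>F G. F \<in> A \<Longrightarrow> G \<in> A \<Longrightarrow> F \<subseteq> G \<Longrightarrow> \<tau> F G \<cdot> \<eta> F = \<eta> G"
    "\<And>F G s. F \<in> A \<Longrightarrow> G \<in> A \<Longrightarrow> F \<subseteq> G \<Longrightarrow> s \<in> F \<Longrightarrow> \<tau> F G \<cdot> b F s = b G s"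
    unfolding \<tau>_def using someI_ex[OF ex\<tau>] by blast+
  define K where "K = poset_cat A (\<subseteq>)"
  define D where "D = \<lparr>fobj = P, fmor = (\<lambda>(F, G). \<tau> F G)\<rparr>"
  have "small U (Pow S)" by (rule small_Pow[OF universe \<open>small U S\<close>])
  then have "small U A" by (rule small_subset[rotated]) (auto simp: A_def)
  have emp: "{} \<in> A" unfolding A_def by simp
  have un: "F \<union> G \<in> A" if "F \<in> A" "G \<in> A" for F G using that unfolding A_def by auto
  have K: "category K" "small U (Obj K)" "small U (Mor K)" "filtered K"
    unfolding K_def
    using category_poset_cat[of A "(\<subseteq>)"] small_poset_cat[OF universe \<open>small U A\<close>]
      filtered_poset_cat[of A "(\<subseteq>)"] emp un by (blast+)
  have "is_functor K C D"
    unfolding K_def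
  proof (rule functor_poset_catI)
    fix F assume F: "F \<in> A"
    show o: "fobj D F \<in> Obj C" unfolding D_def using homD[OF attachmentD(1)[OF Pa[OF F]]] by simp
    note PF = attachmentD[OF Pa[OF F]]
    have "\<tau> F F = Ident C (P F)"
    proof (rule cell_complex_eqI[OF P(1)[OF F] \<tau>(1)[OF F F subset_refl] ident_hom])
      show "P F \<in> Obj C" using o by (simp add: D_def)
      show "\<tau> F F \<cdot> \<eta> F = Ident C (P F) \<cdot> \<eta> F" using \<tau>(2)[OF F F] ident_comp[OF PF(1)] by simp
      fix s assume s: "s \<in> F"
      show "\<tau> F F \<cdot> b F s = Ident C (P F) \<cdot> b F s"
        using \<tau>(3)[OF F F subset_refl s] ident_comp[OF PF(2)[OF s]] by simp
    qed
    then show "fmor D (F, F) = Ident C (fobj D F)" by (simp add: D_def)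
    fix G assume G: "G \<in> A" "F \<subseteq> G"
    show "fmor D (F, G) \<in> hom C (fobj D F) (fobj D G)" using \<tau>(1)[OF F G] by (simp add: D_def)
    fix H assume H: "H \<in> A" "G \<subseteq> H"
    have FH: "F \<subseteq> H" using G H by blast
    have "\<tau> F H = \<tau> G H \<cdot> \<tau> F G"
    proof (rule cell_complex_eqI[OF P(1)[OF F] \<tau>(1)[OF F H(1) FH] comp_hom[OF \<tau>(1)[OF F G] \<tau>(1)[OF G(1) H]]])
      show "\<tau> F H \<cdot> \<eta> F = (\<tau> G H \<cdot> \<tau> F G) \<cdot> \<eta> F"
        using comp_assoc[OF attachmentD(1)[OF Pa[OF F]] \<tau>(1)[OF F G] \<tau>(1)[OF G(1) H]]
          \<tau>(2)[OF F H(1) FH] \<tau>(2)[OF F G] \<tau>(2)[OF G(1) H] by simp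
      fix s assume s: "s \<in> F"
      then have "s \<in> G" using G by blast
      then show "\<tau> F H \<cdot> b F s = (\<tau> G H \<cdot> \<tau> F G) \<cdot> b F s"
        using comp_assoc[OF attachmentD(2)[OF Pa[OF F] s] \<tau>(1)[OF F G] \<tau>(1)[OF G(1) H]]
          \<tau>(3)[OF F H(1) FH s] \<tau>(3)[OF F G s] \<tau>(3)[OF G(1) H] by simp
    qed
    then show "fmor D (F, H) = fmor D (G, H) \<cdot> fmor D (F, G)" by (simp add: D_def)
  qed
  note D = this
  obtain x' l where l: "is_colimit K C D x' l" using colimit_exists[OF K(1-3) D] .
  have L: "l F \<in> hom C (P F) x'" if "F \<in> A" for F
    using coconeD(2)[OF colimit_cocone[OF l], of F] that by (simp add: K_def D_def)
  have Lc: "l G \<cdot> \<tau> F G = l F" if "F \<in> A" "G \<in> A" "F \<subseteq> G" for F G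
    using coconeD(3)[OF colimit_cocone[OF l], of "(F, G)" F G] that
    by (simp add: K_def D_def hom_poset_cat)
  define e where "e = l {} \<cdot> \<eta> {}"
  have le: "l F \<cdot> \<eta> F = e" if F: "F \<in> A" for F
    unfolding e_def
    using triangle_ext[OF Lc[OF emp F] \<tau>(1)[OF emp F] L[OF F] attachmentD(1)[OF Pa[OF emp]]] \<tau>(2)[OF emp F] by simp
  have eh: "e \<in> hom C x x'" unfolding e_def using comp_hom[OF attachmentD(1)[OF Pa[OF emp]] L[OF emp]] .
  have app: "approximable (fp_llp Q) x x' e"
  proof (rule approximable_filtered_colimit[OF K D l _ _ eh])
    show "approximable (fp_llp Q) x (fobj D F) (\<eta> F)" if "F \<in> Obj K" for F
      using P(2) that by (simp add: K_def D_def)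
    show "fmor D t \<cdot> \<eta> F = \<eta> G" if "t \<in> hom K F G" for F G t
      using that \<tau>(2) by (auto simp: K_def D_def hom_poset_cat)
    show "l F \<cdot> \<eta> F = e" if "F \<in> Obj K" for F using that le by (simp add: K_def)
  qed
  have "attachment x F z h (\<lambda>s. snd (snd s))" if "F \<in> A" for F
    unfolding attachment_def using h A(1)[OF that] by (auto simp: S_def)
  then have "\<exists>k. k \<in> hom C (P F) z \<and> k \<cdot> \<eta> F = h \<and> (\<forall>s\<in>F. k \<cdot> b F s = snd (snd s))" if "F \<in> A" for F
    using cell_complex_desc[OF P(1)] that by metis
  then obtain \<kappa> where \<kappa>: "\<And>F. F \<in> A \<Longrightarrow> \<kappa> F \<in> hom C (P F) z" "\<And>F. F \<in> A \<Longrightarrow> \<kappa> F \<cdot> \<eta> F = h"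
    "\<And>F s. F \<in> A \<Longrightarrow> s \<in> F \<Longrightarrow> \<kappa> F \<cdot> b F s = snd (snd s)" by metis
  have "is_cocone K C D z \<kappa>"
    unfolding K_def
  proof (rule cocone_poset_catI[OF x(2)])
    show "\<kappa> F \<in> hom C (fobj D F) z" if "F \<in> A" for F using \<kappa>(1)[OF that] by (simp add: D_def)
    fix F G assume F: "F \<in> A" and G: "G \<in> A" "F \<subseteq> G"
    have "\<kappa> G \<cdot> \<tau> F G = \<kappa> F"
    proof (rule cell_complex_eqI[OF P(1)[OF F] comp_hom[OF \<tau>(1)[OF F G] \<kappa>(1)[OF G(1)]] \<kappa>(1)[OF F]])
      show "(\<kappa> G \<cdot> \<tau> F G) \<cdot> \<eta> F = \<kappa> F \<cdot> \<eta> F"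
        using comp_assoc[OF attachmentD(1)[OF Pa[OF F]] \<tau>(1)[OF F G] \<kappa>(1)[OF G(1)]] \<tau>(2)[OF F G] \<kappa>(2) F G by simp
      fix s assume s: "s \<in> F"
      then have "s \<in> G" using G by blast
      then show "(\<kappa> G \<cdot> \<tau> F G) \<cdot> b F s = \<kappa> F \<cdot> b F s"
        using comp_assoc[OF attachmentD(2)[OF Pa[OF F] s] \<tau>(1)[OF F G] \<kappa>(1)[OF G(1)]] \<tau>(3)[OF F G s] \<kappa>(3) F G s by simp
    qed
    then show "\<kappa> G \<cdot> fmor D (F, G) = \<kappa> F" by (simp add: D_def)
  qed
  then obtain h' where h': "h' \<in> hom C x' z" "\<And>F. F \<in> A \<Longrightarrow> h' \<cdot> l F = \<kappa> F"
    using colimit_desc[OF l] unfolding K_def Obj_poset_cat by metis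
  have "h' \<cdot> e = h"
    unfolding e_def using triangle_ext[OF h'(2)[OF emp] L[OF emp] h'(1) attachmentD(1)[OF Pa[OF emp]]] \<kappa>(2)[OF emp] by simp
  moreover have "\<exists>k\<in>hom C (Cod C i) x'. k \<cdot> i = e \<cdot> f \<and> h' \<cdot> k = g"
    if i: "i \<in> I" and f: "f \<in> hom C (Dom C i) x" and g: "g \<in> hom C (Cod C i) z" and eq: "h \<cdot> f = g \<cdot> i" for i f g
  proof -
    define s where "s = (i, f, g)"
    have "s \<in> S" unfolding S_def s_def using i f g eq by blast
    \<comment> \<open>The solution for a single square is already present in the complex with that
      one cell, at the stage \<open>{s}\<close>.\<close>
    then have F: "{s} \<in> A" unfolding A_def by blast
    note B = attachmentD[OF Pa[OF F]]
    have bs: "b {s} s \<in> hom C (Cod C i) (P {s})" "b {s} s \<cdot> i = \<eta> {s} \<cdot> f"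
      using B(2)[of s] B(3)[of s] by (auto simp: s_def)
    have ih: "i \<in> hom C (Dom C i) (Cod C i)" using I(1) i hom_Mor by blast
    have "(l {s} \<cdot> b {s} s) \<cdot> i = e \<cdot> f"
      using comp_assoc[OF ih bs(1) L[OF F]] bs(2) triangle_ext[OF le[OF F] B(1) L[OF F] f] by simp
    moreover have "h' \<cdot> (l {s} \<cdot> b {s} s) = g"
      using triangle_ext[OF h'(2)[OF F] L[OF F] h'(1) bs(1)] \<kappa>(3)[OF F, of s] by (simp add: s_def)
    ultimately show ?thesis using comp_hom[OF bs(1) L[OF F]] by blast
  qed
  ultimately show ?thesis using app h'(1) unfolding Q_def by blast
qed

text \<open>Transition maps are indexed by starting point and length, so the composition law becomes
  an induction on the second length. Length \<open>0\<close> gives the identity and length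
  \<open>1\<close> gives \<open>e n\<close>.\<close>

lemma chain_functor:
  fixes X :: "nat \<Rightarrow> 'o" and e :: "nat \<Rightarrow> 'm"
  assumes X: "\<And>n. X n \<in> Obj C" and e: "\<And>n. e n \<in> hom C (X n) (X (Suc n))"
  obtains D where "is_functor (poset_cat UNIV (\<le>)) C D" and "\<And>n. fobj D n = X n"
    and "\<And>n. fmor D (n, Suc n) = e n"
proof -
  define c where "c m = rec_nat (Ident C (X m)) (\<lambda>d f. e (m + d) \<cdot> f)" for m
  have c0: "c m 0 = Ident C (X m)" and cS: "c m (Suc d) = e (m + d) \<cdot> c m d" for m d
    by (simp_all add: c_def)
  have ch: "c m d \<in> hom C (X m) (X (m + d))" for m d
  proof (induction d)
    case 0 then show ?case using ident_hom[OF X] by (simp add: c0)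
  next
    case (Suc d) then show ?case using comp_hom[OF Suc e[of "m + d"]] by (simp add: cS)
  qed
  have c_add: "c m (d + d') = c (m + d) d' \<cdot> c m d" for m d d'
  proof (induction d')
    case 0 then show ?case using ident_comp[OF ch[of m d]] by (simp add: c0)
  next
    case (Suc d')
    have e': "e (m + (d + d')) \<in> hom C (X (m + d + d')) (X (Suc (m + (d + d'))))"
      using e[of "m + (d + d')"] by (simp add: add.assoc)
    show ?case using comp_assoc[OF ch[of m d] ch[of "m + d" d'] e'] Suc by (simp add: cS add.assoc)
  qed
  define D where "D = \<lparr>fobj = X, fmor = (\<lambda>(m :: nat, n :: nat). c m (n - m))\<rparr>"
  have "is_functor (poset_cat UNIV (\<le>)) C D"
  proof (rule functor_poset_catI)
    show "fmor D (m, n) \<in> hom C (fobj D m) (fobj D n)" if "m \<le> n" for m n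
      using ch[of m "n - m"] that by (simp add: D_def)
    show "fmor D (a, d) = fmor D (b, d) \<cdot> fmor D (a, b)" if "a \<le> b" "b \<le> d" for a b d
      using c_add[of a "b - a" "d - b"] that by (simp add: D_def)
  qed (use X c0 in \<open>auto simp: D_def\<close>)
  moreover have "fmor D (n, Suc n) = e n" for n
    using cS[of n 0] c0 comp_ident[OF e] by (simp add: D_def)
  ultimately show ?thesis using that[of D] by (simp add: D_def)
qed

text \<open>The iterated stages factor \<open>f\<close> as \<open>l 0\<close> followed by
  \<open>q\<close>. The map \<open>l 0\<close> is approximable as a filtered colimit of composites,
  \<open>q\<close> has the right lifting property against \<open>I\<close>, and \<open>f\<close> is
  then a retract of \<open>l 0\<close>.\<close>

theorem llp_rlp_approximable:
  assumes I: "I \<subseteq> Mor C" "small U I" "\<And>i. i \<in> I \<Longrightarrow> fp (Dom C i) \<and> fp (Cod C i)"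
    and f: "f \<in> llp C (rlp C I)" "f \<in> hom C x z"
  shows "approximable (fp_llp (rlp C I)) x z f"
proof -
  define Q where "Q = rlp C I"
  have Q: "Q \<subseteq> Mor C" unfolding Q_def by (rule rlp_Mor)
  define St where "St y h y' e h' \<longleftrightarrow> approximable (fp_llp Q) y y' e \<and> h' \<in> hom C y' z \<and> h' \<cdot> e = h \<and>
    (\<forall>i\<in>I. \<forall>f\<in>hom C (Dom C i) y. \<forall>g\<in>hom C (Cod C i) z. h \<cdot> f = g \<cdot> i \<longrightarrow>
       (\<exists>k\<in>hom C (Cod C i) y'. k \<cdot> i = e \<cdot> f \<and> h' \<cdot> k = g))" for y h y' e h'
  have "\<exists>y' e h'. St y h y' e h'" if "h \<in> hom C y z" for y h
    unfolding St_def Q_def by (rule small_object_step[OF I that])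
  then have ex: "\<exists>p. St y h (fst p) (fst (snd p)) (snd (snd p))" if "h \<in> hom C y z" for y h
    using that by simp
  define nxt where "nxt y h = (SOME p. St y h (fst p) (fst (snd p)) (snd (snd p)))" for y h
  have St: "St y h (fst (nxt y h)) (fst (snd (nxt y h))) (snd (snd (nxt y h)))" if "h \<in> hom C y z" for y h
    unfolding nxt_def by (rule someI_ex[OF ex[OF that]])
  define Y where "Y y h = fst (nxt y h)" for y h
  define E where "E y h = fst (snd (nxt y h))" for y h
  define H where "H y h = snd (snd (nxt y h))" for y h
  note St = St[folded Y_def E_def H_def]
  \<comment> \<open>A state is a pair: the object reached so far and the remaining map from it to
    \<open>z\<close>.\<close>
  define st where "st = rec_nat (x, f) (\<lambda>_ (y, h). (Y y h, H y h))"
  define X where "X n = fst (st n)" for n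
  define h where "h n = snd (st n)" for n
  define e where "e n = E (X n) (h n)" for n
  have X0: "X 0 = x" "h 0 = f" by (simp_all add: X_def h_def st_def)
  have XS: "X (Suc n) = Y (X n) (h n)" "h (Suc n) = H (X n) (h n)" for n
    by (simp_all add: X_def h_def st_def case_prod_beta)
  have hh: "h n \<in> hom C (X n) z" for n
  proof (induction n)
    case 0 then show ?case using f(2) X0 by simp
  next
    case (Suc n) then show ?case using St[OF Suc] unfolding St_def XS by blast
  qed
  have st: "St (X n) (h n) (X (Suc n)) (e n) (h (Suc n))" for n
    unfolding XS e_def by (rule St[OF hh])
  have ea: "approximable (fp_llp Q) (X n) (X (Suc n)) (e n)" and he: "h (Suc n) \<cdot> e n = h n" for n
    using st[of n] unfolding St_def by auto
  have eh: "e n \<in> hom C (X n) (X (Suc n))" for n using approximable_hom[OF ea] .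
  have Xo: "X n \<in> Obj C" for n using homD[OF hh] by blast
  obtain D where D: "is_functor (poset_cat UNIV (\<le>)) C D" "\<And>n. fobj D n = X n" "\<And>n. fmor D (n, Suc n) = e n"
    using chain_functor[where X=X and e=e, OF Xo eh] by blast
  define K where "K = poset_cat (UNIV :: nat set) (\<le>)"
  have hK: "(m, n) \<in> hom K m n" if "m \<le> n" for m n using that by (simp add: K_def hom_poset_cat)
  have hK': "t = (m, n) \<and> m \<le> n" if "t \<in> hom K m n" for m n t using that by (simp add: K_def hom_poset_cat)
  have K: "category K" "small U (Obj K)" "small U (Mor K)" "filtered K"
    unfolding K_def
    using category_poset_cat[of "UNIV :: nat set" "(\<le>)"]
      small_poset_cat[OF universe small_nat_set[OF universe, of UNIV], of "(\<le>)"]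
      filtered_poset_cat[of "UNIV :: nat set" "(\<le>)"] by (auto intro: le_trans max.cobounded1 max.cobounded2)
  have DK: "is_functor K C D" using D(1) unfolding K_def .
  note F = functorD[OF DK]
  obtain y l where l: "is_colimit K C D y l" using colimit_exists[OF K(1-3) DK] .
  have L: "l n \<in> hom C (X n) y" for n
    using coconeD(2)[OF colimit_cocone[OF l], of n] D(2) by (simp add: K_def)
  have Lc: "l n \<cdot> fmor D (m, n) = l m" if "m \<le> n" for m n
    using coconeD(3)[OF colimit_cocone[OF l] hK[OF that]] .
  have step: "fmor D (m, Suc n) = e n \<cdot> fmor D (m, n)" if "m \<le> n" for m n
    using F(4)[OF hK[OF that] hK[of n "Suc n"]] D(3) by (simp add: K_def)
  have Fh: "fmor D (m, n) \<in> hom C (X m) (X n)" if "m \<le> n" for m n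
    using F(2)[OF hK[OF that]] D(2) by simp
  have p: "approximable (fp_llp Q) x (X n) (fmor D (0, n))" for n
  proof (induction n)
    case 0
    have "fmor D (0, 0) = Ident C x" using F(3)[of 0] D(2) X0 by (simp add: K_def)
    then show ?case using approximable_ident[OF Q] homD[OF f(2)] X0 by simp
  next
    case (Suc n)
    then show ?case using approximable_comp[OF Q Suc ea[of n]] step[of 0 n] by simp
  qed
  have lx: "l 0 \<in> hom C x y" using L[of 0] X0 by simp
  have app: "approximable (fp_llp Q) x y (l 0)"
  proof (rule approximable_filtered_colimit[OF K DK l _ _ lx])
    show "approximable (fp_llp Q) x (fobj D n) (fmor D (0, n))" for n using p D(2) by simp
    show "fmor D t \<cdot> fmor D (0, m) = fmor D (0, n)" if "t \<in> hom K m n" for m n t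
      using F(4)[OF hK[of 0 m] that] hK'[OF that] by (simp add: K_def)
    show "l n \<cdot> fmor D (0, n) = l 0" for n using Lc[of 0 n] by simp
  qed
  have hD: "h n \<cdot> fmor D (m, n) = h m" if "m \<le> n" for m n
    using that
  proof (induction n rule: dec_induct)
    case base
    have "fmor D (m, m) = Ident C (X m)" using F(3)[of m] D(2) by (simp add: K_def)
    then show ?case using comp_ident[OF hh] by simp
  next
    case (step n)
    then show ?case
      using \<open>\<And>n m. m \<le> n \<Longrightarrow> fmor D (m, Suc n) = e n \<cdot> fmor D (m, n)\<close>[OF step(1)]
        triangle_ext[OF he eh hh Fh[OF step(1)]] by simp
  qed
  have "is_cocone K C D z h"
    unfolding K_def by (rule cocone_poset_catI) (use hh hD D(2) homD[OF f(2)] in auto)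
  then obtain q where q: "q \<in> hom C y z" "\<And>n. q \<cdot> l n = h n"
    using colimit_desc[OF l] unfolding K_def Obj_poset_cat by (metis UNIV_I)
  have qQ: "q \<in> Q"
  proof -
    have "has_lifting C i q" if i: "i \<in> I" for i
    proof (rule has_liftingI[OF hom_Mor q(1)])
      show "i \<in> Mor C" using i I(1) by blast
      note ih = hom_Mor[OF this]
      fix u v assume u: "u \<in> hom C (Dom C i) y" and v: "v \<in> hom C (Cod C i) z" and eq: "q \<cdot> u = v \<cdot> i"
      \<comment> \<open>Here countably many stages suffice: the top of the square factors through
        some \<open>X n\<close>, and the stage \<open>Suc n\<close> was built to solve precisely the
        squares into \<open>h n\<close>.\<close>
      have "fp (Dom C i)" using I(3)[OF i] by blast
      then obtain n u0 where u0: "u0 \<in> hom C (Dom C i) (X n)" "l n \<cdot> u0 = u"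
        using commutes_hom_factor[OF finitely_presentable_commutes[OF _ K DK l] u] D(2) by metis
      have "h n \<cdot> u0 = v \<cdot> i" using triangle_ext[OF q(2) L q(1) u0(1)] u0(2) eq by simp
      then obtain k where k: "k \<in> hom C (Cod C i) (X (Suc n))" "k \<cdot> i = e n \<cdot> u0" "h (Suc n) \<cdot> k = v"
        using st[of n] i u0(1) v unfolding St_def by blast
      have Lc': "l (Suc n) \<cdot> e n = l n" using Lc[of n "Suc n"] D(3) by simp
      have "(l (Suc n) \<cdot> k) \<cdot> i = u"
        using comp_assoc[OF ih k(1) L] k(2) triangle_ext[OF Lc' eh L u0(1)] u0(2) by simp
      moreover have "q \<cdot> (l (Suc n) \<cdot> k) = v" using triangle_ext[OF q(2) L q(1) k(1)] k(3) by simp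
      ultimately show "\<exists>k\<in>hom C (Cod C i) y. k \<cdot> i = u \<and> q \<cdot> k = v" using comp_hom[OF k(1) L] by blast
    qed
    then show ?thesis unfolding Q_def rlp_def using q(1) by (simp add: hom_def)
  qed
  have "q \<cdot> l 0 = f" using q(2)[of 0] X0 by simp
  have zI: "Ident C z \<in> hom C z z" using homD[OF f(2)] ident_hom by blast
  \<comment> \<open>Lifting \<open>f\<close> against \<open>q\<close>, in the square with top
    \<open>l 0\<close> and bottom the identity of \<open>z\<close>, gives the section
    \<open>r\<close> of \<open>q\<close> that exhibits the retract.\<close>
  obtain r where r: "r \<in> hom C z y" "r \<cdot> f = l 0" "q \<cdot> r = Ident C z"
    using has_liftingD[OF llpD[OF f(1)[folded Q_def] qQ] f(2) q(1) lx zI] \<open>q \<cdot> l 0 = f\<close> ident_comp[OF f(2)] by metis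
  show ?thesis
    unfolding Q_def[symmetric] by (rule approximable_retract[OF app q(1) r(1) f(2) r(2) \<open>q \<cdot> l 0 = f\<close> r(3)])
qed

end

section \<open>Weak equivalences as the maps approximable by small weak equivalences\<close>

section \<open>Weak equivalences and approximation\<close>

lemma fp_category_simps [simp]:
  "f \<in> hom (fp_category U C) a b \<longleftrightarrow>
     f \<in> hom C a b \<and> finitely_presentable U C a \<and> finitely_presentable U C b"
  "Comp (fp_category U C) = Comp C" "Ident (fp_category U C) = Ident C"
  "Obj (fp_category U C) = {x \<in> Obj C. finitely_presentable U C x}"
  by (auto simp: fp_category_def full_subcategory_def hom_def)

lemma (in category) coproduct_pushout:
  assumes s: "is_coproduct C a b s in0 in1" and z: "is_initial C z" and f: "f \<in> hom C z a" and g: "g \<in> hom C z b"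
  shows "pushout_square C z a b s f g in0 in1"
proof (rule pushout_squareI[OF f g coproductD[OF s]])
  note S = coproductD[OF s]
  have u: "k = k'" if "k \<in> hom C z x" "k' \<in> hom C z x" for k k' x
    using z that homD[OF that(1)] unfolding is_initial_def by blast
  show "in0 \<cdot> f = in1 \<cdot> g" by (rule u[OF comp_hom[OF f S(1)] comp_hom[OF g S(2)]])
  show "\<exists>h\<in>hom C s x. h \<cdot> in0 = i' \<and> h \<cdot> in1 = j'" if "i' \<in> hom C a x" "j' \<in> hom C b x" for x i' j'
    using coproduct_desc[OF s that] by metis
  show "h = h'" if "h \<in> hom C s x" "h' \<in> hom C s x" "h \<cdot> in0 = h' \<cdot> in0" "h \<cdot> in1 = h' \<cdot> in1" for x h h'
    by (rule coproduct_eqI[OF s that])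
qed

text \<open>The cylinder is given in the subcategory of finitely presentable objects, but is glued
  in the ambient category. The ambient coproduct of \<open>a\<close> and \<open>b\<close> is
  finitely presentable, so the two coproducts can be compared.\<close>

lemma (in lfp_category) coproduct_fp_category:
  assumes s: "is_coproduct (fp_category U C) a b s in0 in1"
  shows "is_coproduct C a b s in0 in1"
proof -
  have S: "in0 \<in> hom C a s" "in1 \<in> hom C b s" "fp a" "fp b" "fp s" using coproductD[OF s] by auto
  obtain t j0 j1 where t: "is_coproduct C a b t j0 j1" "fp t"
    using coproduct_exists[of a b] S(3,4) fp_Obj by metis
  note T = coproductD[OF t(1)]
  obtain \<phi> where \<phi>: "\<phi> \<in> hom C s t" "\<phi> \<cdot> in0 = j0" "\<phi> \<cdot> in1 = j1"
    using coproduct_desc[OF s, of j0 t j1] T S t(2) by auto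
  obtain \<psi> where \<psi>: "\<psi> \<in> hom C t s" "\<psi> \<cdot> j0 = in0" "\<psi> \<cdot> j1 = in1" using coproduct_desc[OF t(1) S(1,2)] .
  have sI: "Ident C s \<in> hom C s s" using ident_hom fp_Obj S(5) by blast
  have fpC: "category (fp_category U C)"
    unfolding fp_category_def by (rule category_full_subcategory) (rule category_axioms)
  \<comment> \<open>This one composite is enough: a map \<open>k\<close> out of \<open>s\<close>
    equals \<open>(k \<cdot> \<psi>) \<cdot> \<phi>\<close>, and \<open>k \<cdot> \<psi>\<close> is
    fixed by the ambient coproduct.\<close>
  have "\<psi> \<cdot> \<phi> = Ident C s"
  proof -
    have "(\<psi> \<cdot> \<phi>) \<cdot> in0 = Ident C s \<cdot> in0" "(\<psi> \<cdot> \<phi>) \<cdot> in1 = Ident C s \<cdot> in1"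
      using comp_assoc[OF S(1) \<phi>(1) \<psi>(1)] comp_assoc[OF S(2) \<phi>(1) \<psi>(1)] \<phi> \<psi> ident_comp[OF S(1)] ident_comp[OF S(2)]
      by simp_all
    then show ?thesis
      using category.coproduct_eqI[OF fpC s, of "\<psi> \<cdot> \<phi>" s "Ident C s"] comp_hom[OF \<phi>(1) \<psi>(1)] sI S(5) by simp
  qed
  note \<psi>\<phi> = this
  show ?thesis
    unfolding is_coproduct_def
  proof (intro conjI allI ballI)
    fix x f g assume f: "f \<in> hom C a x" and g: "g \<in> hom C b x"
    obtain h where h: "h \<in> hom C t x" "h \<cdot> j0 = f" "h \<cdot> j1 = g" using coproduct_desc[OF t(1) f g] .
    show "\<exists>!k. k \<in> hom C s x \<and> k \<cdot> in0 = f \<and> k \<cdot> in1 = g"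
    proof (rule ex1I[of _ "h \<cdot> \<phi>"])
      show "h \<cdot> \<phi> \<in> hom C s x \<and> (h \<cdot> \<phi>) \<cdot> in0 = f \<and> (h \<cdot> \<phi>) \<cdot> in1 = g"
        using comp_hom[OF \<phi>(1) h(1)] comp_assoc[OF S(1) \<phi>(1) h(1)] comp_assoc[OF S(2) \<phi>(1) h(1)] \<phi> h by simp
      fix k assume "k \<in> hom C s x \<and> k \<cdot> in0 = f \<and> k \<cdot> in1 = g"
      then have k: "k \<in> hom C s x" "k \<cdot> in0 = f" "k \<cdot> in1 = g" by auto
      have "k \<cdot> \<psi> = h"
        by (rule coproduct_eqI[OF t(1) comp_hom[OF \<psi>(1) k(1)] h(1)])
          (use comp_assoc[OF T(1) \<psi>(1) k(1)] comp_assoc[OF T(2) \<psi>(1) k(1)] \<psi> h k in simp_all)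
      then show "k = h \<cdot> \<phi>"
        using comp_assoc[OF \<phi>(1) \<psi>(1) k(1)] \<psi>\<phi> comp_ident[OF k(1)] by simp
    qed
  qed (fact S)+
qed

locale omega_model = lfp_category C U for C :: "('o, 'm) cat" (structure) and U :: "'u itself" +
  fixes W Fib Cof :: "'m set"
  assumes omega_combinatorial: "omega_combinatorial U C W Fib Cof"
    and left_proper: "left_proper C W Cof"
    and cylinder: "\<And>b. fp b \<Longrightarrow>
      \<exists>Ib i0 i1 p. is_cylinder (fp_category U C) (W \<inter> Mor (fp_category U C)) Cof b Ib i0 i1 p"
    and cofibrant: "\<And>b. fp b \<Longrightarrow> cofibrant C Cof b"
begin

lemma model: "model_category U C W Fib Cof"
  using omega_combinatorial unfolding omega_combinatorial_def by blast

lemma W_Mor: "W \<subseteq> Mor C"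
  using model unfolding model_category_def wide_subcategory_def by blast

lemma W_ident: "a \<in> Obj C \<Longrightarrow> Ident C a \<in> W"
  using model unfolding model_category_def wide_subcategory_def by blast

lemma W_two_out_of_three:
  assumes "f \<in> hom C a b" and "g \<in> hom C b c"
  shows "f \<in> W \<Longrightarrow> g \<in> W \<Longrightarrow> g \<cdot> f \<in> W"
    and "f \<in> W \<Longrightarrow> g \<cdot> f \<in> W \<Longrightarrow> g \<in> W"
    and "g \<in> W \<Longrightarrow> g \<cdot> f \<in> W \<Longrightarrow> f \<in> W"
  using model assms unfolding model_category_def two_out_of_three_def by blast+

lemma Cof_generators:
  obtains I where "small U I" and "I \<subseteq> Mor C" and "\<And>i. i \<in> I \<Longrightarrow> fp (Dom C i) \<and> fp (Cod C i)"
    and "Cof = llp C (rlp C I)"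
  using omega_combinatorial unfolding omega_combinatorial_def omega_generated_def by blast

lemma trivial_Cof_generators:
  obtains I where "small U I" and "I \<subseteq> Mor C" and "\<And>i. i \<in> I \<Longrightarrow> fp (Dom C i) \<and> fp (Cod C i)"
    and "Cof \<inter> W = llp C (rlp C I)"
  using omega_combinatorial unfolding omega_combinatorial_def omega_generated_def by blast

lemma Cof_comp:
  assumes "i \<in> Cof" and "i \<in> hom C a b" and "j \<in> Cof" and "j \<in> hom C b c"
  shows "j \<cdot> i \<in> Cof"
  using assms model unfolding model_category_def wide_subcategory_def hom_def by auto

text \<open>Cofibrations are given by generators as a left lifting class, and every such class is
  stable under cobase change; the same applies to trivial cofibrations.\<close>

lemma Cof_pushout:
  assumes "pushout_square C a b c s f g i j" and "f \<in> Cof"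
  shows "j \<in> Cof"
  using Cof_generators llp_pushout[OF rlp_Mor _ assms(1)] assms(2) by metis

lemma trivial_Cof_pushout:
  assumes "pushout_square C a b c s f g i j" and "f \<in> Cof \<inter> W"
  shows "j \<in> Cof \<inter> W"
  using trivial_Cof_generators llp_pushout[OF rlp_Mor _ assms(1)] assms(2) by metis

lemma inverse_arrows_trivial_Cof: "inverse_arrows C a b f g \<Longrightarrow> f \<in> Cof \<inter> W"
  using trivial_Cof_generators llp_inverse_arrows[OF rlp_Mor] by metis

lemma W_pushout:
  assumes "pushout_square C a b c s f g i j" and "f \<in> W" and "g \<in> Cof"
  shows "j \<in> W"
  using left_proper is_pushoutI[OF assms(1)] assms(2,3) unfolding left_proper_def by blast

lemma factorization:
  assumes "functorially_factors C L R" and f: "f \<in> hom C x y"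
  obtains z i q where "i \<in> hom C x z" and "i \<in> L" and "q \<in> hom C z y" and "q \<in> R" and "q \<cdot> i = f"
proof -
  obtain \<alpha> \<beta> where ab: "functorial_factorization C \<alpha> \<beta>" "\<forall>f\<in>Mor C. fobj \<alpha> f \<in> L \<and> fobj \<beta> f \<in> R"
    using assms(1) unfolding functorially_factors_def by blast
  have fM: "f \<in> Mor C" "Dom C f = x" "Cod C f = y" using f by (auto simp: hom_def)
  have o: "fobj \<alpha> f \<in> Mor C" "fobj \<beta> f \<in> Mor C"
    using ab(1) fM(1) unfolding functorial_factorization_def is_functor_def by (auto simp: arrow_category_def)
  have "Dom C (fobj \<alpha> f) = Dom C f \<and> Cod C (fobj \<alpha> f) = Dom C (fobj \<beta> f) \<and>
      Cod C (fobj \<beta> f) = Cod C f \<and> fobj \<beta> f \<cdot> fobj \<alpha> f = f"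
    using ab(1) fM(1) unfolding functorial_factorization_def by blast
  then show ?thesis
    using that[of "fobj \<alpha> f" "Cod C (fobj \<alpha> f)" "fobj \<beta> f"] ab(2) fM o by (simp add: hom_def)
qed

lemma Cof_factorization:
  assumes "f \<in> hom C x y"
  obtains z i q where "i \<in> hom C x z" and "i \<in> Cof" and "q \<in> hom C z y" and "q \<in> Fib \<inter> W" and "q \<cdot> i = f"
proof -
  have "functorially_factors C Cof (Fib \<inter> W)" using model unfolding model_category_def by blast
  from factorization[OF this assms] show ?thesis using that by metis
qed

lemma trivial_Cof_factorization:
  assumes "f \<in> hom C x y"
  obtains z i q where "i \<in> hom C x z" and "i \<in> Cof \<inter> W" and "q \<in> hom C z y" and "q \<in> Fib" and "q \<cdot> i = f"
proof -
  have "functorially_factors C (Cof \<inter> W) Fib" using model unfolding model_category_def by blast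
  from factorization[OF this assms] show ?thesis using that by metis
qed

lemma lift_Cof: "i \<in> Cof \<Longrightarrow> q \<in> Fib \<inter> W \<Longrightarrow> has_lifting C i q"
  and lift_trivial_Cof: "i \<in> Cof \<inter> W \<Longrightarrow> q \<in> Fib \<Longrightarrow> has_lifting C i q"
  using model unfolding model_category_def by blast+

text \<open>The retract argument: \<open>q\<close> is a retract of the trivial fibration in its factorization.\<close>

lemma rlp_Cof_W:
  assumes q: "q \<in> hom C x y" and lift: "\<And>i. i \<in> Cof \<Longrightarrow> has_lifting C i q"
  shows "q \<in> W"
proof -
  obtain z i p where i: "i \<in> hom C x z" "i \<in> Cof" and p: "p \<in> hom C z y" "p \<in> Fib \<inter> W" and pi: "p \<cdot> i = q"
    using Cof_factorization[OF q] .
  have xy: "x \<in> Obj C" "y \<in> Obj C" using homD[OF q] by auto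
  obtain h where h: "h \<in> hom C z x" "h \<cdot> i = Ident C x" "q \<cdot> h = p"
    using has_liftingD[OF lift[OF i(2)] i(1) q ident_hom[OF xy(1)] p(1)] pi comp_ident[OF q] by metis
  have "is_retract (arrow_category C) q p"
    unfolding is_retract_def
  proof (intro bexI)
    show "(q, p, i, Ident C y) \<in> hom (arrow_category C) q p"
      using q p(1) i(1) pi xy by (auto simp: arrow_category_def hom_def)
    show "(p, q, h, Ident C y) \<in> hom (arrow_category C) p q"
      using q p(1) h(1,3) xy by (auto simp: arrow_category_def hom_def)
    show "Comp (arrow_category C) (p, q, h, Ident C y) (q, p, i, Ident C y) = Ident (arrow_category C) q"
      using h(2) q xy by (simp add: arrow_category_def hom_def)
  qed
  then show ?thesis
    using model p(2) q unfolding model_category_def closed_under_retracts_def hom_def by blast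
qed

text \<open>Cofibrancy provides a cofibration from some initial object; any other one is isomorphic
  to it, and isomorphisms are cofibrations.\<close>

lemma initial_Cof:
  assumes z: "is_initial C z" and f: "f \<in> hom C z a" and a: "fp a"
  shows "f \<in> Cof"
proof -
  obtain z' f' where z': "is_initial C z'" "f' \<in> hom C z' a" "f' \<in> Cof"
    using cofibrant[OF a] unfolding cofibrant_def by blast
  have o: "z \<in> Obj C" "z' \<in> Obj C" using z z' unfolding is_initial_def by auto
  have u: "k = k'" if "k \<in> hom C z x" "k' \<in> hom C z x" for k k' x
    using z that homD[OF that(1)] unfolding is_initial_def by blast
  have u': "k = k'" if "k \<in> hom C z' x" "k' \<in> hom C z' x" for k k' x
    using z' that homD[OF that(1)] unfolding is_initial_def by blast
  obtain k k' where k: "k \<in> hom C z z'" "k' \<in> hom C z' z"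
    using z z' o unfolding is_initial_def by blast
  have "inverse_arrows C z z' k k'"
    unfolding inverse_arrows_def
    using k u[OF comp_hom[OF k] ident_hom[OF o(1)]] u'[OF comp_hom[OF k(2,1)] ident_hom[OF o(2)]] by blast
  then have "k \<in> Cof" using inverse_arrows_trivial_Cof by blast
  then have "f' \<cdot> k \<in> Cof" using Cof_comp k(1) z'(2,3) by blast
  then show ?thesis using u[OF f comp_hom[OF k(1) z'(2)]] by simp
qed

text \<open>The inclusion of \<open>a\<close> is the cobase change of the map from the initial
  object to \<open>b\<close>, which is a cofibration because \<open>b\<close> is cofibrant.\<close>

lemma coproduct_Cof:
  assumes s: "is_coproduct C a b s in0 in1" and a: "fp a" and b: "fp b"
  shows "in0 \<in> Cof"
proof -
  obtain z where z: "is_initial C z" using initial_exists by metis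
  obtain f g where fg: "f \<in> hom C z a" "g \<in> hom C z b"
    using z fp_Obj[OF a] fp_Obj[OF b] unfolding is_initial_def by blast
  show ?thesis
    by (rule Cof_pushout[OF pushout_sym[OF coproduct_pushout[OF s z fg]] initial_Cof[OF z fg(2) b]])
qed

text \<open>The factorization through the mapping cylinder of \<open>f\<close>.\<close>

lemma fp_factorization:
  assumes f: "f \<in> hom C a b" and a: "fp a" and b: "fp b"
  obtains m k e where "fp m" and "k \<in> hom C a m" and "k \<in> Cof" and "e \<in> hom C m b" and "e \<in> W" and "e \<cdot> k = f"
proof -
  obtain Ia i0 i1 p s in0 in1 d c where
    cyl: "is_coproduct (fp_category U C) a a s in0 in1" "d \<in> hom (fp_category U C) s a"
      "d \<cdot> in0 = Ident C a" "d \<cdot> in1 = Ident C a" "c \<in> hom (fp_category U C) s Ia" "c \<cdot> in0 = i0" "c \<cdot> in1 = i1"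
      "p \<in> hom (fp_category U C) Ia a" "p \<cdot> c = d" "c \<in> Cof" "p \<in> W"
    using cylinder[OF a] unfolding is_cylinder_def fp_category_simps(2,3) by blast
  have fps: "fp s" "fp Ia" using cyl by auto
  have d: "d \<in> hom C s a" and c: "c \<in> hom C s Ia" and p: "p \<in> hom C Ia a" using cyl by auto
  have s: "is_coproduct C a a s in0 in1" by (rule coproduct_fp_category[OF cyl(1)])
  note S = coproductD[OF s]
  have i0: "i0 \<in> hom C a Ia" and i1: "i1 \<in> hom C a Ia"
    using comp_hom[OF S(1) c] comp_hom[OF S(2) c] cyl(6,7) by auto
  \<comment> \<open>\<open>i0\<close> is the coproduct inclusion \<open>in0\<close> followed by
    \<open>c\<close>. Being also a section of the weak equivalence \<open>p\<close>, it is a trivial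
    cofibration.\<close>
  have i0C: "i0 \<in> Cof"
    using Cof_comp[OF coproduct_Cof[OF s a a] S(1) cyl(10) c] cyl(6) by simp
  have "p \<cdot> i0 = Ident C a" using triangle_ext[OF cyl(9) c p S(1)] cyl(3,6) by simp
  then have "i0 \<in> W" using W_two_out_of_three(3)[OF i0 p cyl(11)] W_ident fp_Obj[OF a] by simp
  with i0C have i0T: "i0 \<in> Cof \<inter> W" by blast
  obtain t j0 j1 where t: "is_coproduct C a b t j0 j1" "fp t"
    using coproduct_exists[of a b] a b fp_Obj by metis
  note T = coproductD[OF t(1)]
  \<comment> \<open>The end \<open>i0\<close> of the cylinder is glued to \<open>b\<close> along
    \<open>f\<close>, while the end \<open>i1\<close> stays free and becomes the copy of
    \<open>a\<close> in the mapping cylinder. Gluing both ends at once makes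
    \<open>a \<squnion> b \<rightarrow> m\<close> a cofibration.\<close>
  obtain k0 where k0: "k0 \<in> hom C s t" "k0 \<cdot> in0 = j1 \<cdot> f" "k0 \<cdot> in1 = j0"
    using coproduct_desc[OF s comp_hom[OF f T(2)] T(1)] .
  obtain m \<iota> \<kappa> where po: "pushout_square C s Ia t m c k0 \<iota> \<kappa>" using pushout_exists[OF c k0(1)] .
  note P = pushoutD[OF po]
  have bI: "Ident C b \<in> hom C b b" using ident_hom fp_Obj[OF b] by blast
  obtain \<tau> where \<tau>: "\<tau> \<in> hom C t b" "\<tau> \<cdot> j0 = f" "\<tau> \<cdot> j1 = Ident C b" using coproduct_desc[OF t(1) f bI] .
  note fp' = comp_hom[OF p f]
  have "(f \<cdot> p) \<cdot> c = \<tau> \<cdot> k0"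
  proof (rule coproduct_eqI[OF s comp_hom[OF c fp'] comp_hom[OF k0(1) \<tau>(1)]])
    have "((f \<cdot> p) \<cdot> c) \<cdot> x = f \<cdot> (d \<cdot> x)" if "x \<in> hom C a s" for x
      using comp_assoc[OF that c fp'] comp_assoc[OF comp_hom[OF that c] p f] triangle_ext[OF cyl(9) c p that] by simp
    then have *: "((f \<cdot> p) \<cdot> c) \<cdot> in0 = f" "((f \<cdot> p) \<cdot> c) \<cdot> in1 = f" using S cyl(3,4) comp_ident[OF f] by auto
    show "((f \<cdot> p) \<cdot> c) \<cdot> in0 = (\<tau> \<cdot> k0) \<cdot> in0"
      using * comp_assoc[OF S(1) k0(1) \<tau>(1)] k0(2) triangle_ext[OF \<tau>(3) T(2) \<tau>(1) f] ident_comp[OF f] by simp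
    show "((f \<cdot> p) \<cdot> c) \<cdot> in1 = (\<tau> \<cdot> k0) \<cdot> in1"
      using * comp_assoc[OF S(2) k0(1) \<tau>(1)] k0(3) \<tau>(2) by simp
  qed
  then obtain e where e: "e \<in> hom C m b" "e \<cdot> \<iota> = f \<cdot> p" "e \<cdot> \<kappa> = \<tau>" using pushout_desc[OF po fp' \<tau>(1)] by blast
  have kj: "\<kappa> \<cdot> j1 \<in> hom C b m" "\<kappa> \<cdot> j0 \<in> hom C a m" using comp_hom[OF T(2) P(4)] comp_hom[OF T(1) P(4)] by auto
  \<comment> \<open>The same object \<open>m\<close> is also the pushout of \<open>i0\<close> along
    \<open>f\<close> alone. So \<open>b \<rightarrow> m\<close> is a trivial cofibration, and its
    retraction \<open>e\<close> is a weak equivalence.\<close>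
  have po': "pushout_square C a Ia b m i0 f \<iota> (\<kappa> \<cdot> j1)"
  proof (rule pushout_squareI[OF i0 f P(3) kj(1)])
    show "\<iota> \<cdot> i0 = (\<kappa> \<cdot> j1) \<cdot> f"
      using square_ext[OF P(5) c P(3) k0(1) P(4) S(1)] cyl(6) k0(2) comp_assoc[OF f T(2) P(4)] by simp
  next
    fix x u v assume u: "u \<in> hom C Ia x" and v: "v \<in> hom C b x" and uv: "u \<cdot> i0 = v \<cdot> f"
    obtain r where r: "r \<in> hom C t x" "r \<cdot> j0 = u \<cdot> i1" "r \<cdot> j1 = v" using coproduct_desc[OF t(1) comp_hom[OF i1 u] v] .
    have "u \<cdot> c = r \<cdot> k0"
      by (rule coproduct_eqI[OF s comp_hom[OF c u] comp_hom[OF k0(1) r(1)]])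
        (use comp_assoc[OF S(1) c u] comp_assoc[OF S(2) c u] comp_assoc[OF S(1) k0(1) r(1)] comp_assoc[OF S(2) k0(1) r(1)]
          cyl(6,7) k0(2,3) r(2) triangle_ext[OF r(3) T(2) r(1) f] uv in simp_all)
    then obtain h where h: "h \<in> hom C m x" "h \<cdot> \<iota> = u" "h \<cdot> \<kappa> = r" using pushout_desc[OF po u r(1)] by blast
    then show "\<exists>h\<in>hom C m x. h \<cdot> \<iota> = u \<and> h \<cdot> (\<kappa> \<cdot> j1) = v"
      using triangle_ext[OF h(3) P(4) h(1) T(2)] r(3) by auto
  next
    fix x h h' assume h: "h \<in> hom C m x" "h' \<in> hom C m x" "h \<cdot> \<iota> = h' \<cdot> \<iota>" "h \<cdot> (\<kappa> \<cdot> j1) = h' \<cdot> (\<kappa> \<cdot> j1)"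
    have k: "\<kappa> \<cdot> j0 = \<iota> \<cdot> i1" using square_ext[OF P(5) c P(3) k0(1) P(4) S(2)] cyl(7) k0(3) by simp
    show "h = h'"
    proof (rule pushout_eqI[OF po h(1-3)])
      show "h \<cdot> \<kappa> = h' \<cdot> \<kappa>"
        by (rule coproduct_eqI[OF t(1) comp_hom[OF P(4) h(1)] comp_hom[OF P(4) h(2)]])
          (use comp_assoc[OF T(1) P(4) h(1)] comp_assoc[OF T(1) P(4) h(2)] comp_assoc[OF T(2) P(4) h(1)]
            comp_assoc[OF T(2) P(4) h(2)] h(4) k square_ext[OF h(3) P(3) h(1) P(3) h(2) i1] in simp_all)
    qed
  qed
  have "\<kappa> \<cdot> j1 \<in> W" using trivial_Cof_pushout[OF po' i0T] by blast
  moreover have "e \<cdot> (\<kappa> \<cdot> j1) = Ident C b" using triangle_ext[OF e(3) P(4) e(1) T(2)] \<tau>(3) by simp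
  ultimately have eW: "e \<in> W" using W_two_out_of_three(2)[OF kj(1) e(1)] W_ident fp_Obj[OF b] by simp
  have kC: "\<kappa> \<cdot> j0 \<in> Cof"
    by (rule Cof_comp[OF coproduct_Cof[OF t(1) a b] T(1) Cof_pushout[OF po cyl(10)] P(4)])
  have "e \<cdot> (\<kappa> \<cdot> j0) = f" using triangle_ext[OF e(3) P(4) e(1) T(1)] \<tau>(2) by simp
  then show ?thesis using that[OF fp_pushout[OF po fps t(2)] kj(2) kC e(1) eW] by blast
qed

definition fpW :: "'m set" where
  "fpW = {w \<in> W. fp (Dom C w) \<and> fp (Cod C w)}"

lemma fpWI: "w \<in> W \<Longrightarrow> w \<in> hom C a b \<Longrightarrow> fp a \<Longrightarrow> fp b \<Longrightarrow> w \<in> fpW"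
  unfolding fpW_def hom_def by blast

lemma fpWD: "w \<in> fpW \<Longrightarrow> w \<in> hom C a b \<Longrightarrow> w \<in> W \<and> fp a \<and> fp b"
  unfolding fpW_def hom_def by blast

definition fpTC :: "'m set" where
  "fpTC = {w \<in> Cof \<inter> W. fp (Dom C w) \<and> fp (Cod C w)}"

text \<open>The small object argument applied to the generators of the trivial cofibrations; the
  small members of that left class are exactly \<open>fpTC\<close>.\<close>

lemma trivial_Cof_approximable:
  assumes "i \<in> Cof \<inter> W" and "i \<in> hom C x y"
  shows "approximable fpTC x y i"
proof -
  obtain I where I: "small U I" "I \<subseteq> Mor C" "\<And>i. i \<in> I \<Longrightarrow> fp (Dom C i) \<and> fp (Cod C i)"
    and eq: "Cof \<inter> W = llp C (rlp C I)"
    using trivial_Cof_generators by metis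
  have "approximable (fp_llp (rlp C I)) x y i"
    by (rule llp_rlp_approximable[OF I(2,1,3)]) (use assms eq in auto)
  moreover have "fpTC = fp_llp (rlp C I)" unfolding fpTC_def fp_llp_def eq ..
  ultimately show ?thesis by simp
qed

lemma fpTCD: "w \<in> fpTC \<Longrightarrow> w \<in> hom C a b \<Longrightarrow> w \<in> Cof \<inter> W \<and> fp a \<and> fp b"
  unfolding fpTC_def hom_def by blast

text \<open>Let \<open>k\<close> and \<open>e\<close> factor \<open>a\<close> through its mapping
  cylinder \<open>m\<close>. Lifting \<open>k\<close> against \<open>q\<close> turns the given
  square into one from \<open>k\<close> to \<open>i\<close>, which is approximated by
  \<open>w1\<close>. To return from \<open>m\<close> to \<open>B\<close>, the codomain has to be
  pushed out along \<open>e\<close>; for the result to be a weak equivalence, the map out of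
  \<open>m\<close> must first be made a cofibration, compatibly with the domain side.\<close>

proposition weak_equivalence_approximable:
  assumes f: "f \<in> W" "f \<in> hom C x y"
  shows "approximable fpW x y f"
proof (rule approximableI[OF f(2)])
  obtain z i q where i: "i \<in> hom C x z" "i \<in> Cof \<inter> W" and q: "q \<in> hom C z y" "q \<in> Fib" and qi: "q \<cdot> i = f"
    using trivial_Cof_factorization[OF f(2)] .
  have "q \<in> W" using W_two_out_of_three(2)[OF i(1) q(1)] i(2) f(1) qi by blast
  then have qT: "q \<in> Fib \<inter> W" using q(2) by blast
  fix A B a u v
  assume A: "fp A" and B: "fp B" and a: "a \<in> hom C A B" and u: "u \<in> hom C A x" and v: "v \<in> hom C B y"
    and eq: "f \<cdot> u = v \<cdot> a"
  obtain m k e where m: "fp m" and k: "k \<in> hom C A m" "k \<in> Cof" and e: "e \<in> hom C m B" "e \<in> W" and ek: "e \<cdot> k = a"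
    using fp_factorization[OF a A B] .
  have "q \<cdot> (i \<cdot> u) = (v \<cdot> e) \<cdot> k"
    using triangle_ext[OF qi i(1) q(1) u] comp_assoc[OF k(1) e(1) v] ek eq by simp
  then obtain l where l: "l \<in> hom C m z" "l \<cdot> k = i \<cdot> u" "q \<cdot> l = v \<cdot> e"
    using has_liftingD[OF lift_Cof[OF k(2) qT] k(1) q(1) comp_hom[OF u i(1)] comp_hom[OF e(1) v]] by blast
  obtain A1 B1 w1 s1 t1 u1 v1 where 1: "w1 \<in> fpTC" "w1 \<in> hom C A1 B1" "s1 \<in> hom C A A1" "t1 \<in> hom C m B1"
    "u1 \<in> hom C A1 x" "v1 \<in> hom C B1 z" and e1: "w1 \<cdot> s1 = t1 \<cdot> k" "i \<cdot> u1 = v1 \<cdot> w1" "u1 \<cdot> s1 = u" "v1 \<cdot> t1 = l"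
    using approximableE[OF trivial_Cof_approximable[OF i(2,1)] A m k(1) u l(1) l(2)[symmetric]] .
  have w1: "w1 \<in> W" "fp A1" "fp B1" using fpTCD[OF 1(1,2)] by auto
  \<comment> \<open>\<open>s1\<close> is replaced by a cofibration \<open>k2\<close>, so that
    \<open>m \<rightarrow> N\<close> below is one as well. The price is the weak equivalence
    \<open>e2\<close>, absorbed by replacing \<open>w1\<close> with
    \<open>w1 \<cdot> e2\<close>.\<close>
  obtain A2 k2 e2 where A2: "fp A2" and k2: "k2 \<in> hom C A A2" "k2 \<in> Cof" and e2: "e2 \<in> hom C A2 A1" "e2 \<in> W"
    and ek2: "e2 \<cdot> k2 = s1"
    using fp_factorization[OF 1(3) A w1(2)] .
  have w2: "w1 \<cdot> e2 \<in> hom C A2 B1" "w1 \<cdot> e2 \<in> W"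
    using comp_hom[OF e2(1) 1(2)] W_two_out_of_three(1)[OF e2(1) 1(2) e2(2) w1(1)] by auto
  obtain N \<alpha> \<beta> where po: "pushout_square C A A2 m N k2 k \<alpha> \<beta>" using pushout_exists[OF k2(1) k(1)] .
  note P = pushoutD[OF po]
  have "(w1 \<cdot> e2) \<cdot> k2 = t1 \<cdot> k" using comp_assoc[OF k2(1) e2(1) 1(2)] ek2 e1(1) by simp
  then obtain n where n: "n \<in> hom C N B1" "n \<cdot> \<alpha> = w1 \<cdot> e2" "n \<cdot> \<beta> = t1"
    using pushout_desc[OF po w2(1) 1(4)] by blast
  have N: "fp N" by (rule fp_pushout[OF po A A2 m])
  \<comment> \<open>Factoring the map out of \<open>N\<close>, rather than \<open>t1\<close> itself,
    keeps a compatible map from \<open>A2\<close> to \<open>N'\<close>; it is a weak equivalence by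
    two out of three against \<open>e3\<close> and \<open>w1 \<cdot> e2\<close>.\<close>
  obtain N' k3 e3 where N': "fp N'" and k3: "k3 \<in> hom C N N'" "k3 \<in> Cof" and e3: "e3 \<in> hom C N' B1" "e3 \<in> W"
    and ek3: "e3 \<cdot> k3 = n"
    using fp_factorization[OF n(1) N w1(3)] .
  have \<gamma>: "k3 \<cdot> \<beta> \<in> hom C m N'" "k3 \<cdot> \<beta> \<in> Cof"
    using comp_hom[OF P(4) k3(1)] Cof_comp[OF Cof_pushout[OF po k2(2)] P(4) k3(2,1)] by auto
  \<comment> \<open>Left properness: \<open>e\<close> is a weak equivalence and
    \<open>k3 \<cdot> \<beta>\<close> a cofibration, so \<open>j'\<close> is a weak equivalence. The
    map from \<open>B'\<close> to \<open>y\<close> is glued from \<open>v\<close> and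
    \<open>q \<cdot> (v1 \<cdot> e3)\<close>.\<close>
  obtain B' i' j' where po2: "pushout_square C m B N' B' e (k3 \<cdot> \<beta>) i' j'" using pushout_exists[OF e(1) \<gamma>(1)] .
  note P2 = pushoutD[OF po2]
  have B': "fp B'" by (rule fp_pushout[OF po2 m B N'])
  have j': "j' \<in> W" by (rule W_pushout[OF po2 e(2) \<gamma>(2)])
  have ka: "k3 \<cdot> \<alpha> \<in> hom C A2 N'" using comp_hom[OF P(3) k3(1)] .
  have eka: "e3 \<cdot> (k3 \<cdot> \<alpha>) = w1 \<cdot> e2" using triangle_ext[OF ek3 k3(1) e3(1) P(3)] n(2) by simp
  have "k3 \<cdot> \<alpha> \<in> W" using W_two_out_of_three(3)[OF ka e3(1) e3(2)] eka w2(2) by simp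
  then have wW: "j' \<cdot> (k3 \<cdot> \<alpha>) \<in> W" using W_two_out_of_three(1)[OF ka P2(4)] j' by blast
  note wh = comp_hom[OF ka P2(4)]
  have qv: "q \<cdot> (v1 \<cdot> e3) \<in> hom C N' y" using comp_hom[OF comp_hom[OF e3(1) 1(6)] q(1)] .
  have ekb: "e3 \<cdot> (k3 \<cdot> \<beta>) = t1" using triangle_ext[OF ek3 k3(1) e3(1) P(4)] n(3) by simp
  have qve: "(q \<cdot> (v1 \<cdot> e3)) \<cdot> r = q \<cdot> (v1 \<cdot> (e3 \<cdot> r))" if "r \<in> hom C R N'" for r R
    using comp_assoc[OF that comp_hom[OF e3(1) 1(6)] q(1)] comp_assoc[OF that e3(1) 1(6)] by simp
  have "v \<cdot> e = (q \<cdot> (v1 \<cdot> e3)) \<cdot> (k3 \<cdot> \<beta>)"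
    unfolding qve[OF \<gamma>(1)] ekb e1(4) l(3) ..
  then obtain v' where v': "v' \<in> hom C B' y" "v' \<cdot> i' = v" "v' \<cdot> j' = q \<cdot> (v1 \<cdot> e3)"
    using pushout_desc[OF po2 v qv] by blast
  show "approximates fpW x y f A B a u v"
  proof (rule approximatesI[OF fpWI[OF wW wh A2 B'] wh k2(1) P2(3) comp_hom[OF e2(1) 1(5)] v'(1) _ _ _ v'(2)])
    have "(j' \<cdot> (k3 \<cdot> \<alpha>)) \<cdot> k2 = j' \<cdot> (k3 \<cdot> (\<alpha> \<cdot> k2))"
      using comp_assoc[OF k2(1) ka P2(4)] comp_assoc[OF k2(1) P(3) k3(1)] by simp
    also have "\<dots> = j' \<cdot> ((k3 \<cdot> \<beta>) \<cdot> k)" unfolding P(5) using comp_assoc[OF k(1) P(4) k3(1)] by simp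
    also have "\<dots> = i' \<cdot> (e \<cdot> k)" using square_ext[OF P2(5,1,3,2,4) k(1)] by simp
    finally show "(j' \<cdot> (k3 \<cdot> \<alpha>)) \<cdot> k2 = i' \<cdot> a" unfolding ek .
    have "f \<cdot> (u1 \<cdot> e2) = q \<cdot> ((i \<cdot> u1) \<cdot> e2)"
      using comp_assoc[OF comp_hom[OF e2(1) 1(5)] i(1) q(1)] qi comp_assoc[OF e2(1) 1(5) i(1)] by simp
    also have "\<dots> = q \<cdot> (v1 \<cdot> (w1 \<cdot> e2))" unfolding e1(2) using comp_assoc[OF e2(1) 1(2) 1(6)] by simp
    also have "\<dots> = v' \<cdot> (j' \<cdot> (k3 \<cdot> \<alpha>))" using triangle_ext[OF v'(3) P2(4) v'(1) ka] qve[OF ka] eka by simp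
    finally show "f \<cdot> (u1 \<cdot> e2) = v' \<cdot> (j' \<cdot> (k3 \<cdot> \<alpha>))" .
    show "(u1 \<cdot> e2) \<cdot> k2 = u" using comp_assoc[OF k2(1) e2(1) 1(5)] ek2 e1(3) by simp
  qed
qed

text \<open>With \<open>f = q \<cdot> i\<close>, it suffices that \<open>q\<close> lifts against the
  generating cofibrations. The mismatch is that approximations of \<open>f\<close> have domains over
  \<open>x\<close>, while a lifting problem for \<open>q\<close> starts in \<open>z\<close>. An
  approximation of \<open>i\<close> bridges it: it carries the problem to an object
  \<open>B1\<close> over \<open>z\<close> with a trivial cofibration \<open>w1\<close> from an
  object \<open>A1\<close> over \<open>x\<close>.\<close>

proposition approximable_weak_equivalence:
  assumes f: "approximable fpW x y f"
  shows "f \<in> W"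
proof -
  have fh: "f \<in> hom C x y" using approximable_hom[OF f] .
  obtain z i q where i: "i \<in> hom C x z" "i \<in> Cof \<inter> W" and q: "q \<in> hom C z y" "q \<in> Fib" and qi: "q \<cdot> i = f"
    using trivial_Cof_factorization[OF fh] .
  obtain I where I: "I \<subseteq> Mor C" "\<And>i. i \<in> I \<Longrightarrow> fp (Dom C i) \<and> fp (Cod C i)" and CI: "Cof = llp C (rlp C I)"
    using Cof_generators by metis
  have lift: "has_lifting C g q" if gI: "g \<in> I" for g
  proof -
    define A where "A = Dom C g"
    define B where "B = Cod C g"
    have g: "g \<in> hom C A B" using I(1) gI hom_Mor unfolding A_def B_def by blast
    have A: "fp A" and B: "fp B" using I(2)[OF gI] unfolding A_def B_def by auto
    have gC: "g \<in> Cof" unfolding CI using llp_rlp_generator[OF I(1) gI] .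
    show ?thesis
    proof (rule has_liftingI[OF g q(1)])
      fix u v assume u: "u \<in> hom C A z" and v: "v \<in> hom C B y" and eq: "q \<cdot> u = v \<cdot> g"
      obtain o0 where o0: "is_initial C o0" "fp o0" using initial_exists .
      have o_eq: "k = k'" if "k \<in> hom C o0 x" "k' \<in> hom C o0 x" for k k' x
        using o0(1) that homD[OF that(1)] unfolding is_initial_def by blast
      have "x \<in> Obj C" using homD[OF i(1)] by blast
      then obtain oA ox where oA: "oA \<in> hom C o0 A" and ox: "ox \<in> hom C o0 x"
        using o0(1) fp_Obj[OF A] unfolding is_initial_def by blast
      \<comment> \<open>The initial object is taken as domain of the square, so that approximating
        \<open>i\<close> just factors \<open>u\<close> through the codomain of a small trivial
        cofibration.\<close>
      obtain A1 B1 w1 s1 t1 u1 v1 where 1: "w1 \<in> fpTC" "w1 \<in> hom C A1 B1" "t1 \<in> hom C A B1"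
        "u1 \<in> hom C A1 x" "v1 \<in> hom C B1 z" and e1: "i \<cdot> u1 = v1 \<cdot> w1" "v1 \<cdot> t1 = u"
        using approximableE[OF trivial_Cof_approximable[OF i(2,1)] o0(2) A oA ox u
            o_eq[OF comp_hom[OF ox i(1)] comp_hom[OF oA u]]] by metis
      have w1: "w1 \<in> Cof \<inter> W" "fp A1" "fp B1" using fpTCD[OF 1(1,2)] by auto
      \<comment> \<open>\<open>D\<close> contains the whole lifting problem after the factorization
        of \<open>u\<close>; it lies over \<open>y\<close>, and \<open>A1\<close> maps to it over
        \<open>f\<close>, which gives a square to approximate.\<close>
      obtain D \<delta>1 \<delta>2 where po: "pushout_square C A B1 B D t1 g \<delta>1 \<delta>2" using pushout_exists[OF 1(3) g] .
      note P = pushoutD[OF po]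
      have D: "fp D" by (rule fp_pushout[OF po A w1(3) B])
      note qv1 = comp_hom[OF 1(5) q(1)]
      have "(q \<cdot> v1) \<cdot> t1 = v \<cdot> g" using comp_assoc[OF 1(3,5) q(1)] e1(2) eq by simp
      then obtain \<rho> where \<rho>: "\<rho> \<in> hom C D y" "\<rho> \<cdot> \<delta>1 = q \<cdot> v1" "\<rho> \<cdot> \<delta>2 = v" using pushout_desc[OF po qv1 v] by blast
      have "f \<cdot> u1 = \<rho> \<cdot> (\<delta>1 \<cdot> w1)"
        using comp_assoc[OF 1(4) i(1) q(1)] qi e1(1) triangle_ext[OF \<rho>(2) P(3) \<rho>(1) 1(2)] comp_assoc[OF 1(2,5) q(1)] by simp
      from approximableE[OF f w1(2) D comp_hom[OF 1(2) P(3)] 1(4) \<rho>(1) this]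
      obtain A2 D2 w2 s2 t2 u2 v2 where 2: "w2 \<in> fpW" "w2 \<in> hom C A2 D2" "s2 \<in> hom C A1 A2" "t2 \<in> hom C D D2"
        "u2 \<in> hom C A2 x" "v2 \<in> hom C D2 y" and e2: "w2 \<cdot> s2 = t2 \<cdot> (\<delta>1 \<cdot> w1)" "f \<cdot> u2 = v2 \<cdot> w2" "u2 \<cdot> s2 = u1" "v2 \<cdot> t2 = \<rho>" .
      have w2: "w2 \<in> W" using fpWD[OF 2(1,2)] by blast
      \<comment> \<open>\<open>E\<close> joins \<open>B1\<close> to the new domain \<open>A2\<close>
        and still maps to \<open>z\<close>. As a cobase change of the trivial cofibration
        \<open>w1\<close>, the map \<open>\<epsilon>2\<close> is a weak equivalence, so
        \<open>\<theta>\<close> is one by two out of three with \<open>w2\<close>.\<close>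
      obtain E \<epsilon>1 \<epsilon>2 where poE: "pushout_square C A1 B1 A2 E w1 s2 \<epsilon>1 \<epsilon>2" using pushout_exists[OF 1(2) 2(3)] .
      note PE = pushoutD[OF poE]
      have e2W: "\<epsilon>2 \<in> W" using trivial_Cof_pushout[OF poE w1(1)] by blast
      note td = comp_hom[OF P(3) 2(4)]
      have "(t2 \<cdot> \<delta>1) \<cdot> w1 = w2 \<cdot> s2" using comp_assoc[OF 1(2) P(3) 2(4)] e2(1) by simp
      then obtain \<theta> where \<theta>: "\<theta> \<in> hom C E D2" "\<theta> \<cdot> \<epsilon>1 = t2 \<cdot> \<delta>1" "\<theta> \<cdot> \<epsilon>2 = w2" using pushout_desc[OF poE td 2(2)] by blast
      have \<theta>W: "\<theta> \<in> W" using W_two_out_of_three(2)[OF PE(4) \<theta>(1) e2W] \<theta>(3) w2 by simp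
      have "v1 \<cdot> w1 = (i \<cdot> u2) \<cdot> s2" using comp_assoc[OF 2(3,5) i(1)] e2(3) e1(1) by simp
      then obtain \<zeta> where \<zeta>: "\<zeta> \<in> hom C E z" "\<zeta> \<cdot> \<epsilon>1 = v1" "\<zeta> \<cdot> \<epsilon>2 = i \<cdot> u2"
        using pushout_desc[OF poE 1(5) comp_hom[OF 2(5) i(1)]] by blast
      have q\<zeta>: "q \<cdot> \<zeta> = v2 \<cdot> \<theta>"
      proof (rule pushout_eqI[OF poE comp_hom[OF \<zeta>(1) q(1)] comp_hom[OF \<theta>(1) 2(6)]])
        show "(q \<cdot> \<zeta>) \<cdot> \<epsilon>1 = (v2 \<cdot> \<theta>) \<cdot> \<epsilon>1"
          using comp_assoc[OF PE(3) \<zeta>(1) q(1)] \<zeta>(2) comp_assoc[OF PE(3) \<theta>(1) 2(6)] \<theta>(2)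
            triangle_ext[OF e2(4) 2(4,6) P(3)] \<rho>(2) by simp
        show "(q \<cdot> \<zeta>) \<cdot> \<epsilon>2 = (v2 \<cdot> \<theta>) \<cdot> \<epsilon>2"
          using comp_assoc[OF PE(4) \<zeta>(1) q(1)] \<zeta>(3) comp_assoc[OF PE(4) \<theta>(1) 2(6)] \<theta>(3)
            triangle_ext[OF qi i(1) q(1) 2(5)] e2(2) by simp
      qed
      \<comment> \<open>The two halves of \<open>\<theta>\<close> play different parts:
        \<open>a\<close>, a trivial cofibration, lifts against the fibration \<open>q\<close>, while
        \<open>g\<close> lifts against the trivial fibration \<open>b\<close>. The composite of the
        two lifts solves the original problem.\<close>
      obtain R a b where a: "a \<in> hom C E R" "a \<in> Cof" and b: "b \<in> hom C R D2" "b \<in> Fib \<inter> W" and ba: "b \<cdot> a = \<theta>"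
        using Cof_factorization[OF \<theta>(1)] .
      have "a \<in> W" using W_two_out_of_three(3)[OF a(1) b(1)] b(2) ba \<theta>W by blast
      then have aT: "a \<in> Cof \<inter> W" using a(2) by blast
      have "q \<cdot> \<zeta> = (v2 \<cdot> b) \<cdot> a" using q\<zeta> ba comp_assoc[OF a(1) b(1) 2(6)] by simp
      then obtain l where l: "l \<in> hom C R z" "l \<cdot> a = \<zeta>" "q \<cdot> l = v2 \<cdot> b"
        using has_liftingD[OF lift_trivial_Cof[OF aT q(2)] a(1) q(1) \<zeta>(1) comp_hom[OF b(1) 2(6)]] by blast
      have et: "\<epsilon>1 \<cdot> t1 \<in> hom C A E" using comp_hom[OF 1(3) PE(3)] .
      have "b \<cdot> (a \<cdot> (\<epsilon>1 \<cdot> t1)) = (t2 \<cdot> \<delta>2) \<cdot> g"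
        using triangle_ext[OF ba a(1) b(1) et] triangle_ext[OF \<theta>(2) PE(3) \<theta>(1) 1(3)] comp_assoc[OF 1(3) P(3) 2(4)] P(5)
          comp_assoc[OF g P(4) 2(4)] by simp
      then obtain \<mu> where \<mu>: "\<mu> \<in> hom C B R" "\<mu> \<cdot> g = a \<cdot> (\<epsilon>1 \<cdot> t1)" "b \<cdot> \<mu> = t2 \<cdot> \<delta>2"
        using has_liftingD[OF lift_Cof[OF gC b(2)] g b(1) comp_hom[OF et a(1)] comp_hom[OF P(4) 2(4)]] by blast
      have "(l \<cdot> \<mu>) \<cdot> g = u"
        using comp_assoc[OF g \<mu>(1) l(1)] \<mu>(2) triangle_ext[OF l(2) a(1) l(1) et] triangle_ext[OF \<zeta>(2) PE(3) \<zeta>(1) 1(3)] e1(2)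
        by simp
      moreover have "q \<cdot> (l \<cdot> \<mu>) = v"
        using square_ext[OF l(3,1) q(1) b(1) 2(6) \<mu>(1)] \<mu>(3) triangle_ext[OF e2(4) 2(4,6) P(4)] \<rho>(3) by simp
      ultimately show "\<exists>h\<in>hom C B z. h \<cdot> g = u \<and> q \<cdot> h = v" using comp_hom[OF \<mu>(1) l(1)] by blast
    qed
  qed
  have "q \<in> rlp C I" unfolding rlp_def using lift q(1) by (simp add: hom_def)
  then have "q \<in> W" using rlp_Cof_W[OF q(1)] CI llpD by blast
  then show ?thesis using W_two_out_of_three(1)[OF i(1) q(1)] i(2) qi by blast
qed

end

section \<open>Filtered colimits and finitely presentable objects among weak equivalences\<close>

section \<open>The category of weak equivalences\<close>

text \<open>Finite presentability must be checked on an arbitrary colimit, while the computation is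
  done on the componentwise one; the comparison isomorphism transfers the result.\<close>

lemma (in category) commutes_hom_colimit_cong:
  assumes J: "category J" and D: "is_functor J C D" and c: "is_colimit J C D c l" and c': "is_colimit J C D c' l'"
    and comm: "commutes_hom J C D c l x"
  shows "commutes_hom J C D c' l' x"
proof -
  note L = coconeD[OF colimit_cocone[OF c]] and L' = coconeD[OF colimit_cocone[OF c']]
  obtain h where h: "h \<in> hom C c c'" "\<And>j. j \<in> Obj J \<Longrightarrow> h \<cdot> l j = l' j"
    using colimit_desc[OF c colimit_cocone[OF c']] by metis
  obtain k where k: "k \<in> hom C c' c" "\<And>j. j \<in> Obj J \<Longrightarrow> k \<cdot> l' j = l j"
    using colimit_desc[OF c' colimit_cocone[OF c]] by metis
  have hk: "h \<cdot> k = Ident C c'"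
  proof (rule colimit_eqI[OF c' J D comp_hom[OF k(1) h(1)] ident_hom[OF L'(1)]])
    fix j assume j: "j \<in> Obj J"
    show "(h \<cdot> k) \<cdot> l' j = Ident C c' \<cdot> l' j"
      using comp_assoc[OF L'(2)[OF j] k(1) h(1)] k(2)[OF j] h(2)[OF j] ident_comp[OF L'(2)[OF j]] by simp
  qed
  show ?thesis
    unfolding commutes_hom_def
  proof (intro conjI ballI impI)
    fix g assume g: "g \<in> hom C x c'"
    obtain j g' where j: "j \<in> Obj J" "g' \<in> hom C x (fobj D j)" "l j \<cdot> g' = k \<cdot> g"
      using commutes_hom_factor[OF comm comp_hom[OF g k(1)]] .
    have "l' j \<cdot> g' = g"
      using triangle_ext[OF h(2)[OF j(1)] L(2)[OF j(1)] h(1) j(2)] j(3) triangle_ext[OF hk k(1) h(1) g] ident_comp[OF g]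
      by simp
    then show "\<exists>j\<in>Obj J. \<exists>g'\<in>hom C x (fobj D j). l' j \<cdot> g' = g" using j by blast
  next
    fix j g g' assume j: "j \<in> Obj J" and g: "g \<in> hom C x (fobj D j)" "g' \<in> hom C x (fobj D j)"
      and eq: "l' j \<cdot> g = l' j \<cdot> g'"
    have "l j \<cdot> g = l j \<cdot> g'"
      using triangle_ext[OF k(2)[OF j] L'(2)[OF j] k(1) g(1)] triangle_ext[OF k(2)[OF j] L'(2)[OF j] k(1) g(2)] eq by simp
    then show "\<exists>k. \<exists>u\<in>hom J j k. fmor D u \<cdot> g = fmor D u \<cdot> g'" using commutes_hom_eq[OF comm j g] by blast
  qed
qed

abbreviation (input) weq_category :: "('o, 'm) cat \<Rightarrow> 'm set \<Rightarrow> ('m, 'm \<times> 'm \<times> 'm \<times> 'm) cat" where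
  "weq_category C W \<equiv> full_subcategory (arrow_category C) W"

lemma hom_weq_category:
  "m \<in> hom (weq_category C W) f g \<longleftrightarrow> (\<exists>u v. m = (f, g, u, v) \<and> f \<in> W \<and> g \<in> W \<and> f \<in> Mor C \<and> g \<in> Mor C \<and>
     u \<in> hom C (Dom C f) (Dom C g) \<and> v \<in> hom C (Cod C f) (Cod C g) \<and> g \<cdot>\<^bsub>C\<^esub> u = v \<cdot>\<^bsub>C\<^esub> f)"
  unfolding hom_def[of "weq_category C W"] by (auto simp: full_subcategory_def arrow_category_def)

lemma weq_category_simps [simp]:
  "Obj (weq_category C W) = Mor C \<inter> W"
  "Ident (weq_category C W) f = (f, f, Ident C (Dom C f), Ident C (Cod C f))"
  "(g, h, u', v') \<cdot>\<^bsub>weq_category C W\<^esub> (f, g', u, v) = (f, h, u' \<cdot>\<^bsub>C\<^esub> u, v' \<cdot>\<^bsub>C\<^esub> v)"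
  by (simp_all add: full_subcategory_def arrow_category_def)

definition dom_diagram ::
  "('o, 'm) cat \<Rightarrow> ('j, 'k, 'm, 'm \<times> 'm \<times> 'm \<times> 'm) fctr \<Rightarrow> ('j, 'k, 'o, 'm) fctr" where
  "dom_diagram C D = \<lparr>fobj = (\<lambda>j. Dom C (fobj D j)), fmor = (\<lambda>t. fst (snd (snd (fmor D t))))\<rparr>"

definition cod_diagram ::
  "('o, 'm) cat \<Rightarrow> ('j, 'k, 'm, 'm \<times> 'm \<times> 'm \<times> 'm) fctr \<Rightarrow> ('j, 'k, 'o, 'm) fctr" where
  "cod_diagram C D = \<lparr>fobj = (\<lambda>j. Cod C (fobj D j)), fmor = (\<lambda>t. snd (snd (snd (fmor D t))))\<rparr>"

lemma weq_diagramD: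
  assumes D: "is_functor J (weq_category C W) D"
  shows "j \<in> Obj J \<Longrightarrow> fobj D j \<in> W"
    and "j \<in> Obj J \<Longrightarrow> fobj D j \<in> hom C (fobj (dom_diagram C D) j) (fobj (cod_diagram C D) j)"
    and "t \<in> hom J j k \<Longrightarrow> fmor D t = (fobj D j, fobj D k, fmor (dom_diagram C D) t, fmor (cod_diagram C D) t)"
    and "t \<in> hom J j k \<Longrightarrow> fobj D k \<cdot>\<^bsub>C\<^esub> fmor (dom_diagram C D) t = fmor (cod_diagram C D) t \<cdot>\<^bsub>C\<^esub> fobj D j"
proof -
  note F = functorD[OF D]
  show "j \<in> Obj J \<Longrightarrow> fobj D j \<in> W" using F(1) by auto
  show "j \<in> Obj J \<Longrightarrow> fobj D j \<in> hom C (fobj (dom_diagram C D) j) (fobj (cod_diagram C D) j)"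
    using F(1)[of j] by (simp add: hom_def dom_diagram_def cod_diagram_def)
  show "t \<in> hom J j k \<Longrightarrow> fmor D t = (fobj D j, fobj D k, fmor (dom_diagram C D) t, fmor (cod_diagram C D) t)"
    "t \<in> hom J j k \<Longrightarrow> fobj D k \<cdot>\<^bsub>C\<^esub> fmor (dom_diagram C D) t = fmor (cod_diagram C D) t \<cdot>\<^bsub>C\<^esub> fobj D j"
    using F(2)[of t j k] by (auto simp: hom_weq_category dom_diagram_def cod_diagram_def)
qed

lemma (in category) functor_dom_cod_diagram:
  assumes J: "category J" and D: "is_functor J (weq_category C W) D"
  shows "is_functor J C (dom_diagram C D)" and "is_functor J C (cod_diagram C D)"
proof -
  interpret J: category J by fact
  note F = functorD[OF D]
  have o: "fobj D j \<in> Mor C" if "j \<in> Obj J" for j using F(1)[OF that] by simp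
  have h: "fst (snd (snd (fmor D t))) \<in> hom C (Dom C (fobj D j)) (Dom C (fobj D k)) \<and>
      snd (snd (snd (fmor D t))) \<in> hom C (Cod C (fobj D j)) (Cod C (fobj D k))" if "t \<in> hom J j k" for t j k
    using F(2)[OF that] by (auto simp: hom_weq_category)
  have c: "fst (snd (snd (fmor D (t' \<cdot>\<^bsub>J\<^esub> t)))) = fst (snd (snd (fmor D t'))) \<cdot> fst (snd (snd (fmor D t))) \<and>
      snd (snd (snd (fmor D (t' \<cdot>\<^bsub>J\<^esub> t)))) = snd (snd (snd (fmor D t'))) \<cdot> snd (snd (snd (fmor D t)))"
    if t: "t \<in> hom J j k" "t' \<in> hom J k n" for t t' j k n
    using F(2)[OF t(1)] F(2)[OF t(2)] F(4)[OF t] by (auto simp: hom_weq_category)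
  show "is_functor J C (dom_diagram C D)" "is_functor J C (cod_diagram C D)"
    unfolding is_functor_def dom_diagram_def cod_diagram_def
    using o h c F(3) by (auto simp: dom_obj cod_obj)
qed

text \<open>Colimits of arrows are componentwise, and the subcategory is full; hence the only extra
  requirement is that the induced map \<open>f\<close> between the colimits lies in
  \<open>W\<close>.\<close>

lemma (in category) weq_colimit:
  assumes J: "category J" and D: "is_functor J (weq_category C W) D"
    and l: "is_colimit J C (dom_diagram C D) x l" and m: "is_colimit J C (cod_diagram C D) y m"
    and f: "f \<in> hom C x y" "\<And>j. j \<in> Obj J \<Longrightarrow> f \<cdot> l j = m j \<cdot> fobj D j" and W: "f \<in> W"
  shows "is_colimit J (weq_category C W) D f (\<lambda>j. (fobj D j, f, l j, m j))"
  unfolding is_colimit_def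
proof (intro conjI allI impI)
  interpret J: category J by fact
  note F = functor_dom_cod_diagram[OF J D]
  note L = coconeD[OF colimit_cocone[OF l]] and M = coconeD[OF colimit_cocone[OF m]] and dD = weq_diagramD[OF D]
  have fM: "f \<in> Mor C" "Dom C f = x" "Cod C f = y" using f(1) by (auto simp: hom_def)
  have Dm: "fobj D j \<in> Mor C" "Dom C (fobj D j) = fobj (dom_diagram C D) j" "Cod C (fobj D j) = fobj (cod_diagram C D) j"
    if "j \<in> Obj J" for j using dD(2)[OF that] by (auto simp: hom_def)
  show "is_cocone J (weq_category C W) D f (\<lambda>j. (fobj D j, f, l j, m j))"
    unfolding is_cocone_def
  proof (intro conjI ballI allI)
    show "f \<in> Obj (weq_category C W)" using fM W by simp
    show "(fobj D j, f, l j, m j) \<in> hom (weq_category C W) (fobj D j) f" if j: "j \<in> Obj J" for j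
      unfolding hom_weq_category using dD(1)[OF j] W fM Dm[OF j] L(2)[OF j] M(2)[OF j] f(2)[OF j] by simp
    show "(fobj D k, f, l k, m k) \<cdot>\<^bsub>weq_category C W\<^esub> fmor D t = (fobj D j, f, l j, m j)"
      if t: "t \<in> hom J j k" for j k t
      using L(3)[OF t] M(3)[OF t] by (simp add: dD(3)[OF t])
  qed
  fix g n assume n: "is_cocone J (weq_category C W) D g n"
  note N = coconeD[OF n]
  have g: "g \<in> W" "g \<in> Mor C" using N(1) by auto
  define u where "u j = fst (snd (snd (n j)))" for j
  define v where "v j = snd (snd (snd (n j)))" for j
  have nj: "n j = (fobj D j, g, u j, v j) \<and> u j \<in> hom C (fobj (dom_diagram C D) j) (Dom C g) \<and>
      v j \<in> hom C (fobj (cod_diagram C D) j) (Cod C g) \<and> g \<cdot> u j = v j \<cdot> fobj D j" if j: "j \<in> Obj J" for j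
    using N(2)[OF j] Dm[OF j] unfolding hom_weq_category u_def v_def by auto
  have nt: "u k \<cdot> fmor (dom_diagram C D) t = u j \<and> v k \<cdot> fmor (cod_diagram C D) t = v j" if t: "t \<in> hom J j k" for j k t
    using N(3)[OF t] nj J.homD[OF t] by (simp add: dD(3)[OF t])
  have "is_cocone J C (dom_diagram C D) (Dom C g) u" "is_cocone J C (cod_diagram C D) (Cod C g) v"
    unfolding is_cocone_def using nj nt dom_obj[OF g(2)] cod_obj[OF g(2)] by auto
  then obtain a b where a: "a \<in> hom C x (Dom C g)" "\<And>j. j \<in> Obj J \<Longrightarrow> a \<cdot> l j = u j"
    and b: "b \<in> hom C y (Cod C g)" "\<And>j. j \<in> Obj J \<Longrightarrow> b \<cdot> m j = v j"
    using colimit_desc[OF l] colimit_desc[OF m] by metis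
  note gh = hom_Mor[OF g(2)]
  have sq: "g \<cdot> a = b \<cdot> f"
  proof (rule colimit_eqI[OF l J F(1) comp_hom[OF a(1) gh] comp_hom[OF f(1) b(1)]])
    fix j assume j: "j \<in> Obj J"
    show "(g \<cdot> a) \<cdot> l j = (b \<cdot> f) \<cdot> l j"
      using comp_assoc[OF L(2)[OF j] a(1) gh] comp_assoc[OF L(2)[OF j] f(1) b(1)] a(2)[OF j] f(2)[OF j] nj[OF j]
        triangle_ext[OF b(2)[OF j] M(2)[OF j] b(1) dD(2)[OF j]] by simp
  qed
  show "\<exists>!h. h \<in> hom (weq_category C W) f g \<and> (\<forall>j\<in>Obj J. h \<cdot>\<^bsub>weq_category C W\<^esub> (fobj D j, f, l j, m j) = n j)"
  proof (rule ex1I[of _ "(f, g, a, b)"])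
    have "(f, g, a, b) \<in> hom (weq_category C W) f g"
      unfolding hom_weq_category using W g fM a(1) b(1) sq by simp
    then show "(f, g, a, b) \<in> hom (weq_category C W) f g \<and>
      (\<forall>j\<in>Obj J. (f, g, a, b) \<cdot>\<^bsub>weq_category C W\<^esub> (fobj D j, f, l j, m j) = n j)"
      using a(2) b(2) nj by simp
    fix h assume h: "h \<in> hom (weq_category C W) f g \<and>
      (\<forall>j\<in>Obj J. h \<cdot>\<^bsub>weq_category C W\<^esub> (fobj D j, f, l j, m j) = n j)"
    then obtain a' b' where ab: "h = (f, g, a', b')" "a' \<in> hom C x (Dom C g)" "b' \<in> hom C y (Cod C g)"
      unfolding hom_weq_category using fM by auto
    have e: "a' \<cdot> l j = u j \<and> b' \<cdot> m j = v j" if j: "j \<in> Obj J" for j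
    proof -
      have "(fobj D j, g, a' \<cdot> l j, b' \<cdot> m j) = n j"
        using bspec[OF conjunct2[OF h] j] unfolding ab(1) by simp
      then show ?thesis using nj[OF j] by simp
    qed
    have "a' = a" using colimit_eqI[OF l J F(1) ab(2) a(1)] a(2) e by simp
    moreover have "b' = b" using colimit_eqI[OF m J F(2) ab(3) b(1)] b(2) e by simp
    ultimately show "h = (f, g, a, b)" using ab(1) by simp
  qed
qed

context omega_model
begin

abbreviation (input) WA :: "('m, 'm \<times> 'm \<times> 'm \<times> 'm) cat" where
  "WA \<equiv> weq_category C W"

lemma category_WA: "category WA"
  by (intro category_full_subcategory category_arrow_category category_axioms)

lemma locally_small_WA: "locally_small U WA"
  unfolding locally_small_def
proof (intro ballI)
  fix f g assume "f \<in> Obj WA" "g \<in> Obj WA"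
  then have o: "Dom C f \<in> Obj C" "Cod C f \<in> Obj C" "Dom C g \<in> Obj C" "Cod C g \<in> Obj C"
    using dom_obj cod_obj by auto
  have "small U ((\<lambda>(u, v). (f, g, u, v)) ` (hom C (Dom C f) (Dom C g) \<times> hom C (Cod C f) (Cod C g)))"
    by (intro small_image small_Times universe small_hom o)
  then show "small U (hom WA f g)"
    by (rule small_subset[rotated]) (auto simp: hom_weq_category)
qed

text \<open>The existence half of the fact that \<open>a\<close> is finitely presentable in the
  arrow category. The map \<open>f\<close> is not assumed to be a weak equivalence, because this
  lemma is what allows that to be proved.\<close>

lemma fp_arrow_factors:
  assumes J: "category J" "small U (Obj J)" "small U (Mor J)" "filtered J" and D: "is_functor J WA D"
    and l: "is_colimit J C (dom_diagram C D) x l" and m: "is_colimit J C (cod_diagram C D) y m"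
    and f: "f \<in> hom C x y" "\<And>j. j \<in> Obj J \<Longrightarrow> f \<cdot> l j = m j \<cdot> fobj D j"
    and c: "fp c" and d: "fp d" and a: "a \<in> hom C c d" and u: "u \<in> hom C c x" and v: "v \<in> hom C d y"
    and eq: "f \<cdot> u = v \<cdot> a"
  obtains j u' v' where "j \<in> Obj J" and "u' \<in> hom C c (fobj (dom_diagram C D) j)"
    and "v' \<in> hom C d (fobj (cod_diagram C D) j)" and "l j \<cdot> u' = u" and "m j \<cdot> v' = v"
    and "fobj D j \<cdot> u' = v' \<cdot> a"
proof -
  interpret J: category J by fact
  note F = functor_dom_cod_diagram[OF J(1) D]
  note F0 = functorD[OF F(1)] and F1 = functorD[OF F(2)]
  note L = coconeD[OF colimit_cocone[OF l]] and M = coconeD[OF colimit_cocone[OF m]] and dD = weq_diagramD[OF D]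
  obtain j1 u1 where u1: "j1 \<in> Obj J" "u1 \<in> hom C c (fobj (dom_diagram C D) j1)" "l j1 \<cdot> u1 = u"
    using commutes_hom_factor[OF finitely_presentable_commutes[OF c J F(1) l] u] .
  obtain j2 v2 where v2: "j2 \<in> Obj J" "v2 \<in> hom C d (fobj (cod_diagram C D) j2)" "m j2 \<cdot> v2 = v"
    using commutes_hom_factor[OF finitely_presentable_commutes[OF d J F(2) m] v] .
  obtain j t1 t2 where t: "t1 \<in> hom J j1 j" "t2 \<in> hom J j2 j" using J.filtered_bound[OF J(4) u1(1) v2(1)] .
  have j: "j \<in> Obj J" using J.homD[OF t(1)] by blast
  define u3 where "u3 = fmor (dom_diagram C D) t1 \<cdot> u1"
  define v3 where "v3 = fmor (cod_diagram C D) t2 \<cdot> v2"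
  have u3: "u3 \<in> hom C c (fobj (dom_diagram C D) j)" "l j \<cdot> u3 = u"
    unfolding u3_def using comp_hom[OF u1(2) F0(2)[OF t(1)]]
      triangle_ext[OF L(3)[OF t(1)] F0(2)[OF t(1)] L(2)[OF j] u1(2)] u1(3) by auto
  have v3: "v3 \<in> hom C d (fobj (cod_diagram C D) j)" "m j \<cdot> v3 = v"
    unfolding v3_def using comp_hom[OF v2(2) F1(2)[OF t(2)]]
      triangle_ext[OF M(3)[OF t(2)] F1(2)[OF t(2)] M(2)[OF j] v2(2)] v2(3) by auto
  have "m j \<cdot> (fobj D j \<cdot> u3) = m j \<cdot> (v3 \<cdot> a)"
    using square_ext[OF f(2)[OF j] L(2)[OF j] f(1) dD(2)[OF j] M(2)[OF j] u3(1)] u3(2)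
      triangle_ext[OF v3(2,1) M(2)[OF j] a] eq by simp
  then obtain k t where t: "t \<in> hom J j k"
    "fmor (cod_diagram C D) t \<cdot> (fobj D j \<cdot> u3) = fmor (cod_diagram C D) t \<cdot> (v3 \<cdot> a)"
    using commutes_hom_eq[OF finitely_presentable_commutes[OF c J F(2) m] j comp_hom[OF u3(1) dD(2)[OF j]]
        comp_hom[OF a v3(1)]] by blast
  have k: "k \<in> Obj J" using J.homD[OF t(1)] by blast
  show ?thesis
  proof (rule that[OF k comp_hom[OF u3(1) F0(2)[OF t(1)]] comp_hom[OF v3(1) F1(2)[OF t(1)]]])
    show "l k \<cdot> (fmor (dom_diagram C D) t \<cdot> u3) = u"
      using triangle_ext[OF L(3)[OF t(1)] F0(2)[OF t(1)] L(2)[OF k] u3(1)] u3(2) by simp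
    show "m k \<cdot> (fmor (cod_diagram C D) t \<cdot> v3) = v"
      using triangle_ext[OF M(3)[OF t(1)] F1(2)[OF t(1)] M(2)[OF k] v3(1)] v3(2) by simp
    show "fobj D k \<cdot> (fmor (dom_diagram C D) t \<cdot> u3) = (fmor (cod_diagram C D) t \<cdot> v3) \<cdot> a"
      using square_ext[OF dD(4)[OF t(1)] F0(2)[OF t(1)] dD(2)[OF k] dD(2)[OF j] F1(2)[OF t(1)] u3(1)] t(2)
        comp_assoc[OF a v3(1) F1(2)[OF t(1)]] by simp
  qed
qed

text \<open>A small square into the colimit map descends to a stage, where the weak equivalence
  \<open>fobj D j\<close> is approximable. Thus the colimit map is approximable and therefore a weak
  equivalence.\<close>

lemma filtered_colimit_of_weak_equivalences:
  assumes J: "category J" "small U (Obj J)" "small U (Mor J)" "filtered J" and D: "is_functor J WA D"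
  obtains f x y l m where "is_colimit J C (dom_diagram C D) x l" and "is_colimit J C (cod_diagram C D) y m"
    and "f \<in> hom C x y" and "\<And>j. j \<in> Obj J \<Longrightarrow> f \<cdot> l j = m j \<cdot> fobj D j" and "f \<in> W"
proof -
  interpret J: category J by fact
  note F = functor_dom_cod_diagram[OF J(1) D]
  note dD = weq_diagramD[OF D]
  obtain x l where l: "is_colimit J C (dom_diagram C D) x l" using colimit_exists[OF J(1-3) F(1)] .
  obtain y m where m: "is_colimit J C (cod_diagram C D) y m" using colimit_exists[OF J(1-3) F(2)] .
  note L = coconeD[OF colimit_cocone[OF l]] and M = coconeD[OF colimit_cocone[OF m]]
  have cc: "is_cocone J C (dom_diagram C D) y (\<lambda>j. m j \<cdot> fobj D j)"
    unfolding is_cocone_def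
  proof (intro conjI ballI allI)
    show "m j \<cdot> fobj D j \<in> hom C (fobj (dom_diagram C D) j) y" if "j \<in> Obj J" for j
      using comp_hom[OF dD(2)[OF that] M(2)[OF that]] .
    fix j k t assume t: "t \<in> hom J j k"
    have o: "j \<in> Obj J" "k \<in> Obj J" using J.homD[OF t] by auto
    show "(m k \<cdot> fobj D k) \<cdot> fmor (dom_diagram C D) t = m j \<cdot> fobj D j"
      using comp_assoc[OF functorD(2)[OF F(1) t] dD(2)[OF o(2)] M(2)[OF o(2)]] dD(4)[OF t]
        triangle_ext[OF M(3)[OF t] functorD(2)[OF F(2) t] M(2)[OF o(2)] dD(2)[OF o(1)]] by simp
  qed (fact M)
  obtain f where f: "f \<in> hom C x y" "\<And>j. j \<in> Obj J \<Longrightarrow> f \<cdot> l j = m j \<cdot> fobj D j"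
    using colimit_desc[OF l cc] by blast
  have "approximable fpW x y f"
  proof (rule approximableI[OF f(1)])
    fix c d a u v
    assume c: "fp c" and d: "fp d" and a: "a \<in> hom C c d" and u: "u \<in> hom C c x" and v: "v \<in> hom C d y"
      and eq: "f \<cdot> u = v \<cdot> a"
    obtain j u' v' where j: "j \<in> Obj J" and u': "u' \<in> hom C c (fobj (dom_diagram C D) j)" "l j \<cdot> u' = u"
      and v': "v' \<in> hom C d (fobj (cod_diagram C D) j)" "m j \<cdot> v' = v" and sq: "fobj D j \<cdot> u' = v' \<cdot> a"
      using fp_arrow_factors[OF J D l m f c d a u v eq] by metis
    obtain c' d' w s t u2 v2 where w: "w \<in> fpW" "w \<in> hom C c' d'" "s \<in> hom C c c'" "t \<in> hom C d d'"
      "u2 \<in> hom C c' (fobj (dom_diagram C D) j)" "v2 \<in> hom C d' (fobj (cod_diagram C D) j)" "w \<cdot> s = t \<cdot> a"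
      "fobj D j \<cdot> u2 = v2 \<cdot> w" "u2 \<cdot> s = u'" "v2 \<cdot> t = v'"
      using approximableE[OF weak_equivalence_approximable[OF dD(1,2)[OF j]] c d a u'(1) v'(1) sq] .
    show "approximates fpW x y f c d a u v"
    proof (rule approximatesI[OF w(1-4) comp_hom[OF w(5) L(2)[OF j]] comp_hom[OF w(6) M(2)[OF j]] w(7)])
      show "f \<cdot> (l j \<cdot> u2) = (m j \<cdot> v2) \<cdot> w"
        using square_ext[OF f(2)[OF j] L(2)[OF j] f(1) dD(2)[OF j] M(2)[OF j] w(5)] w(8) comp_assoc[OF w(2,6) M(2)[OF j]] by simp
      show "(l j \<cdot> u2) \<cdot> s = u" using comp_assoc[OF w(3,5) L(2)[OF j]] w(9) u'(2) by simp
      show "(m j \<cdot> v2) \<cdot> t = v" using comp_assoc[OF w(4,6) M(2)[OF j]] w(10) v'(2) by simp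
    qed
  qed
  then have "f \<in> W" by (rule approximable_weak_equivalence)
  then show ?thesis using that[OF l m f] by blast
qed

lemma has_filtered_colimits_WA: "has_filtered_colimits U WA"
  unfolding has_filtered_colimits_def has_colimits_of_shape_def small_category_def
proof (intro allI impI)
  fix J :: "('u, 'u) cat" and D
  assume "(category J \<and> small U (Obj J) \<and> small U (Mor J)) \<and> filtered J" and D: "is_functor J WA D"
  then have J: "category J" "small U (Obj J)" "small U (Mor J)" "filtered J" by auto
  obtain f x y l m where "is_colimit J C (dom_diagram C D) x l" "is_colimit J C (cod_diagram C D) y m"
    "f \<in> hom C x y" "\<And>j. j \<in> Obj J \<Longrightarrow> f \<cdot> l j = m j \<cdot> fobj D j" "f \<in> W"
    using filtered_colimit_of_weak_equivalences[OF J D] by metis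
  from weq_colimit[OF J(1) D this] show "\<exists>c l. is_colimit J WA D c l" by blast
qed

text \<open>Filtered colimits of weak equivalences are computed in the arrow category, and there
  finite presentability of both ends of \<open>w\<close> suffices.\<close>

lemma finitely_presentable_WA:
  assumes w: "w \<in> fpW"
  shows "finitely_presentable U WA w"
proof (rule category.finitely_presentableI[OF category_WA])
  define c where "c = Dom C w"
  define d where "d = Cod C w"
  have wW: "w \<in> W" and c: "fp c" and d: "fp d" using w unfolding fpW_def c_def d_def by auto
  have wh: "w \<in> hom C c d" using wW W_Mor hom_Mor unfolding c_def d_def by blast
  have wM: "w \<in> Mor C" using wW W_Mor by blast
  show "w \<in> Obj WA" using wW wM by simp
  fix J :: "('u, 'u) cat" and D z n
  assume J: "category J" "small U (Obj J)" "small U (Mor J)" "filtered J" and D: "is_functor J WA D"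
    and z: "is_colimit J WA D z n"
  interpret J: category J by fact
  note dD = weq_diagramD[OF D]
  note F = functor_dom_cod_diagram[OF J(1) D]
  note F0 = functorD[OF F(1)] and F1 = functorD[OF F(2)]
  obtain f x y l m where l: "is_colimit J C (dom_diagram C D) x l" and m: "is_colimit J C (cod_diagram C D) y m"
    and f: "f \<in> hom C x y" "\<And>j. j \<in> Obj J \<Longrightarrow> f \<cdot> l j = m j \<cdot> fobj D j" and fW: "f \<in> W"
    using filtered_colimit_of_weak_equivalences[OF J D] by metis
  have fM: "f \<in> Mor C" "Dom C f = x" "Cod C f = y" using f(1) by (auto simp: hom_def)
  have Dm: "fobj D j \<in> Mor C" "Dom C (fobj D j) = fobj (dom_diagram C D) j" "Cod C (fobj D j) = fobj (cod_diagram C D) j"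
    if "j \<in> Obj J" for j using dD(2)[OF that] by (auto simp: hom_def)
  have col: "is_colimit J WA D f (\<lambda>j. (fobj D j, f, l j, m j))" by (rule weq_colimit[OF J(1) D l m f fW])
  have "commutes_hom J WA D f (\<lambda>j. (fobj D j, f, l j, m j)) w"
    unfolding commutes_hom_def
  proof (intro conjI ballI impI)
    fix g assume "g \<in> hom WA w f"
    then obtain u v where g: "g = (w, f, u, v)" "u \<in> hom C c x" "v \<in> hom C d y" "f \<cdot> u = v \<cdot> w"
      unfolding hom_weq_category using fM by (auto simp: c_def d_def)
    obtain j u' v' where j: "j \<in> Obj J" and u': "u' \<in> hom C c (fobj (dom_diagram C D) j)" "l j \<cdot> u' = u"
      and v': "v' \<in> hom C d (fobj (cod_diagram C D) j)" "m j \<cdot> v' = v" and sq: "fobj D j \<cdot> u' = v' \<cdot> w"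
      using fp_arrow_factors[OF J D l m f c d wh g(2-4)] by metis
    have "(w, fobj D j, u', v') \<in> hom WA w (fobj D j)"
      unfolding hom_weq_category using wW wM dD(1)[OF j] Dm[OF j] u'(1) v'(1) sq by (simp add: c_def d_def)
    moreover have "(fobj D j, f, l j, m j) \<cdot>\<^bsub>WA\<^esub> (w, fobj D j, u', v') = g" using u'(2) v'(2) g(1) by simp
    ultimately show "\<exists>j\<in>Obj J. \<exists>g'\<in>hom WA w (fobj D j). (fobj D j, f, l j, m j) \<cdot>\<^bsub>WA\<^esub> g' = g"
      using j by blast
  next
    fix j g g' assume j: "j \<in> Obj J" and "g \<in> hom WA w (fobj D j)" "g' \<in> hom WA w (fobj D j)"
      and eq: "(fobj D j, f, l j, m j) \<cdot>\<^bsub>WA\<^esub> g = (fobj D j, f, l j, m j) \<cdot>\<^bsub>WA\<^esub> g'"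
    then obtain u v u' v' where g: "g = (w, fobj D j, u, v)" "u \<in> hom C c (fobj (dom_diagram C D) j)"
      "v \<in> hom C d (fobj (cod_diagram C D) j)" and g': "g' = (w, fobj D j, u', v')"
      "u' \<in> hom C c (fobj (dom_diagram C D) j)" "v' \<in> hom C d (fobj (cod_diagram C D) j)"
      unfolding hom_weq_category using Dm[OF j] by (auto simp: c_def d_def)
    have e: "l j \<cdot> u = l j \<cdot> u'" "m j \<cdot> v = m j \<cdot> v'" using eq unfolding g(1) g'(1) by auto
    obtain k1 t1 where t1: "t1 \<in> hom J j k1" "fmor (dom_diagram C D) t1 \<cdot> u = fmor (dom_diagram C D) t1 \<cdot> u'"
      using commutes_hom_eq[OF finitely_presentable_commutes[OF c J F(1) l] j g(2) g'(2) e(1)] .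
    obtain k2 t2 where t2: "t2 \<in> hom J j k2" "fmor (cod_diagram C D) t2 \<cdot> v = fmor (cod_diagram C D) t2 \<cdot> v'"
      using commutes_hom_eq[OF finitely_presentable_commutes[OF d J F(2) m] j g(3) g'(3) e(2)] .
    \<comment> \<open>The domain and codomain components become equal at different stages; one
      transition map out of \<open>j\<close> has to serve for both.\<close>
    obtain k p q where pq: "p \<in> hom J k1 k" "q \<in> hom J k2 k" "p \<cdot>\<^bsub>J\<^esub> t1 = q \<cdot>\<^bsub>J\<^esub> t2"
      using J.filtered_span[OF J(4) t1(1) t2(1)] .
    define t where "t = p \<cdot>\<^bsub>J\<^esub> t1"
    have t: "t \<in> hom J j k" unfolding t_def using J.comp_hom[OF t1(1) pq(1)] .
    have "fmor (dom_diagram C D) t \<cdot> u = fmor (dom_diagram C D) t \<cdot> u'"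
      unfolding t_def F0(4)[OF t1(1) pq(1)]
      using comp_assoc[OF g(2) F0(2)[OF t1(1)] F0(2)[OF pq(1)]] comp_assoc[OF g'(2) F0(2)[OF t1(1)] F0(2)[OF pq(1)]] t1(2)
      by simp
    moreover have "fmor (cod_diagram C D) t \<cdot> v = fmor (cod_diagram C D) t \<cdot> v'"
      unfolding t_def pq(3) F1(4)[OF t2(1) pq(2)]
      using comp_assoc[OF g(3) F1(2)[OF t2(1)] F1(2)[OF pq(2)]] comp_assoc[OF g'(3) F1(2)[OF t2(1)] F1(2)[OF pq(2)]] t2(2)
      by simp
    ultimately have "fmor D t \<cdot>\<^bsub>WA\<^esub> g = fmor D t \<cdot>\<^bsub>WA\<^esub> g'"
      unfolding g(1) g'(1) dD(3)[OF t] by simp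
    then show "\<exists>k. \<exists>u\<in>hom J j k. fmor D u \<cdot>\<^bsub>WA\<^esub> g = fmor D u \<cdot>\<^bsub>WA\<^esub> g'" using t by blast
  qed
  then show "commutes_hom J WA D z n w"
    by (rule category.commutes_hom_colimit_cong[OF category_WA J(1) D col z])
qed

subsection \<open>Every weak equivalence is a filtered colimit of small ones\<close>

definition weq_over :: "'m set \<Rightarrow> 'm \<Rightarrow> ('m \<times> 'm \<times> 'm) set" where
  "weq_over V f = {(w, u, v). w \<in> V \<and> u \<in> hom C (Dom C w) (Dom C f) \<and> v \<in> hom C (Cod C w) (Cod C f) \<and>
     f \<cdot> u = v \<cdot> w}"

text \<open>The comma category of \<open>V\<close> over \<open>f\<close>, inside the arrow category.
  A morphism records its source and target, since the same pair \<open>(a, b)\<close> may be a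
  morphism between different objects.\<close>

definition weq_comma ::
  "'m set \<Rightarrow> 'm \<Rightarrow> ('m \<times> 'm \<times> 'm, ('m \<times> 'm \<times> 'm) \<times> ('m \<times> 'm \<times> 'm) \<times> 'm \<times> 'm) cat" where
  "weq_comma V f =
     \<lparr>Obj = weq_over V f,
      Mor = {(k, k', a, b). k \<in> weq_over V f \<and> k' \<in> weq_over V f \<and>
        a \<in> hom C (Dom C (fst k)) (Dom C (fst k')) \<and> b \<in> hom C (Cod C (fst k)) (Cod C (fst k')) \<and>
        fst k' \<cdot> a = b \<cdot> fst k \<and> fst (snd k') \<cdot> a = fst (snd k) \<and> snd (snd k') \<cdot> b = snd (snd k)},
      Dom = fst, Cod = (\<lambda>(k, k', a, b). k'),
      Ident = (\<lambda>k. (k, k, Ident C (Dom C (fst k)), Ident C (Cod C (fst k)))),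
      Comp = (\<lambda>(k', k'', a', b') (k, k''', a, b). (k, k'', a' \<cdot> a, b' \<cdot> b))\<rparr>"

lemma weq_comma_simps [simp]:
  "Obj (weq_comma V f) = weq_over V f"
  "Ident (weq_comma V f) k = (k, k, Ident C (Dom C (fst k)), Ident C (Cod C (fst k)))"
  "(k1, k2, a', b') \<cdot>\<^bsub>weq_comma V f\<^esub> (k, k3, a, b) = (k, k2, a' \<cdot> a, b' \<cdot> b)"
  by (simp_all add: weq_comma_def)

lemma hom_weq_comma:
  "t \<in> hom (weq_comma V f) k k' \<longleftrightarrow> (\<exists>a b. t = (k, k', a, b) \<and> k \<in> weq_over V f \<and> k' \<in> weq_over V f \<and>
     a \<in> hom C (Dom C (fst k)) (Dom C (fst k')) \<and> b \<in> hom C (Cod C (fst k)) (Cod C (fst k')) \<and>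
     fst k' \<cdot> a = b \<cdot> fst k \<and> fst (snd k') \<cdot> a = fst (snd k) \<and> snd (snd k') \<cdot> b = snd (snd k))"
  unfolding hom_def[of "weq_comma V f"] by (auto simp: weq_comma_def)

lemma weq_overD:
  assumes "(w, u, v) \<in> weq_over V f"
  shows "w \<in> V" and "u \<in> hom C (Dom C w) (Dom C f)" and "v \<in> hom C (Cod C w) (Cod C f)" and "f \<cdot> u = v \<cdot> w"
  using assms unfolding weq_over_def by auto

end

text \<open>\<open>V\<close> is a small set of representatives of the weak equivalences between finitely presentable objects.\<close>

locale weq_presentation = omega_model C U W Fib Cof
  for C :: "('o, 'm) cat" (structure) and U :: "'u itself" and W Fib Cof +
  fixes V :: "'m set" and f :: 'm and x y :: 'o
  assumes V: "V \<subseteq> fpW" "small U V"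
    and f: "f \<in> hom C x y" "f \<in> W" and approx: "approximable V x y f"
begin

abbreviation K where "K \<equiv> weq_comma V f"

lemma fM: "f \<in> Mor C" "Dom C f = x" "Cod C f = y"
  using f(1) by (auto simp: hom_def)

lemma VD: "w \<in> V \<Longrightarrow> w \<in> hom C (Dom C w) (Cod C w) \<and> w \<in> W \<and> fp (Dom C w) \<and> fp (Cod C w)"
  using V(1) W_Mor hom_Mor unfolding fpW_def by blast

lemma K_objD:
  assumes "(w, u, v) \<in> weq_over V f"
  shows "w \<in> hom C (Dom C w) (Cod C w)" and "fp (Dom C w)" and "fp (Cod C w)"
    and "u \<in> hom C (Dom C w) x" and "v \<in> hom C (Cod C w) y" and "f \<cdot> u = v \<cdot> w"
  using weq_overD[OF assms] VD[of w] unfolding fM by auto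

lemma category_K: "category K"
proof
  show "k \<in> Mor K \<Longrightarrow> Dom K k \<in> Obj K" "k \<in> Mor K \<Longrightarrow> Cod K k \<in> Obj K" for k
    by (auto simp: weq_comma_def)
  show "Ident K k \<in> hom K k k" if k: "k \<in> Obj K" for k
  proof -
    obtain w u v where kw: "k = (w, u, v)" by (cases k)
    note kD = K_objD[OF k[unfolded kw, simplified]]
    show ?thesis unfolding hom_weq_comma kw
      using k[unfolded kw] kD homD[OF kD(1)] comp_ident[OF kD(1)] ident_comp[OF kD(1)] comp_ident[OF kD(4)] comp_ident[OF kD(5)]
      by (simp add: ident_hom)
  qed
  show "t' \<cdot>\<^bsub>K\<^esub> t \<in> hom K k k''" if t: "t \<in> hom K k k'" "t' \<in> hom K k' k''" for t t' k k' k''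
  proof -
    obtain w u v w' u' v' w'' u'' v'' where kw: "k = (w, u, v)" "k' = (w', u', v')" "k'' = (w'', u'', v'')"
      by (cases k, cases k', cases k'')
    obtain a b where ab: "t = (k, k', a, b)" "k \<in> weq_over V f" "k' \<in> weq_over V f" "a \<in> hom C (Dom C w) (Dom C w')"
      "b \<in> hom C (Cod C w) (Cod C w')" "w' \<cdot> a = b \<cdot> w" "u' \<cdot> a = u" "v' \<cdot> b = v"
      using t(1) unfolding hom_weq_comma kw by auto
    obtain a' b' where ab': "t' = (k', k'', a', b')" "k'' \<in> weq_over V f" "a' \<in> hom C (Dom C w') (Dom C w'')"
      "b' \<in> hom C (Cod C w') (Cod C w'')" "w'' \<cdot> a' = b' \<cdot> w'" "u'' \<cdot> a' = u'" "v'' \<cdot> b' = v'"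
      using t(2) unfolding hom_weq_comma kw by auto
    note k1 = K_objD[OF ab(2)[unfolded kw]] and k2 = K_objD[OF ab(3)[unfolded kw]] and k3 = K_objD[OF ab'(2)[unfolded kw]]
    have "w'' \<cdot> (a' \<cdot> a) = (b' \<cdot> b) \<cdot> w"
      using square_ext[OF ab'(5,3) k3(1) k2(1) ab'(4) ab(4)] ab(6) comp_assoc[OF k1(1) ab(5) ab'(4)] by simp
    moreover have "u'' \<cdot> (a' \<cdot> a) = u" using triangle_ext[OF ab'(6,3) k3(4) ab(4)] ab(7) by simp
    moreover have "v'' \<cdot> (b' \<cdot> b) = v" using triangle_ext[OF ab'(7,4) k3(5) ab(5)] ab(8) by simp
    ultimately show ?thesis
      unfolding hom_weq_comma using ab(1-3) ab'(1,2) comp_hom[OF ab(4) ab'(3)] comp_hom[OF ab(5) ab'(4)] kw by simp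
  qed
  show "t \<cdot>\<^bsub>K\<^esub> Ident K k = t" "Ident K k' \<cdot>\<^bsub>K\<^esub> t = t" if "t \<in> hom K k k'" for t k k'
    using that comp_ident ident_comp unfolding hom_weq_comma by auto
  show "t'' \<cdot>\<^bsub>K\<^esub> t' \<cdot>\<^bsub>K\<^esub> t = t'' \<cdot>\<^bsub>K\<^esub> (t' \<cdot>\<^bsub>K\<^esub> t)"
    if "t \<in> hom K k k1" "t' \<in> hom K k1 k2" "t'' \<in> hom K k2 k3" for t t' t'' k k1 k2 k3
    using that comp_assoc unfolding hom_weq_comma by auto
qed

lemma small_K: "small U (Obj K)" "small U (Mor K)"
proof -
  have xy: "x \<in> Obj C" "y \<in> Obj C" using homD[OF f(1)] by auto
  have "small U (SIGMA w:V. hom C (Dom C w) x \<times> hom C (Cod C w) y)"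
    by (rule small_Sigma[OF universe V(2)]) (use VD fp_Obj xy in \<open>blast intro: small_Times[OF universe] small_hom\<close>)
  then have o: "small U (weq_over V f)"
    by (rule small_subset[rotated]) (auto simp: weq_over_def fM)
  then show "small U (Obj K)" by simp
  have "small U (SIGMA k:weq_over V f. SIGMA k':weq_over V f.
      hom C (Dom C (fst k)) (Dom C (fst k')) \<times> hom C (Cod C (fst k)) (Cod C (fst k')))"
  proof (intro small_Sigma[OF universe] small_Times[OF universe] small_hom o)
    fix k k' assume "k \<in> weq_over V f" "k' \<in> weq_over V f"
    then have "fst k \<in> V" "fst k' \<in> V" unfolding weq_over_def by auto
    then show "Dom C (fst k) \<in> Obj C" "Dom C (fst k') \<in> Obj C" "Cod C (fst k) \<in> Obj C" "Cod C (fst k') \<in> Obj C"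
      using VD fp_Obj by auto
  qed
  then show "small U (Mor K)"
    by (rule small_subset[rotated]) (auto simp: weq_comma_def)
qed

lemma K_approx:
  assumes "fp c" and "fp d" and "a \<in> hom C c d" and "u \<in> hom C c x" and "v \<in> hom C d y" and "f \<cdot> u = v \<cdot> a"
  obtains w u' v' s t where "(w, u', v') \<in> weq_over V f" and "s \<in> hom C c (Dom C w)" and "t \<in> hom C d (Cod C w)"
    and "w \<cdot> s = t \<cdot> a" and "u' \<cdot> s = u" and "v' \<cdot> t = v"
proof -
  obtain c' d' w s t u' v' where w: "w \<in> V" "w \<in> hom C c' d'" "s \<in> hom C c c'" "t \<in> hom C d d'"
    "u' \<in> hom C c' x" "v' \<in> hom C d' y" "w \<cdot> s = t \<cdot> a" "f \<cdot> u' = v' \<cdot> w" "u' \<cdot> s = u" "v' \<cdot> t = v"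
    using approximableE[OF approx assms] .
  have "Dom C w = c'" "Cod C w = d'" using w(2) by (auto simp: hom_def)
  then show ?thesis using that[of w u' v' s t] w unfolding weq_over_def fM by auto
qed

text \<open>Turns any map \<open>a\<close> of finitely presentable objects lying under
  \<open>w\<close> and over \<open>f\<close> into a morphism of \<open>K\<close>. It is enough to
  build such an \<open>a\<close> by finite colimits; approximability then moves it into
  \<open>V\<close>.\<close>

lemma K_extend:
  assumes k: "(w, u, v) \<in> weq_over V f" and c: "fp c" and d: "fp d" and a: "a \<in> hom C c d"
    and e: "e \<in> hom C (Dom C w) c" "e' \<in> hom C (Cod C w) d" "a \<cdot> e = e' \<cdot> w"
    and h: "h \<in> hom C c x" "h' \<in> hom C d y" "f \<cdot> h = h' \<cdot> a" "h \<cdot> e = u" "h' \<cdot> e' = v"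
  obtains w' u' v' s t where "(w', u', v') \<in> weq_over V f" and "s \<in> hom C c (Dom C w')" and "t \<in> hom C d (Cod C w')"
    and "((w, u, v), (w', u', v'), s \<cdot> e, t \<cdot> e') \<in> hom K (w, u, v) (w', u', v')"
proof -
  obtain w' u' v' s t where k': "(w', u', v') \<in> weq_over V f" and s: "s \<in> hom C c (Dom C w')"
    and t: "t \<in> hom C d (Cod C w')" and eq: "w' \<cdot> s = t \<cdot> a" "u' \<cdot> s = h" "v' \<cdot> t = h'"
    using K_approx[OF c d a h(1-3)] .
  note kD = K_objD[OF k] and k'D = K_objD[OF k']
  have "w' \<cdot> (s \<cdot> e) = (t \<cdot> e') \<cdot> w"
    using square_ext[OF eq(1) s k'D(1) a t e(1)] e(3) comp_assoc[OF kD(1) e(2) t] by simp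
  moreover have "u' \<cdot> (s \<cdot> e) = u" using triangle_ext[OF eq(2) s k'D(4) e(1)] h(4) by simp
  moreover have "v' \<cdot> (t \<cdot> e') = v" using triangle_ext[OF eq(3) t k'D(5) e(2)] h(5) by simp
  ultimately have "((w, u, v), (w', u', v'), s \<cdot> e, t \<cdot> e') \<in> hom K (w, u, v) (w', u', v')"
    unfolding hom_weq_comma using k k' comp_hom[OF e(1) s] comp_hom[OF e(2) t] by simp
  then show ?thesis using that k' s t by blast
qed

text \<open>Bounds and coequalizing maps are first constructed in the arrow category, from
  coproducts and coequalizers of both components. The results are maps between finitely presentable
  objects which need not lie in \<open>V\<close>, and approximating them over \<open>f\<close>
  brings them back into \<open>K\<close>.\<close>

lemma filtered_K: "filtered K"
  unfolding filtered_def
proof (intro conjI ballI allI)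
  have xy: "x \<in> Obj C" "y \<in> Obj C" using homD[OF f(1)] by auto
  obtain z where z: "is_initial C z" "fp z" using initial_exists .
  obtain u v where uv: "u \<in> hom C z x" "v \<in> hom C z y" using z(1) xy unfolding is_initial_def by blast
  have zI: "Ident C z \<in> hom C z z" using ident_hom fp_Obj[OF z(2)] by blast
  \<comment> \<open>Nonemptiness comes from approximating the square whose source is the identity of
    the initial object.\<close>
  have "f \<cdot> u = v \<cdot> Ident C z"
    using z(1) xy(2) comp_hom[OF uv(1) f(1)] comp_hom[OF zI uv(2)] unfolding is_initial_def by blast
  then show "Obj K \<noteq> {}" using K_approx[OF z(2,2) zI uv] by fastforce
  show "\<exists>c\<in>Obj K. hom K k1 c \<noteq> {} \<and> hom K k2 c \<noteq> {}" if k: "k1 \<in> Obj K" "k2 \<in> Obj K" for k1 k2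
  proof -
    obtain w1 u1 v1 w2 u2 v2 where kw: "k1 = (w1, u1, v1)" "k2 = (w2, u2, v2)" by (cases k1, cases k2)
    have kO: "(w1, u1, v1) \<in> weq_over V f" "(w2, u2, v2) \<in> weq_over V f" using k kw by auto
    note k1 = K_objD[OF kO(1)] and k2 = K_objD[OF kO(2)]
    \<comment> \<open>Domains and codomains are summed separately; the induced map \<open>a\<close>
      between the sums is the coproduct of \<open>w1\<close> and \<open>w2\<close> as
      arrows.\<close>
    obtain c i1 i2 where c: "is_coproduct C (Dom C w1) (Dom C w2) c i1 i2" "fp c"
      using coproduct_exists[OF fp_Obj[OF k1(2)] fp_Obj[OF k2(2)]] k1(2) k2(2) by metis
    obtain d j1 j2 where d: "is_coproduct C (Cod C w1) (Cod C w2) d j1 j2" "fp d"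
      using coproduct_exists[OF fp_Obj[OF k1(3)] fp_Obj[OF k2(3)]] k1(3) k2(3) by metis
    note I = coproductD[OF c(1)] and Jd = coproductD[OF d(1)]
    obtain a where a: "a \<in> hom C c d" "a \<cdot> i1 = j1 \<cdot> w1" "a \<cdot> i2 = j2 \<cdot> w2"
      using coproduct_desc[OF c(1) comp_hom[OF k1(1) Jd(1)] comp_hom[OF k2(1) Jd(2)]] .
    obtain h where h: "h \<in> hom C c x" "h \<cdot> i1 = u1" "h \<cdot> i2 = u2" using coproduct_desc[OF c(1) k1(4) k2(4)] .
    obtain h' where h': "h' \<in> hom C d y" "h' \<cdot> j1 = v1" "h' \<cdot> j2 = v2" using coproduct_desc[OF d(1) k1(5) k2(5)] .
    have fh: "f \<cdot> h = h' \<cdot> a"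
    proof (rule coproduct_eqI[OF c(1) comp_hom[OF h(1) f(1)] comp_hom[OF a(1) h'(1)]])
      show "(f \<cdot> h) \<cdot> i1 = (h' \<cdot> a) \<cdot> i1"
        using comp_assoc[OF I(1) h(1) f(1)] comp_assoc[OF I(1) a(1) h'(1)] h(2) a(2) triangle_ext[OF h'(2) Jd(1) h'(1) k1(1)] k1(6) by simp
      show "(f \<cdot> h) \<cdot> i2 = (h' \<cdot> a) \<cdot> i2"
        using comp_assoc[OF I(2) h(1) f(1)] comp_assoc[OF I(2) a(1) h'(1)] h(3) a(3) triangle_ext[OF h'(3) Jd(2) h'(1) k2(1)] k2(6) by simp
    qed
    obtain w u' v' s t where w: "(w, u', v') \<in> weq_over V f" and s: "s \<in> hom C c (Dom C w)" and t: "t \<in> hom C d (Cod C w)"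
      and eq: "w \<cdot> s = t \<cdot> a" "u' \<cdot> s = h" "v' \<cdot> t = h'"
      using K_approx[OF c(2) d(2) a(1) h(1) h'(1) fh] .
    note wD = K_objD[OF w]
    have "(k1, (w, u', v'), s \<cdot> i1, t \<cdot> j1) \<in> hom K k1 (w, u', v')"
      unfolding hom_weq_comma kw
      using kO w comp_hom[OF I(1) s] comp_hom[OF Jd(1) t] square_ext[OF eq(1) s wD(1) a(1) t I(1)] a(2)
        comp_assoc[OF k1(1) Jd(1) t] triangle_ext[OF eq(2) s wD(4) I(1)] h(2) triangle_ext[OF eq(3) t wD(5) Jd(1)] h'(2) by simp
    moreover have "(k2, (w, u', v'), s \<cdot> i2, t \<cdot> j2) \<in> hom K k2 (w, u', v')"
      unfolding hom_weq_comma kw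
      using kO w comp_hom[OF I(2) s] comp_hom[OF Jd(2) t] square_ext[OF eq(1) s wD(1) a(1) t I(2)] a(3)
        comp_assoc[OF k2(1) Jd(2) t] triangle_ext[OF eq(2) s wD(4) I(2)] h(3) triangle_ext[OF eq(3) t wD(5) Jd(2)] h'(3) by simp
    moreover have "(w, u', v') \<in> Obj K" using w by simp
    ultimately show ?thesis by blast
  qed
  show "\<exists>c. \<exists>h\<in>hom K k2 c. h \<cdot>\<^bsub>K\<^esub> t = h \<cdot>\<^bsub>K\<^esub> t'" if t: "t \<in> hom K k1 k2" "t' \<in> hom K k1 k2" for k1 k2 t t'
  proof -
    obtain w1 u1 v1 w2 u2 v2 where kw: "k1 = (w1, u1, v1)" "k2 = (w2, u2, v2)" by (cases k1, cases k2)
    obtain a b where ab: "t = (k1, k2, a, b)" "k1 \<in> weq_over V f" "k2 \<in> weq_over V f" "a \<in> hom C (Dom C w1) (Dom C w2)"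
      "b \<in> hom C (Cod C w1) (Cod C w2)" "w2 \<cdot> a = b \<cdot> w1" "u2 \<cdot> a = u1" "v2 \<cdot> b = v1"
      using t(1) unfolding hom_weq_comma kw by auto
    obtain a' b' where ab': "t' = (k1, k2, a', b')" "a' \<in> hom C (Dom C w1) (Dom C w2)"
      "b' \<in> hom C (Cod C w1) (Cod C w2)" "w2 \<cdot> a' = b' \<cdot> w1" "u2 \<cdot> a' = u1" "v2 \<cdot> b' = v1"
      using t(2) unfolding hom_weq_comma kw by auto
    note k1 = K_objD[OF ab(2)[unfolded kw]] and k2 = K_objD[OF ab(3)[unfolded kw]]
    \<comment> \<open>Coequalizers of both components form the coequalizer in the arrow category.
      The uniqueness clause is also needed on the domain side, to check that the induced maps
      commute with \<open>f\<close>.\<close>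
    obtain c e where e: "e \<in> hom C (Dom C w2) c" "e \<cdot> a = e \<cdot> a'" and c: "fp c"
      and ec: "\<forall>x. \<forall>k\<in>hom C (Dom C w2) x. k \<cdot> a = k \<cdot> a' \<longrightarrow> (\<exists>h\<in>hom C c x. h \<cdot> e = k)"
      and eu: "\<forall>x. \<forall>h\<in>hom C c x. \<forall>h'\<in>hom C c x. h \<cdot> e = h' \<cdot> e \<longrightarrow> h = h'"
      using coequalizer_exists[OF ab(4) ab'(2) k1(2) k2(2)] by blast
    obtain d e' where e': "e' \<in> hom C (Cod C w2) d" "e' \<cdot> b = e' \<cdot> b'" and d: "fp d"
      and ed: "\<forall>x. \<forall>k\<in>hom C (Cod C w2) x. k \<cdot> b = k \<cdot> b' \<longrightarrow> (\<exists>h\<in>hom C d x. h \<cdot> e' = k)"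
      using coequalizer_exists[OF ab(5) ab'(3) k1(3) k2(3)] by blast
    have "(e' \<cdot> w2) \<cdot> a = (e' \<cdot> w2) \<cdot> a'"
      using comp_assoc[OF ab(4) k2(1) e'(1)] comp_assoc[OF ab'(2) k2(1) e'(1)] ab(6) ab'(4)
        square_ext[OF e'(2) ab(5) e'(1) ab'(3) e'(1) k1(1)] by simp
    then obtain q where q: "q \<in> hom C c d" "q \<cdot> e = e' \<cdot> w2" using ec comp_hom[OF k2(1) e'(1)] by blast
    obtain h where h: "h \<in> hom C c x" "h \<cdot> e = u2" using ec k2(4) ab(7) ab'(5) by metis
    obtain h' where h': "h' \<in> hom C d y" "h' \<cdot> e' = v2" using ed k2(5) ab(8) ab'(6) by metis
    have "(f \<cdot> h) \<cdot> e = (h' \<cdot> q) \<cdot> e"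
      using comp_assoc[OF e(1) h(1) f(1)] comp_assoc[OF e(1) q(1) h'(1)] h(2) q(2)
        triangle_ext[OF h'(2) e'(1) h'(1) k2(1)] k2(6) by simp
    then have fh: "f \<cdot> h = h' \<cdot> q"
      using eu comp_hom[OF h(1) f(1)] comp_hom[OF q(1) h'(1)] by blast
    obtain w u v s r where w: "s \<in> hom C c (Dom C w)" "r \<in> hom C d (Cod C w)"
      "((w2, u2, v2), (w, u, v), s \<cdot> e, r \<cdot> e') \<in> hom K (w2, u2, v2) (w, u, v)"
      using K_extend[OF ab(3)[unfolded kw] c d q(1) e(1) e'(1) q(2) h(1) h'(1) fh h(2) h'(2)] by metis
    have "((w2, u2, v2), (w, u, v), s \<cdot> e, r \<cdot> e') \<cdot>\<^bsub>K\<^esub> t = ((w2, u2, v2), (w, u, v), s \<cdot> e, r \<cdot> e') \<cdot>\<^bsub>K\<^esub> t'"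
      unfolding ab(1) ab'(1)
      using comp_assoc[OF ab(4) e(1) w(1)] comp_assoc[OF ab'(2) e(1) w(1)] e(2)
        comp_assoc[OF ab(5) e'(1) w(2)] comp_assoc[OF ab'(3) e'(1) w(2)] e'(2) by simp
    then show ?thesis using w(3) kw by blast
  qed
qed

definition K_diagram where
  "K_diagram = \<lparr>fobj = (fst :: 'm \<times> 'm \<times> 'm \<Rightarrow> 'm),
     fmor = (\<lambda>(k :: 'm \<times> 'm \<times> 'm, k' :: 'm \<times> 'm \<times> 'm, a :: 'm, b :: 'm). (fst k, fst k', a, b))\<rparr>"

lemma functor_K: "is_functor K WA K_diagram"
  unfolding is_functor_def
proof (intro conjI ballI allI)
  have o: "fst k \<in> W \<and> fst k \<in> Mor C" if "k \<in> weq_over V f" for k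
    using that VD W_Mor unfolding weq_over_def by auto
  show "fobj K_diagram k \<in> Obj WA" if "k \<in> Obj K" for k
    using o that by (simp add: K_diagram_def)
  show "fmor K_diagram t \<in> hom WA (fobj K_diagram k) (fobj K_diagram k')" if tk: "t \<in> hom K k k'" for t k k'
  proof -
    obtain a b where t: "t = (k, k', a, b)" "k \<in> weq_over V f" "k' \<in> weq_over V f"
      "a \<in> hom C (Dom C (fst k)) (Dom C (fst k'))" "b \<in> hom C (Cod C (fst k)) (Cod C (fst k'))"
      "fst k' \<cdot> a = b \<cdot> fst k"
      using tk unfolding hom_weq_comma by blast
    then show ?thesis using o[OF t(2)] o[OF t(3)] unfolding hom_weq_category K_diagram_def by simp
  qed
  show "fmor K_diagram (Ident K k) = Ident WA (fobj K_diagram k)" for k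
    by (simp add: K_diagram_def)
  show "fmor K_diagram (t' \<cdot>\<^bsub>K\<^esub> t) = fmor K_diagram t' \<cdot>\<^bsub>WA\<^esub> fmor K_diagram t"
    if "t \<in> hom K k k'" "t' \<in> hom K k' k''" for t t' k k' k''
    using that unfolding hom_weq_comma by (auto simp: K_diagram_def)
qed

lemma K_dom_cod [simp]:
  "fobj (dom_diagram C K_diagram) k = Dom C (fst k)" "fobj (cod_diagram C K_diagram) k = Cod C (fst k)"
  "fmor (dom_diagram C K_diagram) (k, k', a, b) = a" "fmor (cod_diagram C K_diagram) (k, k', a, b) = b"
  by (simp_all add: dom_diagram_def cod_diagram_def K_diagram_def)

lemma cocone_K:
  "is_cocone K C (dom_diagram C K_diagram) x (\<lambda>k. fst (snd k))"
  "is_cocone K C (cod_diagram C K_diagram) y (\<lambda>k. snd (snd k))"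
proof -
  have xy: "x \<in> Obj C" "y \<in> Obj C" using homD[OF f(1)] by auto
  have "fst (snd k) \<in> hom C (Dom C (fst k)) x \<and> snd (snd k) \<in> hom C (Cod C (fst k)) y" if "k \<in> Obj K" for k
    using that fM unfolding weq_comma_simps weq_over_def by auto
  then show "is_cocone K C (dom_diagram C K_diagram) x (\<lambda>k. fst (snd k))"
    "is_cocone K C (cod_diagram C K_diagram) y (\<lambda>k. snd (snd k))"
    unfolding is_cocone_def using xy by (auto simp del: split_paired_All) (auto simp: hom_weq_comma)
qed

text \<open>By the componentwise description it is enough to find the colimits of the domains and of
  the codomains, and both are detected by finitely presentable objects. A map from such an object is
  turned into a square into \<open>f\<close>; an equality of two such maps is forced by coequalizing
  them and extending the result to an object under \<open>w\<close>.\<close>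

lemma colimit_K: "is_colimit K WA K_diagram f (\<lambda>k. (fst k, f, fst (snd k), snd (snd k)))"
proof -
  note F = functor_dom_cod_diagram[OF category_K functor_K]
  have dom: "is_colimit K C (dom_diagram C K_diagram) x (\<lambda>k. fst (snd k))"
  proof (rule colimit_if_commutes_hom[OF category_K filtered_K F(1) cocone_K(1)])
    fix z assume z: "fp z"
    have zI: "Ident C z \<in> hom C z z" using ident_hom fp_Obj[OF z] by blast
    show "commutes_hom K C (dom_diagram C K_diagram) x (\<lambda>k. fst (snd k)) z"
      unfolding commutes_hom_def
    proof (intro conjI ballI impI)
      fix g assume g: "g \<in> hom C z x"
      \<comment> \<open>A map \<open>g\<close> into the domain becomes a square starting at the
        identity of \<open>z\<close>, with \<open>f \<cdot> g\<close> on the codomain.\<close>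
      have "f \<cdot> g = (f \<cdot> g) \<cdot> Ident C z" using comp_ident[OF comp_hom[OF g f(1)]] by simp
      from K_approx[OF z z zI g comp_hom[OF g f(1)] this]
      obtain w u v s where "(w, u, v) \<in> weq_over V f" "s \<in> hom C z (Dom C w)" "u \<cdot> s = g" by metis
      then show "\<exists>k\<in>Obj K. \<exists>g'\<in>hom C z (fobj (dom_diagram C K_diagram) k). fst (snd k) \<cdot> g' = g"
        by (intro bexI[of _ "(w, u, v)"]) auto
    next
      fix k g g' assume k: "k \<in> Obj K" and g0: "g \<in> hom C z (fobj (dom_diagram C K_diagram) k)"
        "g' \<in> hom C z (fobj (dom_diagram C K_diagram) k)" and eq: "fst (snd k) \<cdot> g = fst (snd k) \<cdot> g'"
      obtain w u v where kw: "k = (w, u, v)" by (cases k)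
      have kO: "(w, u, v) \<in> weq_over V f" using k kw by simp
      note kD = K_objD[OF kO]
      have g: "g \<in> hom C z (Dom C w)" "g' \<in> hom C z (Dom C w)" "u \<cdot> g = u \<cdot> g'" using g0 eq kw by auto
      obtain c e where e: "e \<in> hom C (Dom C w) c" "e \<cdot> g = e \<cdot> g'" and c: "fp c"
        and ec: "\<forall>x. \<forall>k\<in>hom C (Dom C w) x. k \<cdot> g = k \<cdot> g' \<longrightarrow> (\<exists>h\<in>hom C c x. h \<cdot> e = k)"
        using coequalizer_exists[OF g(1,2) z kD(2)] by blast
      obtain h where h: "h \<in> hom C c x" "h \<cdot> e = u" using ec kD(4) g(3) by blast
      \<comment> \<open>Coequalizing on the domain disturbs the codomain; the pushout of
        \<open>w\<close> along \<open>e\<close> supplies the accompanying codomain and hence an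
        arrow under \<open>w\<close>.\<close>
      obtain d a e' where po: "pushout_square C (Dom C w) c (Cod C w) d e w a e'" using pushout_exists[OF e(1) kD(1)] .
      note P = pushoutD[OF po]
      have "(f \<cdot> h) \<cdot> e = v \<cdot> w" using comp_assoc[OF e(1) h(1) f(1)] h(2) kD(6) by simp
      then obtain h' where h': "h' \<in> hom C d y" "h' \<cdot> a = f \<cdot> h" "h' \<cdot> e' = v"
        using pushout_desc[OF po comp_hom[OF h(1) f(1)] kD(5)] by blast
      obtain w' u' v' s t where s: "s \<in> hom C c (Dom C w')"
        and t: "((w, u, v), (w', u', v'), s \<cdot> e, t \<cdot> e') \<in> hom K (w, u, v) (w', u', v')"
        using K_extend[OF kO c fp_pushout[OF po kD(2) c kD(3)] P(3) e(1) P(4,5) h(1) h'(1) h'(2)[symmetric] h(2) h'(3)]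
        by metis
      have "(s \<cdot> e) \<cdot> g = (s \<cdot> e) \<cdot> g'"
        using comp_assoc[OF g(1) e(1) s] comp_assoc[OF g(2) e(1) s] e(2) by simp
      then have "fmor (dom_diagram C K_diagram) ((w, u, v), (w', u', v'), s \<cdot> e, t \<cdot> e') \<cdot> g =
          fmor (dom_diagram C K_diagram) ((w, u, v), (w', u', v'), s \<cdot> e, t \<cdot> e') \<cdot> g'"
        unfolding K_dom_cod .
      then show "\<exists>k'. \<exists>t\<in>hom K k k'. fmor (dom_diagram C K_diagram) t \<cdot> g = fmor (dom_diagram C K_diagram) t \<cdot> g'"
        using t unfolding kw by blast
    qed
  qed
  have cod: "is_colimit K C (cod_diagram C K_diagram) y (\<lambda>k. snd (snd k))"
  proof (rule colimit_if_commutes_hom[OF category_K filtered_K F(2) cocone_K(2)])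
    fix z assume z: "fp z"
    show "commutes_hom K C (cod_diagram C K_diagram) y (\<lambda>k. snd (snd k)) z"
      unfolding commutes_hom_def
    proof (intro conjI ballI impI)
      fix g assume g: "g \<in> hom C z y"
      have xy: "x \<in> Obj C" "y \<in> Obj C" using homD[OF f(1)] by auto
      \<comment> \<open>For a map into the codomain, the initial object serves as the domain of the
        square, so nothing has to be lifted to \<open>x\<close>.\<close>
      obtain o0 where o0: "is_initial C o0" "fp o0" using initial_exists .
      obtain a u where au: "a \<in> hom C o0 z" "u \<in> hom C o0 x" using o0(1) xy fp_Obj[OF z] unfolding is_initial_def by blast
      have "f \<cdot> u = g \<cdot> a"
        using o0(1) xy(2) comp_hom[OF au(2) f(1)] comp_hom[OF au(1) g] unfolding is_initial_def by blast
      from K_approx[OF o0(2) z au g this]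
      obtain w u v t where "(w, u, v) \<in> weq_over V f" "t \<in> hom C z (Cod C w)" "v \<cdot> t = g" by metis
      then show "\<exists>k\<in>Obj K. \<exists>g'\<in>hom C z (fobj (cod_diagram C K_diagram) k). snd (snd k) \<cdot> g' = g"
        by (intro bexI[of _ "(w, u, v)"]) auto
    next
      fix k g g' assume k: "k \<in> Obj K" and g0: "g \<in> hom C z (fobj (cod_diagram C K_diagram) k)"
        "g' \<in> hom C z (fobj (cod_diagram C K_diagram) k)" and eq: "snd (snd k) \<cdot> g = snd (snd k) \<cdot> g'"
      obtain w u v where kw: "k = (w, u, v)" by (cases k)
      have kO: "(w, u, v) \<in> weq_over V f" using k kw by simp
      note kD = K_objD[OF kO]
      have g: "g \<in> hom C z (Cod C w)" "g' \<in> hom C z (Cod C w)" "v \<cdot> g = v \<cdot> g'" using g0 eq kw by auto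
      obtain d e where e: "e \<in> hom C (Cod C w) d" "e \<cdot> g = e \<cdot> g'" and d: "fp d"
        and ed: "\<forall>x. \<forall>k\<in>hom C (Cod C w) x. k \<cdot> g = k \<cdot> g' \<longrightarrow> (\<exists>h\<in>hom C d x. h \<cdot> e = k)"
        using coequalizer_exists[OF g(1,2) z kD(3)] by blast
      obtain h where h: "h \<in> hom C d y" "h \<cdot> e = v" using ed kD(5) g(3) by blast
      \<comment> \<open>Coequalizing on the codomain leaves the domain alone: the arrow under
        \<open>w\<close> is \<open>e \<cdot> w\<close>, with the identity as domain
        component.\<close>
      have cI: "Ident C (Dom C w) \<in> hom C (Dom C w) (Dom C w)" using ident_hom fp_Obj[OF kD(2)] by blast
      have ew: "(e \<cdot> w) \<cdot> Ident C (Dom C w) = e \<cdot> w" by (rule comp_ident[OF comp_hom[OF kD(1) e(1)]])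
      have fu: "f \<cdot> u = h \<cdot> (e \<cdot> w)" using triangle_ext[OF h(2) e(1) h(1) kD(1)] kD(6) by simp
      obtain w' u' v' s t where s: "t \<in> hom C d (Cod C w')"
        and t: "((w, u, v), (w', u', v'), s \<cdot> Ident C (Dom C w), t \<cdot> e) \<in> hom K (w, u, v) (w', u', v')"
        using K_extend[OF kO kD(2) d comp_hom[OF kD(1) e(1)] cI e(1) ew kD(4) h(1) fu comp_ident[OF kD(4)] h(2)] by metis
      have "(t \<cdot> e) \<cdot> g = (t \<cdot> e) \<cdot> g'"
        using comp_assoc[OF g(1) e(1) s] comp_assoc[OF g(2) e(1) s] e(2) by simp
      then have "fmor (cod_diagram C K_diagram) ((w, u, v), (w', u', v'), s \<cdot> Ident C (Dom C w), t \<cdot> e) \<cdot> g =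
          fmor (cod_diagram C K_diagram) ((w, u, v), (w', u', v'), s \<cdot> Ident C (Dom C w), t \<cdot> e) \<cdot> g'"
        unfolding K_dom_cod .
      then show "\<exists>k'. \<exists>t\<in>hom K k k'. fmor (cod_diagram C K_diagram) t \<cdot> g = fmor (cod_diagram C K_diagram) t \<cdot> g'"
        using t unfolding kw by blast
    qed
  qed
  have sq: "f \<cdot> fst (snd k) = snd (snd k) \<cdot> fobj K_diagram k" if "k \<in> Obj K" for k
    using that unfolding weq_comma_simps weq_over_def K_diagram_def by auto
  have "is_colimit K WA K_diagram f (\<lambda>k. (fobj K_diagram k, f, fst (snd k), snd (snd k)))"
    by (rule weq_colimit[OF category_K functor_K dom cod f(1) sq f(2)])
  then show ?thesis by (simp add: K_diagram_def)
qed

end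

section \<open>A small generating set and finite accessibility\<close>

context omega_model
begin

text \<open>An approximating weak equivalence is conjugated by isomorphisms of its ends with
  representatives from \<open>R\<close>. Isomorphisms are weak equivalences, so the result stays in
  \<open>W\<close>, and the maps between members of \<open>R\<close> form a small set.\<close>

lemma small_weq_representatives:
  obtains V where "V \<subseteq> fpW" and "small U V" and "\<And>f x y. f \<in> hom C x y \<Longrightarrow> f \<in> W \<Longrightarrow> approximable V x y f"
proof -
  obtain R where R: "small U R" "\<And>x. x \<in> R \<Longrightarrow> fp x"
    "\<And>x. fp x \<Longrightarrow> \<exists>r\<in>R. \<exists>f g. inverse_arrows C x r f g"
    using small_fp_representatives by metis
  define V where "V = {w \<in> W. Dom C w \<in> R \<and> Cod C w \<in> R}"
  have "V \<subseteq> fpW" unfolding V_def fpW_def using R(2) by blast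
  moreover have "small U V"
  proof -
    have "small U (\<Union>p\<in>R \<times> R. hom C (fst p) (snd p))"
      by (rule small_UN[OF universe small_Times[OF universe R(1,1)]]) (use small_hom R(2) fp_Obj in auto)
    then show ?thesis
      by (rule small_subset[rotated]) (use W_Mor in \<open>auto simp: V_def hom_def\<close>)
  qed
  moreover have "approximable V x y f" if f: "f \<in> hom C x y" "f \<in> W" for f x y
  proof (rule approximableI[OF f(1)])
    fix c d a u v
    assume h: "fp c" "fp d" "a \<in> hom C c d" "u \<in> hom C c x" "v \<in> hom C d y" "f \<cdot> u = v \<cdot> a"
    obtain c' d' w s t u' v' where w: "w \<in> fpW" "w \<in> hom C c' d'" "s \<in> hom C c c'" "t \<in> hom C d d'"
      "u' \<in> hom C c' x" "v' \<in> hom C d' y" "w \<cdot> s = t \<cdot> a" "f \<cdot> u' = v' \<cdot> w" "u' \<cdot> s = u" "v' \<cdot> t = v"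
      using approximableE[OF weak_equivalence_approximable[OF f(2,1)] h] .
    have wW: "w \<in> W" "fp c'" "fp d'" using fpWD[OF w(1,2)] by auto
    obtain c1 p p' where p: "c1 \<in> R" "inverse_arrows C c' c1 p p'" using R(3)[OF wW(2)] by blast
    obtain d1 q q' where q: "d1 \<in> R" "inverse_arrows C d' d1 q q'" using R(3)[OF wW(3)] by blast
    note P = inverse_arrowsD[OF p(2)] and Q = inverse_arrowsD[OF q(2)]
    have p'W: "p' \<in> W"
      using W_two_out_of_three(2)[OF P(1,2)] inverse_arrows_trivial_Cof[OF p(2)] P(3) W_ident fp_Obj[OF wW(2)] by simp
    have qW: "q \<in> W" using inverse_arrows_trivial_Cof[OF q(2)] by blast
    have wp: "w \<cdot> p' \<in> hom C c1 d'" "w \<cdot> p' \<in> W"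
      using comp_hom[OF P(2) w(2)] W_two_out_of_three(1)[OF P(2) w(2) p'W wW(1)] by auto
    have w1: "q \<cdot> (w \<cdot> p') \<in> hom C c1 d1" "q \<cdot> (w \<cdot> p') \<in> W"
      using comp_hom[OF wp(1) Q(1)] W_two_out_of_three(1)[OF wp(1) Q(1) wp(2) qW] by auto
    then have wV: "q \<cdot> (w \<cdot> p') \<in> V" unfolding V_def using p(1) q(1) by (simp add: hom_def)
    have pp: "p' \<cdot> (p \<cdot> s) = s" using triangle_ext[OF P(3,1,2) w(3)] ident_comp[OF w(3)] by simp
    have qq: "q' \<cdot> (q \<cdot> r) = r" if "r \<in> hom C e d'" for r e
      using triangle_ext[OF Q(3,1,2) that] ident_comp[OF that] by simp
    note ps = comp_hom[OF w(3) P(1)]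
    show "approximates V x y f c d a u v"
    proof (rule approximatesI[OF wV w1(1) ps comp_hom[OF w(4) Q(1)] comp_hom[OF P(2) w(5)] comp_hom[OF Q(2) w(6)]])
      show "(q \<cdot> (w \<cdot> p')) \<cdot> (p \<cdot> s) = (q \<cdot> t) \<cdot> a"
        using comp_assoc[OF ps wp(1) Q(1)] comp_assoc[OF ps P(2) w(2)] pp w(7) comp_assoc[OF h(3) w(4) Q(1)] by simp
      show "f \<cdot> (u' \<cdot> p') = (v' \<cdot> q') \<cdot> (q \<cdot> (w \<cdot> p'))"
        using comp_assoc[OF w1(1) Q(2) w(6)] qq[OF wp(1)] square_ext[OF w(8,5) f(1) w(2,6) P(2)] by simp
      show "(u' \<cdot> p') \<cdot> (p \<cdot> s) = u" using comp_assoc[OF ps P(2) w(5)] pp w(9) by simp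
      show "(v' \<cdot> q') \<cdot> (q \<cdot> t) = v" using comp_assoc[OF comp_hom[OF w(4) Q(1)] Q(2) w(6)] qq[OF w(4)] w(10) by simp
    qed
  qed
  ultimately show ?thesis using that by metis
qed

theorem finitely_accessible_WA: "finitely_accessible U WA"
proof -
  obtain V where V: "V \<subseteq> fpW" "small U V" "\<And>f x y. f \<in> hom C x y \<Longrightarrow> f \<in> W \<Longrightarrow> approximable V x y f"
    using small_weq_representatives by metis
  have "generates_under_filtered_colimits U WA V"
    unfolding generates_under_filtered_colimits_def
  proof
    fix f assume "f \<in> Obj WA"
    then have f: "f \<in> hom C (Dom C f) (Cod C f)" "f \<in> W" using hom_Mor by auto
    interpret P: weq_presentation C U W Fib Cof V f "Dom C f" "Cod C f"
      by unfold_locales (fact V(1,2) f V(3)[OF f])+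
    \<comment> \<open>The comma category lives on tuples of morphisms, while generation asks for an
      index category on \<open>'u\<close>; an isomorphic copy there carries the diagram and its
      colimit.\<close>
    obtain I :: "('u, 'u) cat" and po pm where I: "small_category U I" and iso: "index_iso I P.K po pm"
      using small_index_iso[OF P.category_K P.small_K] .
    have I': "category I" using I unfolding small_category_def by blast
    have "filtered I" by (rule filtered_index_iso[OF iso P.category_K I' P.filtered_K])
    moreover have "is_functor I WA (reindex po pm P.K_diagram)"
      by (rule functor_reindex[OF iso P.category_K I' P.functor_K])
    moreover have "\<forall>i\<in>Obj I. fobj (reindex po pm P.K_diagram) i \<in> V"
    proof
      fix i assume "i \<in> Obj I"
      then have "po i \<in> weq_over V f" using index_iso_inv_into(2)[OF iso] by simp
      then show "fobj (reindex po pm P.K_diagram) i \<in> V"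
        by (cases "po i") (simp add: reindex_def P.K_diagram_def weq_over_def)
    qed
    moreover have "is_colimit I WA (reindex po pm P.K_diagram) f
        ((\<lambda>k. (fst k, f, fst (snd k), snd (snd k))) \<circ> po)"
      by (rule iffD2[OF colimit_reindex[OF iso P.category_K I'] P.colimit_K])
    ultimately show "\<exists>(J :: ('u, 'u) cat) D l. small_category U J \<and> filtered J \<and> is_functor J WA D \<and>
        (\<forall>j\<in>Obj J. fobj D j \<in> V) \<and> is_colimit J WA D f l"
      using I by blast
  qed
  then show ?thesis
    unfolding finitely_accessible_def
    using category_WA locally_small_WA has_filtered_colimits_WA V(1,2) finitely_presentable_WA by blast
qed

end

theorem theorem1p7:
  fixes U :: "'u itself"
    and M :: "('o, 'm) cat" and W Fib Cof :: "'m set"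
    and cyl :: "'o \<Rightarrow> 'o" and i0 i1 p :: "'o \<Rightarrow> 'm"
  assumes "universe U"
    and "omega_combinatorial U M W Fib Cof"
    and "left_proper M W Cof"
    and cylinder: "\<And>B. B \<in> Obj (fp_category U M) \<Longrightarrow>
      is_cylinder (fp_category U M) (W \<inter> Mor (fp_category U M)) Cof B (cyl B) (i0 B) (i1 B) (p B)"
    and "has_finite_limits (fp_category U M)"
    and "\<And>B. B \<in> Obj (fp_category U M) \<Longrightarrow> cofibrant M Cof B"
    and right_proper: "\<And>A B f j k q.
      f \<in> hom (fp_category U M) A B \<Longrightarrow>
      is_pushout (fp_category U M) f (i0 A) j k \<Longrightarrow>
      q \<in> hom (fp_category U M) (Cod M j) B \<Longrightarrow>
      q \<cdot>\<^bsub>M\<^esub> j = Ident M B \<Longrightarrow>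
      q \<cdot>\<^bsub>M\<^esub> k = f \<cdot>\<^bsub>M\<^esub> p A \<Longrightarrow>
      right_proper_map (fp_category U M) (W \<inter> Mor (fp_category U M)) q"
  shows "finitely_accessible U (full_subcategory (arrow_category M) W)"
proof -
  have "category M" "locally_finitely_presentable U M"
    using assms(2) unfolding omega_combinatorial_def model_category_def by blast+
  moreover have "B \<in> Obj (fp_category U M)" if "finitely_presentable U M B" for B
    using that unfolding fp_category_simps finitely_presentable_def by blast
  ultimately have "omega_model M U W Fib Cof"
    using assms(1-4,6)
    by (intro omega_model.intro lfp_category.intro lfp_category_axioms.intro omega_model_axioms.intro) blast+
  then show ?thesis by (rule omega_model.finitely_accessible_WA)
qed

end
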